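(* Let $d\ge1$ and let $A_1,\dots,A_k\in\mathrm{SO}(d+1)$ generate a dense subgroup of $\mathrm{SO}(d+1)$. Then for any $A_0\in\mathrm{SL}(d+1,\mathbb R)\setminus\mathrm{SO}(d+1)$, the natural action on $\mathbb S^d$ of the group generated by $\{A_0,A_1,\dots,A_k\}$ is $\mathcal C^1$-stably ergodic in $\mathrm{Diff}^{1+\alpha}(\mathbb S^d)$ and $\mathcal C^1$-robustly minimal.
   Context: The action of $A\in\mathrm{SL}(d+1,\mathbb R)$ on $\mathbb S^d$ is $f_A(x)=Ax/|Ax|$. $\mathcal C^1$-stably ergodic in $\mathrm{Diff}^{1+\alpha}$: for all $\mathcal C^{1+\alpha}$ diffeomorphisms $\tilde f_0,\dots,\tilde f_k$ $\mathcal C^1$-close to $f_{A_0},\dots,f_{A_k}$, the group they generate acts ergodically w.r.t. Lebesgue (invariant measurable sets have zero or full measure). $\mathcal C^1$-robustly minimal: for all $\mathcal C^1$ diffeomorphisms $\mathcal C^1$-close to them, every orbit of the generated group is dense. *)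

theory Defs
  imports "HOL-Analysis.Analysis"
begin

text \<open>The sphere S^d as the unit sphere of real^'n, with CARD('n) = d+1.\<close>
definition sph :: "(real^'n) set" where
  "sph = sphere 0 1"

text \<open>Degree-0 homogeneous extension of a map on the sphere to R^(d+1) minus 0;
  C^1 regularity and C^1 distances on the sphere are measured through it.\<close>
definition radext :: "(real^'n \<Rightarrow> real^'n) \<Rightarrow> real^'n \<Rightarrow> real^'n" where
  "radext f x = f (x /\<^sub>R norm x)"

definition sph_deriv :: "(real^'n \<Rightarrow> real^'n) \<Rightarrow> (real^'n \<Rightarrow> ((real^'n) \<Rightarrow>\<^sub>L (real^'n))) \<Rightarrow> bool" where
  "sph_deriv f D \<longleftrightarrow> continuous_on (-{0}) D \<and>
     (\<forall>x. x \<noteq> 0 \<longrightarrow> (radext f has_derivative blinfun_apply (D x)) (at x))"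

definition C1_sph :: "(real^'n \<Rightarrow> real^'n) \<Rightarrow> bool" where
  "C1_sph f \<longleftrightarrow> f ` sph \<subseteq> sph \<and> (\<exists>D. sph_deriv f D)"

definition diffeo_sph :: "(real^'n \<Rightarrow> real^'n) \<Rightarrow> bool" where
  "diffeo_sph f \<longleftrightarrow> bij_betw f sph sph \<and> C1_sph f \<and> C1_sph (inv_into sph f)"

definition C1_close :: "real \<Rightarrow> (real^'n \<Rightarrow> real^'n) \<Rightarrow> (real^'n \<Rightarrow> real^'n) \<Rightarrow> bool" where
  "C1_close \<epsilon> f g \<longleftrightarrow> (\<exists>Df Dg. sph_deriv f Df \<and> sph_deriv g Dg \<and>
     (\<forall>x\<in>sph. norm (f x - g x) < \<epsilon> \<and> norm (Df x - Dg x) < \<epsilon>))"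

definition holder_C1 :: "real \<Rightarrow> (real^'n \<Rightarrow> real^'n) \<Rightarrow> bool" where
  "holder_C1 \<alpha> f \<longleftrightarrow> (\<exists>D C. sph_deriv f D \<and>
     (\<forall>x\<in>sph. \<forall>y\<in>sph. norm (D x - D y) \<le> C * dist x y powr \<alpha>))"

definition C1alpha_diffeo :: "real \<Rightarrow> (real^'n \<Rightarrow> real^'n) \<Rightarrow> bool" where
  "C1alpha_diffeo \<alpha> f \<longleftrightarrow> diffeo_sph f \<and> holder_C1 \<alpha> f \<and> holder_C1 \<alpha> (inv_into sph f)"

definition proj_action :: "real^'n^'n \<Rightarrow> real^'n \<Rightarrow> real^'n" where
  "proj_action A x = (A *v x) /\<^sub>R norm (A *v x)"

text \<open>Cone over a subset of the sphere; its Lebesgue measure is a constant multiple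
  of the surface (Lebesgue) measure of the subset.\<close>
definition cone_sph :: "(real^'n) set \<Rightarrow> (real^'n) set" where
  "cone_sph E = {t *\<^sub>R x | t x. 0 < t \<and> t \<le> 1 \<and> x \<in> E}"

inductive_set orbit_of :: "('i \<Rightarrow> real^'n \<Rightarrow> real^'n) \<Rightarrow> 'i set \<Rightarrow> real^'n \<Rightarrow> (real^'n) set"
  for g I x where
  base: "x \<in> orbit_of g I x"
| fwd: "y \<in> orbit_of g I x \<Longrightarrow> i \<in> I \<Longrightarrow> g i y \<in> orbit_of g I x"
| bwd: "y \<in> orbit_of g I x \<Longrightarrow> i \<in> I \<Longrightarrow> inv_into sph (g i) y \<in> orbit_of g I x"

definition ergodic_action :: "('i \<Rightarrow> real^'n \<Rightarrow> real^'n) \<Rightarrow> 'i set \<Rightarrow> bool" where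
  "ergodic_action g I \<longleftrightarrow> (\<forall>E. E \<subseteq> sph \<and> cone_sph E \<in> sets lebesgue \<and> (\<forall>i\<in>I. g i ` E = E)
      \<longrightarrow> emeasure lebesgue (cone_sph E) = 0 \<or> emeasure lebesgue (cone_sph (sph - E)) = 0)"

definition minimal_action :: "('i \<Rightarrow> real^'n \<Rightarrow> real^'n) \<Rightarrow> 'i set \<Rightarrow> bool" where
  "minimal_action g I \<longleftrightarrow> (\<forall>x\<in>sph. sph \<subseteq> closure (orbit_of g I x))"

definition SO :: "(real^'n^'n) set" where
  "SO = {M. orthogonal_matrix M \<and> det M = 1}"

inductive_set gen_group :: "('i \<Rightarrow> real^'n^'n) \<Rightarrow> 'i set \<Rightarrow> (real^'n^'n) set"
  for A I where
  one: "mat 1 \<in> gen_group A I"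
| mul: "M \<in> gen_group A I \<Longrightarrow> i \<in> I \<Longrightarrow> A i ** M \<in> gen_group A I"
| mulinv: "M \<in> gen_group A I \<Longrightarrow> i \<in> I \<Longrightarrow> matrix_inv (A i) ** M \<in> gen_group A I"

end

theory Submission
  imports Defs
begin

text \<open>
  Composing \<open>A 0\<close> with suitable rotations one finds a product whose largest singular value is
  simple; its action contracts a neighbourhood of the corresponding direction \<open>v\<close>. Following it by
  finitely many products of the generators \<open>A 1, \<dots>, A k\<close> gives words that contract a ball around \<open>v\<close>
  and map a smaller ball onto sets covering the sphere, and both properties survive small
  \<open>C\<^sup>1\<close> perturbations. Pulling a point back along such words and pushing a ball forward gives
  minimality.

  For ergodicity, no conformality of the contractions is needed. Let \<open>p j\<close> be a Lipschitz partition of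
  unity subordinate to the cover by the images of the words \<open>h j\<close>, and consider the operator
  \<open>L \<psi> y = (\<Sum>j. p j (h j y) * J j y * \<psi> (h j y))\<close> with \<open>J j\<close> the Jacobian of \<open>h j\<close>. It preserves
  the integral of \<open>\<psi>\<close> over every invariant set. Since it evaluates \<open>\<psi>\<close> along contractions and its
  weights are Hoelder continuous, a lower bound for \<open>\<psi>\<close> on balls of radius \<open>\<kappa> * \<rho>\<close> becomes one for
  \<open>L \<psi>\<close> on balls of radius \<open>\<rho>\<close>, at the cost of a factor \<open>1 - C * \<rho> powr \<alpha>\<close> in its integral. Starting
  from the indicator of a thin neighbourhood of a compact subset of an invariant set \<open>E\<close> and iterating,
  one obtains balls of a fixed radius in which the complement of \<open>E\<close> has arbitrarily small measure,
  hence a ball almost contained in \<open>E\<close>; minimality then spreads it over the sphere.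
\<close>

section \<open>Hoelder functions\<close>

text \<open>The usual way to ergodicity magnifies small balls around a density point of
  \<open>E\<close> by inverses of contractions. Without conformality the magnified sets may become
  ever thinner ellipsoids, and high density in those says nothing about a ball of fixed size.
  Averaging over all words of a given length avoids the shapes of images: what matters is how close
  two points become under a contraction, and how much the weights differ at two nearby points. The
  errors committed at the scales \<kappa>^i * \<rho> are of order (\<kappa>^i * \<rho>) powr
  \<alpha> and form a geometric series, so the loss is bounded however many iterations are made.
  This summability is what Hoelder derivatives are for; minimality gets by with C^1 maps.

  The contraction itself comes from a dimension count: \<open>A 0\<close> not being orthogonal makes
  its space of maximally stretched vectors proper, and rotations can then be used to lower the
  dimension of such a space until it is a line.\<close>

definition holder_on :: "real \<Rightarrow> 'a::metric_space set \<Rightarrow> ('a \<Rightarrow> real) \<Rightarrow> bool" where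
  "holder_on \<alpha> S f \<longleftrightarrow> (\<exists>B. \<forall>x\<in>S. \<bar>f x\<bar> \<le> B) \<and>
     (\<exists>C. \<forall>x\<in>S. \<forall>y\<in>S. \<bar>f x - f y\<bar> \<le> C * dist x y powr \<alpha>)"

lemma holder_onI:
  assumes "\<And>x. x \<in> S \<Longrightarrow> \<bar>f x\<bar> \<le> B"
    and "\<And>x y. x \<in> S \<Longrightarrow> y \<in> S \<Longrightarrow> \<bar>f x - f y\<bar> \<le> C * dist x y powr \<alpha>"
  shows "holder_on \<alpha> S f"
  using assms unfolding holder_on_def by blast

lemma holder_onE:
  assumes "holder_on \<alpha> S f"
  obtains B C where "B \<ge> 0" "C \<ge> 0" "\<And>x. x \<in> S \<Longrightarrow> \<bar>f x\<bar> \<le> B"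
    "\<And>x y. x \<in> S \<Longrightarrow> y \<in> S \<Longrightarrow> \<bar>f x - f y\<bar> \<le> C * dist x y powr \<alpha>"
proof -
  obtain B where B: "\<forall>x\<in>S. \<bar>f x\<bar> \<le> B" using assms unfolding holder_on_def by blast
  obtain C where C: "\<forall>x\<in>S. \<forall>y\<in>S. \<bar>f x - f y\<bar> \<le> C * dist x y powr \<alpha>"
    using assms unfolding holder_on_def by blast
  have "\<bar>f x - f y\<bar> \<le> max 0 C * dist x y powr \<alpha>" if "x \<in> S" "y \<in> S" for x y
  proof -
    have "\<bar>f x - f y\<bar> \<le> C * dist x y powr \<alpha>" using C that by auto
    also have "\<dots> \<le> max 0 C * dist x y powr \<alpha>" by (simp add: mult_right_mono)
    finally show ?thesis .
  qed
  moreover have "\<bar>f x\<bar> \<le> max 0 B" if "x \<in> S" for x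
    using B that by (simp add: le_max_iff_disj)
  ultimately show ?thesis by (intro that[of "max 0 B" "max 0 C"]) auto
qed

lemma holder_on_const: "holder_on \<alpha> S (\<lambda>x. c)"
  by (rule holder_onI[where B="\<bar>c\<bar>" and C=0]) auto

lemma holder_on_add:
  assumes "holder_on \<alpha> S f" "holder_on \<alpha> S g"
  shows "holder_on \<alpha> S (\<lambda>x. f x + g x)"
proof -
  obtain B C where p: "B \<ge> 0" "C \<ge> 0" and f: "\<And>x. x \<in> S \<Longrightarrow> \<bar>f x\<bar> \<le> B"
    "\<And>x y. x \<in> S \<Longrightarrow> y \<in> S \<Longrightarrow> \<bar>f x - f y\<bar> \<le> C * dist x y powr \<alpha>"
    by (fact holder_onE[OF assms(1)])
  obtain B' C' where p': "B' \<ge> 0" "C' \<ge> 0" and g: "\<And>x. x \<in> S \<Longrightarrow> \<bar>g x\<bar> \<le> B'"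
    "\<And>x y. x \<in> S \<Longrightarrow> y \<in> S \<Longrightarrow> \<bar>g x - g y\<bar> \<le> C' * dist x y powr \<alpha>"
    by (fact holder_onE[OF assms(2)])
  show ?thesis
  proof (rule holder_onI[where B="B+B'" and C="C+C'"])
    show "\<bar>f x + g x\<bar> \<le> B + B'" if "x \<in> S" for x
      using f(1)[OF that] g(1)[OF that] by linarith
    show "\<bar>f x + g x - (f y + g y)\<bar> \<le> (C + C') * dist x y powr \<alpha>" if "x \<in> S" "y \<in> S" for x y
      using f(2)[OF that] g(2)[OF that] by (simp add: distrib_right)
  qed
qed

text \<open>Products are the reason why boundedness is part of \<open>holder_on\<close>: splitting
  the difference as (f x - f y) g x + f y (g x - g y) needs a bound on each factor.\<close>

lemma holder_on_mult:
  assumes "holder_on \<alpha> S f" "holder_on \<alpha> S g"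
  shows "holder_on \<alpha> S (\<lambda>x. f x * g x)"
proof -
  obtain B C where p: "B \<ge> 0" "C \<ge> 0" and f: "\<And>x. x \<in> S \<Longrightarrow> \<bar>f x\<bar> \<le> B"
    "\<And>x y. x \<in> S \<Longrightarrow> y \<in> S \<Longrightarrow> \<bar>f x - f y\<bar> \<le> C * dist x y powr \<alpha>"
    by (fact holder_onE[OF assms(1)])
  obtain B' C' where p': "B' \<ge> 0" "C' \<ge> 0" and g: "\<And>x. x \<in> S \<Longrightarrow> \<bar>g x\<bar> \<le> B'"
    "\<And>x y. x \<in> S \<Longrightarrow> y \<in> S \<Longrightarrow> \<bar>g x - g y\<bar> \<le> C' * dist x y powr \<alpha>"
    by (fact holder_onE[OF assms(2)])
  show ?thesis
  proof (rule holder_onI[where B="B*B'" and C="C*B'+B*C'"])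
    show "\<bar>f x * g x\<bar> \<le> B * B'" if "x \<in> S" for x
      using f(1)[OF that] g(1)[OF that] by (simp add: abs_mult mult_mono p)
    show "\<bar>f x * g x - f y * g y\<bar> \<le> (C*B'+B*C') * dist x y powr \<alpha>" if "x \<in> S" "y \<in> S" for x y
    proof -
      have "\<bar>f x * g x - f y * g y\<bar> = \<bar>(f x - f y) * g x + f y * (g x - g y)\<bar>"
        by (simp add: algebra_simps)
      also have "\<dots> \<le> \<bar>f x - f y\<bar> * \<bar>g x\<bar> + \<bar>f y\<bar> * \<bar>g x - g y\<bar>"
        by (metis abs_mult abs_triangle_ineq)
      also have "\<dots> \<le> (C * dist x y powr \<alpha>) * B' + B * (C' * dist x y powr \<alpha>)"
        by (intro add_mono mult_mono f g that p p') (auto simp: p p')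
      finally show ?thesis by (simp add: algebra_simps)
    qed
  qed
qed

lemma holder_on_sum:
  assumes "\<And>i. i \<in> I \<Longrightarrow> holder_on \<alpha> S (f i)"
  shows "holder_on \<alpha> S (\<lambda>x. \<Sum>i\<in>I. f i x)"
  using assms by (induction I rule: infinite_finite_induct)
    (auto intro: holder_on_const holder_on_add)

lemma holder_on_prod:
  assumes "\<And>i. i \<in> I \<Longrightarrow> holder_on \<alpha> S (f i)"
  shows "holder_on \<alpha> S (\<lambda>x. \<Prod>i\<in>I. f i x)"
  using assms by (induction I rule: infinite_finite_induct)
    (auto intro: holder_on_const holder_on_mult)

lemma holder_on_abs:
  assumes "holder_on \<alpha> S f"
  shows "holder_on \<alpha> S (\<lambda>x. \<bar>f x\<bar>)"
proof -
  obtain B C where p: "B \<ge> 0" "C \<ge> 0" and f: "\<And>x. x \<in> S \<Longrightarrow> \<bar>f x\<bar> \<le> B"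
    "\<And>x y. x \<in> S \<Longrightarrow> y \<in> S \<Longrightarrow> \<bar>f x - f y\<bar> \<le> C * dist x y powr \<alpha>"
    by (fact holder_onE[OF assms(1)])
  show ?thesis
    by (rule holder_onI[where B=B and C=C]) (use f in \<open>auto intro: order_trans[OF abs_triangle_ineq3]\<close>)
qed

lemma holder_on_inverse:
  assumes "holder_on \<alpha> S f" "c > 0" "\<And>x. x \<in> S \<Longrightarrow> c \<le> f x"
  shows "holder_on \<alpha> S (\<lambda>x. inverse (f x))"
proof -
  obtain B C where p: "B \<ge> 0" "C \<ge> 0" and f: "\<And>x. x \<in> S \<Longrightarrow> \<bar>f x\<bar> \<le> B"
    "\<And>x y. x \<in> S \<Longrightarrow> y \<in> S \<Longrightarrow> \<bar>f x - f y\<bar> \<le> C * dist x y powr \<alpha>"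
    by (fact holder_onE[OF assms(1)])
  show ?thesis
  proof (rule holder_onI[where B="inverse c" and C="C * (inverse c * inverse c)"])
    show "\<bar>inverse (f x)\<bar> \<le> inverse c" if "x \<in> S" for x
      using assms(2) assms(3)[OF that] by (simp add: le_imp_inverse_le)
    show "\<bar>inverse (f x) - inverse (f y)\<bar> \<le> C * (inverse c * inverse c) * dist x y powr \<alpha>"
      if "x \<in> S" "y \<in> S" for x y
    proof -
      have pos: "f x > 0" "f y > 0" using assms(2) assms(3)[OF that(1)] assms(3)[OF that(2)] by linarith+
      have "inverse (f x) - inverse (f y) = - (f x - f y) * (inverse (f x) * inverse (f y))"
        using pos by (simp add: field_simps)
      then have "\<bar>inverse (f x) - inverse (f y)\<bar> = \<bar>f x - f y\<bar> * (inverse (f x) * inverse (f y))"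
        using pos by (simp add: abs_mult)
      also have "\<dots> \<le> (C * dist x y powr \<alpha>) * (inverse c * inverse c)"
        using pos assms(2) assms(3)[OF that(1)] assms(3)[OF that(2)]
        by (intro mult_mono f(2) that le_imp_inverse_le) (auto simp: p)
      finally show ?thesis by (simp add: algebra_simps)
    qed
  qed
qed

lemma holder_on_compose:
  assumes "holder_on \<alpha> S f" "\<alpha> > 0" "\<And>x. x \<in> S \<Longrightarrow> h x \<in> S"
    and "\<And>x y. x \<in> S \<Longrightarrow> y \<in> S \<Longrightarrow> dist (h x) (h y) \<le> L * dist x y"
  shows "holder_on \<alpha> S (\<lambda>x. f (h x))"
proof -
  obtain B C where p: "B \<ge> 0" "C \<ge> 0" and f: "\<And>x. x \<in> S \<Longrightarrow> \<bar>f x\<bar> \<le> B"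
    "\<And>x y. x \<in> S \<Longrightarrow> y \<in> S \<Longrightarrow> \<bar>f x - f y\<bar> \<le> C * dist x y powr \<alpha>"
    by (fact holder_onE[OF assms(1)])
  show ?thesis
  proof (rule holder_onI[where B=B and C="C * (max 0 L) powr \<alpha>"])
    show "\<bar>f (h x)\<bar> \<le> B" if "x \<in> S" for x using f(1) assms(3) that by auto
    show "\<bar>f (h x) - f (h y)\<bar> \<le> C * max 0 L powr \<alpha> * dist x y powr \<alpha>"
      if "x \<in> S" "y \<in> S" for x y
    proof -
      have "dist (h x) (h y) \<le> max 0 L * dist x y"
        by (rule order_trans[OF assms(4)[OF that]]) (simp add: mult_right_mono)
      then have "dist (h x) (h y) powr \<alpha> \<le> (max 0 L * dist x y) powr \<alpha>"
        by (intro powr_mono2) (use assms(2) in auto)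
      also have "\<dots> = max 0 L powr \<alpha> * dist x y powr \<alpha>" by (simp add: powr_mult)
      finally have "C * dist (h x) (h y) powr \<alpha> \<le> C * (max 0 L powr \<alpha> * dist x y powr \<alpha>)"
        by (rule mult_left_mono) (rule p)
      with f(2)[of "h x" "h y"] that assms(3) show ?thesis by (simp add: mult.assoc)
    qed
  qed
qed

text \<open>On a set of diameter at most e, a distance d is the product of d powr (1 - \<alpha>), at
  most e powr (1 - \<alpha>), and d powr \<alpha>; here \<alpha> \<le> 1 enters.\<close>

lemma holder_on_lipschitz:
  assumes "bounded S" "0 < \<alpha>" "\<alpha> \<le> 1"
    and "\<And>x y. x \<in> S \<Longrightarrow> y \<in> S \<Longrightarrow> \<bar>f x - f y\<bar> \<le> L * dist x y"
  shows "holder_on \<alpha> S f"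
proof (cases "S = {}")
  case True
  then show ?thesis by (simp add: holder_on_def)
next
  case False
  then obtain x0 where x0: "x0 \<in> S" by auto
  obtain e where e: "\<And>x y. x \<in> S \<Longrightarrow> y \<in> S \<Longrightarrow> dist x y \<le> e"
    using assms(1) by (meson bounded_two_points)
  have e0: "e \<ge> 0" using e[OF x0 x0] by simp
  have lip: "\<bar>f x - f y\<bar> \<le> max 0 L * dist x y" if "x \<in> S" "y \<in> S" for x y
    by (rule order_trans[OF assms(4)[OF that]]) (simp add: mult_right_mono)
  show ?thesis
  proof (rule holder_onI[where B="\<bar>f x0\<bar> + max 0 L * e" and C="max 0 L * e powr (1-\<alpha>)"])
    show "\<bar>f x\<bar> \<le> \<bar>f x0\<bar> + max 0 L * e" if "x \<in> S" for x
      using lip[OF that x0] mult_left_mono[OF e[OF that x0], of "max 0 L"] by linarith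
    show "\<bar>f x - f y\<bar> \<le> max 0 L * e powr (1-\<alpha>) * dist x y powr \<alpha>" if "x \<in> S" "y \<in> S" for x y
    proof -
      have "dist x y = dist x y powr (1-\<alpha>) * dist x y powr \<alpha>"
        by (cases "x = y") (simp_all add: powr_add[symmetric])
      also have "\<dots> \<le> e powr (1-\<alpha>) * dist x y powr \<alpha>"
        by (intro mult_right_mono powr_mono2) (use assms e that in auto)
      finally have "max 0 L * dist x y \<le> max 0 L * (e powr (1-\<alpha>) * dist x y powr \<alpha>)"
        by (rule mult_left_mono) simp
      with lip[OF that] show ?thesis by (simp add: mult.assoc)
    qed
  qed
qed

lemma holder_on_continuous_on:
  assumes "holder_on \<alpha> S f" "0 < \<alpha>"
  shows "continuous_on S f"
proof -
  obtain B C where p: "B \<ge> 0" "C \<ge> 0" and f: "\<And>x. x \<in> S \<Longrightarrow> \<bar>f x\<bar> \<le> B"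
    "\<And>x y. x \<in> S \<Longrightarrow> y \<in> S \<Longrightarrow> \<bar>f x - f y\<bar> \<le> C * dist x y powr \<alpha>"
    by (fact holder_onE[OF assms(1)])
  show ?thesis unfolding continuous_on_def
  proof
    fix x assume x: "x \<in> S"
    have "((\<lambda>y. C * dist y x powr \<alpha>) \<longlongrightarrow> C * dist x x powr \<alpha>) (at x within S)"
      by (intro tendsto_intros tendsto_powr2) (use assms(2) in auto)
    then have "((\<lambda>y. C * dist y x powr \<alpha>) \<longlongrightarrow> 0) (at x within S)" by simp
    moreover have "\<forall>\<^sub>F y in at x within S. norm (f y - f x) \<le> C * dist y x powr \<alpha>"
      using f(2) x by (auto simp: eventually_at_filter)
    ultimately have "((\<lambda>y. f y - f x) \<longlongrightarrow> 0) (at x within S)"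
      by (rule Lim_null_comparison[rotated])
    then show "(f \<longlongrightarrow> f x) (at x within S)" by (simp add: LIM_zero_iff)
  qed
qed

section \<open>The transfer operator of a contracting cover\<close>

lemma lipschitz_continuous_on:
  assumes "\<And>y z. y \<in> S \<Longrightarrow> z \<in> S \<Longrightarrow> dist (h y) (h z) \<le> L * dist y z"
  shows "continuous_on S h"
proof -
  have "(max 0 L)-lipschitz_on S h"
  proof (rule lipschitz_onI)
    fix y z assume "y \<in> S" "z \<in> S"
    then have "dist (h y) (h z) \<le> L * dist y z" by (rule assms)
    also have "\<dots> \<le> max 0 L * dist y z" by (simp add: mult_right_mono)
    finally show "dist (h y) (h z) \<le> max 0 L * dist y z" .
  qed simp
  then show ?thesis by (rule lipschitz_on_continuous_on)
qed

text \<open>The metric and measure-theoretic core of the ergodicity argument, free of smooth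
  structure. \<open>k j\<close> stands for the inverse of \<open>h j\<close>;
  \<open>change_of_variables\<close> makes \<open>J j\<close> its Jacobian, and
  \<open>pullback_bounded\<close> says that the image of \<open>M\<close> under \<open>h j\<close>
  is at most a multiple of \<open>M\<close>. The radii leave room for each other: covering within
  \<delta>/2, cutoffs supported within \<delta>, contraction up to 2 * \<delta>.\<close>

locale contracting_cover =
  fixes S :: "'a::{metric_space, second_countable_topology} set" and M :: "'a measure"
    and W :: "'j set" and h k :: "'j \<Rightarrow> 'a \<Rightarrow> 'a" and J :: "'j \<Rightarrow> 'a \<Rightarrow> real"
    and x :: 'a and \<alpha> \<delta> \<kappa> :: real
  assumes compact_S: "compact S"
    and finite_M: "finite_measure M"
    and sets_M: "sets M = sets (restrict_space borel S)"
    and finite_W: "finite W"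
    and h_S: "\<And>j y. j \<in> W \<Longrightarrow> y \<in> S \<Longrightarrow> h j y \<in> S"
    and k_S: "\<And>j y. j \<in> W \<Longrightarrow> y \<in> S \<Longrightarrow> k j y \<in> S"
    and k_h: "\<And>j y. j \<in> W \<Longrightarrow> y \<in> S \<Longrightarrow> k j (h j y) = y"
    and h_lipschitz: "\<And>j. j \<in> W \<Longrightarrow> \<exists>L. \<forall>y\<in>S. \<forall>z\<in>S. dist (h j y) (h j z) \<le> L * dist y z"
    and k_lipschitz: "\<And>j. j \<in> W \<Longrightarrow> \<exists>L. \<forall>y\<in>S. \<forall>z\<in>S. dist (k j y) (k j z) \<le> L * dist y z"
    and J_nonneg: "\<And>j y. j \<in> W \<Longrightarrow> y \<in> S \<Longrightarrow> J j y \<ge> 0"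
    and J_holder: "\<And>j. j \<in> W \<Longrightarrow> holder_on \<alpha> S (J j)"
    and change_of_variables: "\<And>j \<phi>. j \<in> W \<Longrightarrow> \<phi> \<in> borel_measurable M \<Longrightarrow>
          (\<integral>\<^sup>+y. ennreal (J j y) * \<phi> (h j y) \<partial>M) = integral\<^sup>N M \<phi>"
    and pullback_bounded: "\<And>j. j \<in> W \<Longrightarrow> \<exists>C\<ge>0. \<forall>\<phi>\<in>borel_measurable M.
          (\<integral>\<^sup>+y. \<phi> (h j y) \<partial>M) \<le> ennreal C * integral\<^sup>N M \<phi>"
    and \<alpha>_bounds: "0 < \<alpha>" "\<alpha> \<le> 1"
    and \<delta>_pos: "0 < \<delta>"
    and \<kappa>_bounds: "0 < \<kappa>" "\<kappa> < 1"
    and contraction: "\<And>j y z. j \<in> W \<Longrightarrow> y \<in> S \<Longrightarrow> z \<in> S \<Longrightarrow> dist y x \<le> 2*\<delta> \<Longrightarrow> dist z x \<le> 2*\<delta>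
          \<Longrightarrow> dist (h j y) (h j z) \<le> \<kappa> * dist y z"
    and cover: "\<And>z. z \<in> S \<Longrightarrow> \<exists>j\<in>W. dist (k j z) x < \<delta>/2"
begin

lemma space_M: "space M = S"
  using sets_eq_imp_space_eq[OF sets_M] by (simp add: space_restrict_space)

lemma continuous_measurable_M: "continuous_on S f \<Longrightarrow> f \<in> borel_measurable M"
  for f :: "'a \<Rightarrow> 'b::topological_space"
  by (subst measurable_cong_sets[OF sets_M refl]) (rule borel_measurable_continuous_on_restrict)

lemma h_measurable: "j \<in> W \<Longrightarrow> h j \<in> measurable M M"
proof -
  assume j: "j \<in> W"
  obtain L where L: "\<forall>y\<in>S. \<forall>z\<in>S. dist (h j y) (h j z) \<le> L * dist y z"
    using h_lipschitz[OF j] by auto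
  have "continuous_on S (h j)" by (rule lipschitz_continuous_on) (use L in blast)
  then have "h j \<in> borel_measurable M" by (rule continuous_measurable_M)
  then have "h j \<in> measurable M (restrict_space borel S)"
    by (intro measurable_restrict_space2) (auto simp: space_M h_S[OF j])
  then show ?thesis by (subst measurable_cong_sets[OF refl sets_M])
qed

section \<open>Partition of unity and transfer operator\<close>

definition bump :: "'a \<Rightarrow> real" where "bump y = max 0 (\<delta> - dist y x)"
definition total :: "'a \<Rightarrow> real" where "total z = (\<Sum>j\<in>W. bump (k j z))"
text \<open>The partition functions are p_j z = bump (k j z) / total z. At z = h j y the numerator
  is \<open>bump y\<close>, by \<open>k_h\<close>, so the weight is the Jacobian times p_j (h j y),
  and it vanishes unless \<open>y\<close> is near \<open>x\<close>.\<close>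

definition weight :: "'j \<Rightarrow> 'a \<Rightarrow> real" where
  "weight j y = bump y * inverse (total (h j y)) * J j y"
definition transfer :: "('a \<Rightarrow> ennreal) \<Rightarrow> 'a \<Rightarrow> ennreal" where
  "transfer \<psi> y = (\<Sum>j\<in>W. ennreal (weight j y) * \<psi> (h j y))"

lemma bump_nonneg: "bump y \<ge> 0" by (simp add: bump_def)

text \<open>The cover has radius \<delta>/2 while the cutoff has radius \<delta>, so some summand is
  at least \<delta>/2. A uniform bound, rather than positivity, is what keeps the inverse of
  \<open>total\<close> Hoelder.\<close>

lemma total_ge: "z \<in> S \<Longrightarrow> total z \<ge> \<delta>/2"
proof -
  assume "z \<in> S"
  then obtain j where j: "j \<in> W" "dist (k j z) x < \<delta>/2" using cover by blast
  then have "\<delta>/2 \<le> bump (k j z)" unfolding bump_def by linarith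
  also have "\<dots> \<le> total z" unfolding total_def
    by (rule member_le_sum) (auto simp: bump_nonneg finite_W j)
  finally show ?thesis .
qed

lemma weight_nonneg: "j \<in> W \<Longrightarrow> y \<in> S \<Longrightarrow> weight j y \<ge> 0"
  unfolding weight_def using total_ge[OF h_S, of j y] \<delta>_pos J_nonneg[of j y] bump_nonneg
  by (intro mult_nonneg_nonneg) auto

lemma bounded_S: "bounded S" using compact_S by (rule compact_imp_bounded)

lemma bump_holder: "holder_on \<alpha> S bump"
proof (rule holder_on_lipschitz[OF bounded_S \<alpha>_bounds, where L=1])
  fix y z
  show "\<bar>bump y - bump z\<bar> \<le> 1 * dist y z"
    using dist_triangle[of y x z] dist_triangle[of z x y] dist_commute[of y z]
    unfolding bump_def by linarith
qed

lemma total_holder: "holder_on \<alpha> S total"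
  unfolding total_def
proof (rule holder_on_sum)
  fix j assume j: "j \<in> W"
  obtain L where "\<forall>y\<in>S. \<forall>z\<in>S. dist (k j y) (k j z) \<le> L * dist y z"
    using k_lipschitz[OF j] by auto
  then show "holder_on \<alpha> S (\<lambda>z. bump (k j z))"
    by (intro holder_on_compose[OF bump_holder \<alpha>_bounds(1)]) (auto simp: k_S j)
qed

lemma weight_holder: "j \<in> W \<Longrightarrow> holder_on \<alpha> S (weight j)"
proof -
  assume j: "j \<in> W"
  obtain L where L: "\<forall>y\<in>S. \<forall>z\<in>S. dist (h j y) (h j z) \<le> L * dist y z"
    using h_lipschitz[OF j] by auto
  have "holder_on \<alpha> S (\<lambda>y. total (h j y))"
    by (rule holder_on_compose[OF total_holder \<alpha>_bounds(1)]) (use h_S L j in auto)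
  then have "holder_on \<alpha> S (\<lambda>y. inverse (total (h j y)))"
    by (rule holder_on_inverse[where c="\<delta>/2"]) (use total_ge h_S \<delta>_pos j in auto)
  then show ?thesis unfolding weight_def
    by (intro holder_on_mult bump_holder J_holder j)
qed

lemma weight_measurable: "j \<in> W \<Longrightarrow> weight j \<in> borel_measurable M"
  by (intro continuous_measurable_M holder_on_continuous_on[OF weight_holder \<alpha>_bounds(1)])

lemma transfer_measurable:
  "\<psi> \<in> borel_measurable M \<Longrightarrow> transfer \<psi> \<in> borel_measurable M"
  unfolding transfer_def
  by (intro borel_measurable_sum borel_measurable_times_ennreal measurable_compose[OF weight_measurable]
       measurable_compose[OF h_measurable]) auto

text \<open>Each weight is a Jacobian times a partition function evaluated at \<open>h j y\<close>.
  The change of variables turns the j-th term into the integral of p_j \<psi>, and the p_j sum to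
  1.\<close>

lemma weighted_pullback:
  assumes "\<psi> \<in> borel_measurable M"
  shows "(\<integral>\<^sup>+y. (\<Sum>j\<in>W. ennreal (weight j y) * \<psi> (h j y)) \<partial>M) = integral\<^sup>N M \<psi>"
proof -
  define p where "p j z = bump (k j z) * inverse (total z)" for j z
  have p_meas: "p j \<in> borel_measurable M" if "j \<in> W" for j
  proof (rule continuous_measurable_M, rule holder_on_continuous_on[OF _ \<alpha>_bounds(1)])
    obtain L where "\<forall>y\<in>S. \<forall>z\<in>S. dist (k j y) (k j z) \<le> L * dist y z"
      using k_lipschitz[OF \<open>j \<in> W\<close>] by auto
    then show "holder_on \<alpha> S (p j)" unfolding p_def
      by (intro holder_on_mult holder_on_inverse[OF total_holder, of "\<delta>/2"]
            holder_on_compose[OF bump_holder \<alpha>_bounds(1)])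
         (use k_S \<open>j \<in> W\<close> total_ge \<delta>_pos in auto)
  qed
  have p_nn: "p j z \<ge> 0" if "z \<in> S" for j z
    using total_ge[OF that] \<delta>_pos bump_nonneg unfolding p_def by (intro mult_nonneg_nonneg) auto
  have p_sum: "(\<Sum>j\<in>W. p j z) = 1" if "z \<in> S" for z
    using total_ge[OF that] \<delta>_pos
    by (simp add: p_def total_def[symmetric] sum_distrib_right[symmetric])
  have "(\<integral>\<^sup>+y. (\<Sum>j\<in>W. ennreal (weight j y) * \<psi> (h j y)) \<partial>M)
      = (\<Sum>j\<in>W. \<integral>\<^sup>+y. ennreal (weight j y) * \<psi> (h j y) \<partial>M)"
    by (rule nn_integral_sum)
       (intro borel_measurable_times_ennreal measurable_compose[OF weight_measurable]
         measurable_compose[OF h_measurable] assms, auto)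
  also have "\<dots> = (\<Sum>j\<in>W. \<integral>\<^sup>+y. ennreal (J j y) * (ennreal (p j (h j y)) * \<psi> (h j y)) \<partial>M)"
  proof (intro sum.cong refl nn_integral_cong)
    fix j y assume j: "j \<in> W" and "y \<in> space M"
    then have y: "y \<in> S" by (simp add: space_M)
    have "weight j y = J j y * p j (h j y)"
      by (simp add: weight_def p_def k_h j y)
    then show "ennreal (weight j y) * \<psi> (h j y) = ennreal (J j y) * (ennreal (p j (h j y)) * \<psi> (h j y))"
      using J_nonneg[OF j y] p_nn[OF h_S[OF j y], of j] by (simp add: ennreal_mult mult.assoc)
  qed
  also have "\<dots> = (\<Sum>j\<in>W. \<integral>\<^sup>+z. ennreal (p j z) * \<psi> z \<partial>M)"
    by (intro sum.cong refl change_of_variables borel_measurable_times_ennreal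
          measurable_compose[OF p_meas] assms) auto
  also have "\<dots> = (\<integral>\<^sup>+z. (\<Sum>j\<in>W. ennreal (p j z) * \<psi> z) \<partial>M)"
    by (rule nn_integral_sum[symmetric])
       (intro borel_measurable_times_ennreal measurable_compose[OF p_meas] assms, auto)
  also have "\<dots> = integral\<^sup>N M \<psi>"
  proof (rule nn_integral_cong)
    fix z assume "z \<in> space M"
    then have z: "z \<in> S" by (simp add: space_M)
    have "(\<Sum>j\<in>W. ennreal (p j z) * \<psi> z) = ennreal (\<Sum>j\<in>W. p j z) * \<psi> z"
      by (simp add: sum_distrib_right[symmetric] sum_ennreal p_nn z)
    then show "(\<Sum>j\<in>W. ennreal (p j z) * \<psi> z) = \<psi> z" by (simp add: p_sum z)
  qed
  finally show ?thesis .
qed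

text \<open>Invariance lets the indicator of \<open>E\<close> pass under the sum as its value at
  \<open>h j y\<close>; \<open>weighted_pullback\<close> then applies to the indicator times
  \<psi>.\<close>

lemma transfer_integral_invariant:
  assumes "\<psi> \<in> borel_measurable M" "E \<in> sets M"
    and inv: "\<And>j y. j \<in> W \<Longrightarrow> y \<in> S \<Longrightarrow> h j y \<in> E \<longleftrightarrow> y \<in> E"
  shows "(\<integral>\<^sup>+y. indicator E y * transfer \<psi> y \<partial>M) = (\<integral>\<^sup>+y. indicator E y * \<psi> y \<partial>M)"
proof -
  have "(\<integral>\<^sup>+y. indicator E y * transfer \<psi> y \<partial>M)
     = (\<integral>\<^sup>+y. (\<Sum>j\<in>W. ennreal (weight j y) * (indicator E (h j y) * \<psi> (h j y))) \<partial>M)"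
    unfolding transfer_def
    by (intro nn_integral_cong) (auto simp: sum_distrib_left indicator_def inv space_M intro!: sum.cong)
  also have "\<dots> = (\<integral>\<^sup>+y. indicator E y * \<psi> y \<partial>M)"
    by (rule weighted_pullback) (use assms in auto)
  finally show ?thesis .
qed

section \<open>Local lower bounds under the transfer operator\<close>

definition envelope :: "('a \<Rightarrow> ennreal) \<Rightarrow> real \<Rightarrow> ('a \<Rightarrow> ennreal) \<Rightarrow> bool" where
  "envelope \<psi> \<rho> w \<longleftrightarrow> w \<in> borel_measurable M \<and> integral\<^sup>N M w < \<infinity> \<and>
     (\<forall>y\<in>S. \<forall>z\<in>S. dist y z \<le> \<rho> \<longrightarrow> w y \<le> \<psi> z)"

text \<open>An envelope stands in for the infimum of \<psi> over \<rho>-balls, whose measurability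
  would otherwise be an issue. The new one evaluates each weight at \<open>y\<close>, lowered by its
  largest variation H j * \<rho> powr \<alpha> over the distance \<rho>. The loss is this amount
  times the integral of \<open>w (h j y)\<close>, which \<open>pullback_bounded\<close> controls.
  \<open>C\<close> depends on the cover alone, which allows iteration.\<close>

lemma envelope_transfer:
  obtains C where "C \<ge> 0" "\<And>\<psi> \<rho> w. 0 < \<rho> \<Longrightarrow> \<rho> \<le> \<delta> \<Longrightarrow> envelope \<psi> (\<kappa> * \<rho>) w \<Longrightarrow>
     \<exists>w'. envelope (transfer \<psi>) \<rho> w' \<and>
       integral\<^sup>N M w \<le> integral\<^sup>N M w' + ennreal (C * \<rho> powr \<alpha>) * integral\<^sup>N M w"
proof -
  have "\<forall>j\<in>W. \<exists>C\<ge>0. \<forall>y\<in>S. \<forall>z\<in>S. \<bar>weight j y - weight j z\<bar> \<le> C * dist y z powr \<alpha>"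
    by (meson holder_onE weight_holder)
  then obtain H where H: "\<And>j. j \<in> W \<Longrightarrow> H j \<ge> 0"
    "\<And>j y z. j \<in> W \<Longrightarrow> y \<in> S \<Longrightarrow> z \<in> S \<Longrightarrow> \<bar>weight j y - weight j z\<bar> \<le> H j * dist y z powr \<alpha>"
    by metis
  obtain P where P: "\<And>j. j \<in> W \<Longrightarrow> P j \<ge> 0" "\<And>j \<phi>. j \<in> W \<Longrightarrow> \<phi> \<in> borel_measurable M \<Longrightarrow>
          (\<integral>\<^sup>+y. \<phi> (h j y) \<partial>M) \<le> ennreal (P j) * integral\<^sup>N M \<phi>"
    using pullback_bounded by metis
  define C where "C = (\<Sum>j\<in>W. H j * P j)"
  have C0: "C \<ge> 0" unfolding C_def by (intro sum_nonneg mult_nonneg_nonneg H P)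
  show ?thesis
  proof (rule that[OF C0])
    fix \<psi> \<rho> w assume \<rho>: "0 < \<rho>" "\<rho> \<le> \<delta>" and env: "envelope \<psi> (\<kappa> * \<rho>) w"
    have w_meas: "w \<in> borel_measurable M" and w_fin: "integral\<^sup>N M w < \<infinity>"
      and w_le: "\<And>y z. y \<in> S \<Longrightarrow> z \<in> S \<Longrightarrow> dist y z \<le> \<kappa> * \<rho> \<Longrightarrow> w y \<le> \<psi> z"
      using env by (auto simp: envelope_def)
    define w' where "w' y = (\<Sum>j\<in>W. ennreal (max 0 (weight j y - H j * \<rho> powr \<alpha>)) * w (h j y))" for y
    have whm: "(\<lambda>y. w (h j y)) \<in> borel_measurable M" if "j \<in> W" for j
      by (rule measurable_compose[OF h_measurable[OF that] w_meas])
    have w'_meas: "w' \<in> borel_measurable M" unfolding w'_def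
      by (intro borel_measurable_sum borel_measurable_times_ennreal whm
           measurable_compose[OF _ measurable_ennreal] borel_measurable_max borel_measurable_diff
           weight_measurable) auto
    have "integral\<^sup>N M w' \<le> (\<integral>\<^sup>+y. (\<Sum>j\<in>W. ennreal (weight j y) * w (h j y)) \<partial>M)"
      unfolding w'_def
      by (intro nn_integral_mono sum_mono mult_right_mono ennreal_leI)
         (auto simp: space_M weight_nonneg H)
    also have "\<dots> = integral\<^sup>N M w" by (rule weighted_pullback[OF w_meas])
    finally have w'_fin: "integral\<^sup>N M w' < \<infinity>" using w_fin by (rule le_less_trans)
    have w'_le: "w' y \<le> transfer \<psi> z" if y: "y \<in> S" and z: "z \<in> S" and d: "dist y z \<le> \<rho>" for y z
      unfolding w'_def transfer_def
    proof (rule sum_mono)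
      fix j assume j: "j \<in> W"
      show "ennreal (max 0 (weight j y - H j * \<rho> powr \<alpha>)) * w (h j y) \<le> ennreal (weight j z) * \<psi> (h j z)"
      proof (cases "weight j y - H j * \<rho> powr \<alpha> > 0")
        case False
        then show ?thesis by (simp add: max_def)
      next
        case True
        have "dist y z powr \<alpha> \<le> \<rho> powr \<alpha>" using d \<alpha>_bounds by (intro powr_mono2) auto
        then have Hle: "H j * dist y z powr \<alpha> \<le> H j * \<rho> powr \<alpha>" by (intro mult_left_mono H j)
        \<comment> \<open>A positive lowered weight forces \<open>bump y\<close> to be nonzero,
          hence \<open>y\<close> within \<delta> of \<open>x\<close> and \<open>z\<close> within
          \<delta> + \<rho> \<le> 2 * \<delta>: contraction is invoked only where it is available.
          The truncation at 0 disposes of every other \<open>y\<close>.\<close>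
        have "weight j y > 0" using True H(1)[OF j] by (smt (verit) mult_nonneg_nonneg powr_ge_zero)
        then have "bump y \<noteq> 0" by (auto simp: weight_def)
        then have yx: "dist y x < \<delta>" by (auto simp: bump_def max_def split: if_splits)
        have "dist z x \<le> dist y z + dist y x" by (metis dist_commute dist_triangle add.commute)
        then have zx: "dist z x \<le> 2*\<delta>" using yx d \<rho> by linarith
        have "dist (h j y) (h j z) \<le> \<kappa> * dist y z"
          using contraction[OF j y z _ zx] yx \<delta>_pos by auto
        also have "\<dots> \<le> \<kappa> * \<rho>" using d \<kappa>_bounds by (intro mult_left_mono) auto
        finally have "w (h j y) \<le> \<psi> (h j z)" by (intro w_le h_S j y z)
        moreover have "max 0 (weight j y - H j * \<rho> powr \<alpha>) \<le> weight j z"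
          using H(2)[OF j y z] Hle weight_nonneg[OF j z] by (auto simp: max_def)
        ultimately show ?thesis by (intro mult_mono ennreal_leI) auto
      qed
    qed
    have "integral\<^sup>N M w = (\<integral>\<^sup>+y. (\<Sum>j\<in>W. ennreal (weight j y) * w (h j y)) \<partial>M)"
      by (rule weighted_pullback[OF w_meas, symmetric])
    also have "\<dots> \<le> (\<integral>\<^sup>+y. w' y + (\<Sum>j\<in>W. ennreal (H j * \<rho> powr \<alpha>) * w (h j y)) \<partial>M)"
    proof (rule nn_integral_mono)
      fix y assume "y \<in> space M"
      then have y: "y \<in> S" by (simp add: space_M)
      have "ennreal (weight j y) * w (h j y) \<le>
        ennreal (max 0 (weight j y - H j * \<rho> powr \<alpha>)) * w (h j y) + ennreal (H j * \<rho> powr \<alpha>) * w (h j y)"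
        if j: "j \<in> W" for j
      proof -
        have "ennreal (weight j y) \<le> ennreal (max 0 (weight j y - H j * \<rho> powr \<alpha>) + H j * \<rho> powr \<alpha>)"
          by (rule ennreal_leI) auto
        also have "\<dots> = ennreal (max 0 (weight j y - H j * \<rho> powr \<alpha>)) + ennreal (H j * \<rho> powr \<alpha>)"
          by (rule ennreal_plus) (auto simp: H j)
        finally show ?thesis by (simp add: distrib_right[symmetric] mult_right_mono)
      qed
      then show "(\<Sum>j\<in>W. ennreal (weight j y) * w (h j y)) \<le> w' y + (\<Sum>j\<in>W. ennreal (H j * \<rho> powr \<alpha>) * w (h j y))"
        unfolding w'_def sum.distrib[symmetric] by (rule sum_mono)
    qed
    also have "\<dots> = integral\<^sup>N M w' + (\<integral>\<^sup>+y. (\<Sum>j\<in>W. ennreal (H j * \<rho> powr \<alpha>) * w (h j y)) \<partial>M)"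
      by (rule nn_integral_add[OF w'_meas])
         (intro borel_measurable_sum borel_measurable_times_ennreal borel_measurable_const whm)
    finally have main: "integral\<^sup>N M w \<le>
      integral\<^sup>N M w' + (\<integral>\<^sup>+y. (\<Sum>j\<in>W. ennreal (H j * \<rho> powr \<alpha>) * w (h j y)) \<partial>M)" .
    have "(\<integral>\<^sup>+y. (\<Sum>j\<in>W. ennreal (H j * \<rho> powr \<alpha>) * w (h j y)) \<partial>M)
        = (\<Sum>j\<in>W. \<integral>\<^sup>+y. ennreal (H j * \<rho> powr \<alpha>) * w (h j y) \<partial>M)"
      by (rule nn_integral_sum) (intro borel_measurable_times_ennreal borel_measurable_const whm)
    also have "\<dots> = (\<Sum>j\<in>W. ennreal (H j * \<rho> powr \<alpha>) * (\<integral>\<^sup>+y. w (h j y) \<partial>M))"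
      by (intro sum.cong refl nn_integral_cmult whm)
    also have "\<dots> \<le> (\<Sum>j\<in>W. ennreal (H j * \<rho> powr \<alpha>) * (ennreal (P j) * integral\<^sup>N M w))"
      by (intro sum_mono mult_left_mono P w_meas) auto
    also have "\<dots> = ennreal (C * \<rho> powr \<alpha>) * integral\<^sup>N M w"
    proof -
      have "ennreal (H j * \<rho> powr \<alpha>) * (ennreal (P j) * integral\<^sup>N M w)
          = ennreal (H j * P j * \<rho> powr \<alpha>) * integral\<^sup>N M w" if "j \<in> W" for j
        using H(1)[OF that] P(1)[OF that] by (simp add: ennreal_mult mult_ac)
      then have "(\<Sum>j\<in>W. ennreal (H j * \<rho> powr \<alpha>) * (ennreal (P j) * integral\<^sup>N M w))
          = (\<Sum>j\<in>W. ennreal (H j * P j * \<rho> powr \<alpha>)) * integral\<^sup>N M w"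
        by (simp add: sum_distrib_right)
      also have "(\<Sum>j\<in>W. ennreal (H j * P j * \<rho> powr \<alpha>)) = ennreal (C * \<rho> powr \<alpha>)"
        by (subst sum_ennreal) (auto simp: H P C_def sum_distrib_right)
      finally show ?thesis .
    qed
    finally have "(\<integral>\<^sup>+y. (\<Sum>j\<in>W. ennreal (H j * \<rho> powr \<alpha>) * w (h j y)) \<partial>M)
      \<le> ennreal (C * \<rho> powr \<alpha>) * integral\<^sup>N M w" .
    then have "integral\<^sup>N M w \<le> integral\<^sup>N M w' + ennreal (C * \<rho> powr \<alpha>) * integral\<^sup>N M w"
      by (intro order_trans[OF main] add_left_mono)
    moreover have "envelope (transfer \<psi>) \<rho> w'"
      unfolding envelope_def using w'_meas w'_fin w'_le by auto
    ultimately show "\<exists>w'. envelope (transfer \<psi>) \<rho> w' \<and>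
       integral\<^sup>N M w \<le> integral\<^sup>N M w' + ennreal (C * \<rho> powr \<alpha>) * integral\<^sup>N M w" by blast
  qed
qed

text \<open>The losses occur at the scales \<kappa>^i * \<rho> and so decay geometrically in i.
  Their sum is a multiple of \<rho> powr \<alpha> with a factor independent of n, which is the point
  of the statement.\<close>

lemma envelope_transfer_iterate:
  obtains C where "C \<ge> 0" "\<And>n \<psi> \<rho> w. 0 < \<rho> \<Longrightarrow> \<rho> \<le> \<delta> \<Longrightarrow> C * \<rho> powr \<alpha> \<le> 1 \<Longrightarrow>
     envelope \<psi> (\<kappa>^n * \<rho>) w \<Longrightarrow>
     \<exists>w'. envelope ((transfer^^n) \<psi>) \<rho> w' \<and>
       ennreal (1 - C * \<rho> powr \<alpha>) * integral\<^sup>N M w \<le> integral\<^sup>N M w'"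
proof -
  obtain C where C: "C \<ge> 0" and step: "\<And>\<psi> \<rho> w. 0 < \<rho> \<Longrightarrow> \<rho> \<le> \<delta> \<Longrightarrow> envelope \<psi> (\<kappa> * \<rho>) w \<Longrightarrow>
     \<exists>w'. envelope (transfer \<psi>) \<rho> w' \<and>
       integral\<^sup>N M w \<le> integral\<^sup>N M w' + ennreal (C * \<rho> powr \<alpha>) * integral\<^sup>N M w"
    by (fact envelope_transfer)
  define \<theta> where "\<theta> = \<kappa> powr \<alpha>"
  have \<theta>: "0 < \<theta>" "\<theta> < 1"
    using \<kappa>_bounds \<alpha>_bounds powr_less_mono2[of \<alpha> \<kappa> 1] by (auto simp: \<theta>_def)
  \<comment> \<open>\<open>K\<close> is the sum of the series C * \<theta>^i. It satisfies C + K *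
    \<theta> = K, so the induction closes: the outermost step costs \<open>C\<close>, and the n
    steps starting from scale \<kappa> * \<rho> cost K * \<theta>.\<close>
  define K where "K = C / (1 - \<theta>)"
  have K0: "K \<ge> 0" using C \<theta> by (simp add: K_def)
  have KC: "C + K * \<theta> = K" using \<theta> by (simp add: K_def field_simps)
  have "\<exists>w'. envelope ((transfer^^n) \<psi>) \<rho> w' \<and>
       ennreal (1 - K * \<rho> powr \<alpha>) * integral\<^sup>N M w \<le> integral\<^sup>N M w'"
    if "0 < \<rho>" "\<rho> \<le> \<delta>" "K * \<rho> powr \<alpha> \<le> 1" "envelope \<psi> (\<kappa>^n * \<rho>) w" for n \<psi> \<rho> w
    using that
  proof (induction n arbitrary: \<rho>)
    case 0
    then have "envelope \<psi> \<rho> w" by simp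
    moreover have "ennreal (1 - K * \<rho> powr \<alpha>) * integral\<^sup>N M w \<le> ennreal 1 * integral\<^sup>N M w"
      by (intro mult_right_mono ennreal_leI) (auto simp: K0)
    ultimately show ?case by auto
  next
    case (Suc n)
    have small: "\<kappa> * \<rho> \<le> \<rho>" using Suc.prems \<kappa>_bounds by (simp add: mult_left_le_one_le)
    have pw: "(\<kappa> * \<rho>) powr \<alpha> = \<theta> * \<rho> powr \<alpha>"
      using Suc.prems \<kappa>_bounds by (simp add: powr_mult \<theta>_def)
    have "K * (\<theta> * \<rho> powr \<alpha>) \<le> K * \<rho> powr \<alpha>"
      using \<theta> K0 by (intro mult_left_mono mult_left_le_one_le) auto
    then have K1: "K * (\<kappa> * \<rho>) powr \<alpha> \<le> 1" using Suc.prems(3) pw by simp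
    obtain w1 where w1: "envelope ((transfer^^n) \<psi>) (\<kappa> * \<rho>) w1"
      "ennreal (1 - K * (\<kappa> * \<rho>) powr \<alpha>) * integral\<^sup>N M w \<le> integral\<^sup>N M w1"
      using Suc.IH[of "\<kappa> * \<rho>"] Suc.prems small K1 \<kappa>_bounds by (auto simp: mult_ac)
    obtain w2 where w2: "envelope (transfer ((transfer^^n) \<psi>)) \<rho> w2"
      "integral\<^sup>N M w1 \<le> integral\<^sup>N M w2 + ennreal (C * \<rho> powr \<alpha>) * integral\<^sup>N M w1"
      using step[OF Suc.prems(1,2) w1(1)] by blast
    \<comment> \<open>Envelopes have finite integrals, so the two estimates can be rearranged as
      inequalities between reals.\<close>
    obtain a where a: "a \<ge> 0" "integral\<^sup>N M w = ennreal a"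
      using Suc.prems(4) by (auto simp: envelope_def less_top_ennreal)
    obtain a1 where a1: "a1 \<ge> 0" "integral\<^sup>N M w1 = ennreal a1"
      using w1(1) by (auto simp: envelope_def less_top_ennreal)
    obtain a2 where a2: "a2 \<ge> 0" "integral\<^sup>N M w2 = ennreal a2"
      using w2(1) by (auto simp: envelope_def less_top_ennreal)
    define r where "r = \<rho> powr \<alpha>"
    have r0: "r \<ge> 0" by (simp add: r_def)
    have "ennreal ((1 - K * (\<theta> * r)) * a) \<le> ennreal a1"
      using w1(2) K1 by (simp add: a a1 pw ennreal_mult r_def)
    then have e1: "(1 - K * (\<theta> * r)) * a \<le> a1" using a1 by simp
    have "ennreal a1 \<le> ennreal (a2 + (C * r) * a1)"
      using w2(2) C r0 a1(1) a2(1) by (simp add: a1(2) a2(2) ennreal_plus ennreal_mult r_def)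
    then have "a1 \<le> a2 + (C * r) * a1"
      by (subst (asm) ennreal_le_iff) (use C r0 a1(1) a2(1) in auto)
    then have e2: "(1 - C * r) * a1 \<le> a2" by (simp add: algebra_simps)
    have Cr: "C * r \<le> 1"
    proof -
      have "C * r \<le> K * r" using KC K0 \<theta> r0 by (intro mult_right_mono) (auto, smt (verit) mult_nonneg_nonneg)
      then show ?thesis using Suc.prems(3) by (simp add: r_def)
    qed
    have "1 - K * r = 1 - (C + K * \<theta>) * r" using KC by simp
    \<comment> \<open>The product exceeds 1 - (C + K * \<theta>) * r by the nonnegative term C * K *
      \<theta> * r^2.\<close>
    also have "\<dots> \<le> (1 - C * r) * (1 - K * (\<theta> * r))"
      using C r0 K0 \<theta> by (simp add: algebra_simps)
    finally have "(1 - K * r) * a \<le> (1 - C * r) * (1 - K * (\<theta> * r)) * a"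
      using a by (intro mult_right_mono)
    also have "\<dots> = (1 - C * r) * ((1 - K * (\<theta> * r)) * a)" by simp
    also have "\<dots> \<le> (1 - C * r) * a1" using e1 Cr by (intro mult_left_mono) auto
    also have "\<dots> \<le> a2" by (rule e2)
    finally have "ennreal ((1 - K * r) * a) \<le> ennreal a2" by (rule ennreal_leI)
    then have "ennreal (1 - K * \<rho> powr \<alpha>) * integral\<^sup>N M w \<le> integral\<^sup>N M w2"
      using Suc.prems(3) a(1) by (simp add: a(2) a2(2) ennreal_mult r_def)
    then show ?case using w2(1) by auto
  qed
  then show ?thesis using that[of K] K0 by blast
qed

section \<open>From an invariant set to a ball almost inside it\<close>

lemma transfer_iterate_measurable:
  "\<psi> \<in> borel_measurable M \<Longrightarrow> (transfer^^n) \<psi> \<in> borel_measurable M"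
  by (induction n) (auto intro: transfer_measurable)

lemma transfer_iterate_integral_invariant:
  assumes "\<psi> \<in> borel_measurable M" "E \<in> sets M"
    and inv: "\<And>j y. j \<in> W \<Longrightarrow> y \<in> S \<Longrightarrow> h j y \<in> E \<longleftrightarrow> y \<in> E"
  shows "(\<integral>\<^sup>+y. indicator E y * (transfer^^n) \<psi> y \<partial>M) = (\<integral>\<^sup>+y. indicator E y * \<psi> y \<partial>M)"
  by (induction n)
     (auto simp: transfer_integral_invariant[OF transfer_iterate_measurable[OF assms(1)] assms(2,3)])

text \<open>Two estimates of the same iterate are played against each other. Its envelope keeps half
  the mass of \<open>K\<close>, so the iterate is at least a fixed \<open>c\<close> on some ball of
  radius \<rho>. Outside \<open>E\<close>, however, its integral equals that of the initial
  indicator, at most the measure of \<open>U i - K\<close>, which is as small as desired.\<close>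

lemma invariant_contains_ball:
  assumes E: "E \<in> sets M" and K: "compact K" "K \<subseteq> E" "emeasure M K > 0"
    and inv: "\<And>j y. j \<in> W \<Longrightarrow> y \<in> S \<Longrightarrow> h j y \<in> E \<longleftrightarrow> y \<in> E"
  shows "\<exists>p\<in>S. \<exists>r>0. emeasure M (S \<inter> ball p r - E) = 0"
proof -
  interpret finite_measure M by (rule finite_M)
  have sets_int: "S \<inter> X \<in> sets M" if "X \<in> sets borel" for X
    using that by (auto simp: sets_M sets_restrict_space)
  have ES: "E \<subseteq> S" using sets.sets_into_space[OF E] by (simp add: space_M)
  have KS: "K \<subseteq> S" using K(2) ES by auto
  have K_sets: "K \<in> sets M"
    using sets_int[of K] K(1) KS by (simp add: borel_closed compact_imp_closed Int_absorb1)
  define m where "m = measure M K"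
  have m: "m > 0" using K(3) by (simp add: m_def emeasure_eq_measure)
  have Kne: "K \<noteq> {}" using K(3) by auto
  define s where "s = measure M S"
  have s: "s > 0"
    using m finite_measure_mono[OF KS] sets.top[of M] by (auto simp: m_def s_def space_M)
  obtain C where C: "C \<ge> 0" and iter: "\<And>n \<psi> \<rho> w. 0 < \<rho> \<Longrightarrow> \<rho> \<le> \<delta> \<Longrightarrow> C * \<rho> powr \<alpha> \<le> 1 \<Longrightarrow>
     envelope \<psi> (\<kappa>^n * \<rho>) w \<Longrightarrow>
     \<exists>w'. envelope ((transfer^^n) \<psi>) \<rho> w' \<and>
       ennreal (1 - C * \<rho> powr \<alpha>) * integral\<^sup>N M w \<le> integral\<^sup>N M w'"
    by (fact envelope_transfer_iterate)
  \<comment> \<open>The radius is fixed before the accuracy \<eta> and the number n of iterations;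
    the bound 1/2 preserves half the mass for every n.\<close>
  obtain \<rho> where \<rho>: "0 < \<rho>" "\<rho> \<le> \<delta>" "C * \<rho> powr \<alpha> \<le> 1/2"
  proof -
    have "((\<lambda>\<rho>. C * \<rho> powr \<alpha>) \<longlongrightarrow> C * 0 powr \<alpha>) (at_right 0)"
      by (intro tendsto_intros tendsto_powr2)
         (use \<alpha>_bounds in \<open>auto simp: eventually_at_right_less eventually_at_filter\<close>)
    then have "\<forall>\<^sub>F \<rho> in at_right 0. C * \<rho> powr \<alpha> < 1/2"
      by (rule order_tendstoD) simp
    moreover have "\<forall>\<^sub>F \<rho> in at_right 0. \<rho> < \<delta>"
      using \<delta>_pos by (rule eventually_at_right_less[THEN eventually_mono, rotated] order_tendstoD(2)[OF tendsto_ident_at])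
    moreover have "\<forall>\<^sub>F \<rho>::real in at_right 0. \<rho> > 0" by (rule eventually_at_right_less)
    ultimately have "\<forall>\<^sub>F \<rho> in at_right 0. C * \<rho> powr \<alpha> < 1/2 \<and> \<rho> < \<delta> \<and> \<rho> > 0"
      by eventually_elim auto
    then obtain \<rho> where "C * \<rho> powr \<alpha> < 1/2 \<and> \<rho> < \<delta> \<and> \<rho> > 0"
      using eventually_happens trivial_limit_at_right_real by blast
    then show ?thesis using that[of \<rho>] by auto
  qed
  \<comment> \<open>A function below \<open>c\<close> everywhere has integral at most c * s = m/4,
    less than the mass m/2 that the envelope keeps.\<close>
  define c where "c = m / (4 * s)"
  have c: "c > 0" using m s by (simp add: c_def)
  have approx: "\<exists>y\<in>S. measure M (S \<inter> ball y \<rho> - E) \<le> \<eta>" if \<eta>: "\<eta> > 0" for \<eta>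
  proof -
    define U where "U i = S \<inter> {z. infdist z K < 1 / real (Suc i)}" for i
    have U_sets: "U i \<in> sets M" for i
      unfolding U_def by (intro sets_int borel_open open_Collect_less continuous_intros)
    have KU: "K \<subseteq> U i" for i using KS by (auto simp: U_def)
    have "decseq U"
    proof (rule decseq_SucI)
      fix i
      have "1 / real (Suc (Suc i)) \<le> 1 / real (Suc i)" by (simp add: frac_le)
      then show "U (Suc i) \<subseteq> U i" unfolding U_def by force
    qed
    moreover have "(\<Inter>i. U i) = K"
    proof
      show "(\<Inter>i. U i) \<subseteq> K"
      proof
        fix z assume z: "z \<in> (\<Inter>i. U i)"
        have "infdist z K \<le> 0"
        proof (rule ccontr)
          assume "\<not> infdist z K \<le> 0"
          then obtain i where "inverse (real (Suc i)) < infdist z K"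
            using reals_Archimedean[of "infdist z K"] by auto
          moreover have "infdist z K < 1 / real (Suc i)" using z by (auto simp: U_def)
          ultimately show False by (simp add: inverse_eq_divide)
        qed
        then have "infdist z K = 0" using infdist_nonneg[of z K] by linarith
        then show "z \<in> K"
          using in_closed_iff_infdist_zero[of K z] K(1) Kne by (simp add: compact_imp_closed)
      qed
    qed (use KU in auto)
    ultimately have "(\<lambda>i. measure M (U i)) \<longlonglongrightarrow> measure M K"
      using finite_Lim_measure_decseq[of U] U_sets by auto
    then have "\<forall>\<^sub>F i in sequentially. measure M (U i) < measure M K + c * \<eta>"
      by (rule order_tendstoD) (use c \<eta> in auto)
    then obtain i where i: "measure M (U i) < measure M K + c * \<eta>"
      using eventually_happens by force
    have "(\<lambda>n. \<kappa>^n * \<rho>) \<longlonglongrightarrow> 0 * \<rho>"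
      by (intro tendsto_intros LIMSEQ_power_zero) (use \<kappa>_bounds in auto)
    then have "\<forall>\<^sub>F n in sequentially. \<kappa>^n * \<rho> < 1 / real (Suc i)"
      by (rule order_tendstoD) auto
    then obtain n where n: "\<kappa>^n * \<rho> < 1 / real (Suc i)"
      using eventually_happens by force
    define \<psi> :: "'a \<Rightarrow> ennreal" where "\<psi> = indicator (U i)"
    have \<psi>_meas: "\<psi> \<in> borel_measurable M" unfolding \<psi>_def using U_sets by simp
    \<comment> \<open>The choice of \<open>n\<close> puts the closed (\<kappa>^n *
      \<rho>)-neighbourhood of \<open>K\<close> inside \<open>U i\<close>.\<close>
    have "envelope \<psi> (\<kappa>^n * \<rho>) (indicator K)"
      unfolding envelope_def
    proof (intro conjI ballI impI)
      show "indicator K \<in> borel_measurable M" using K_sets by simp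
      show "(\<integral>\<^sup>+y. indicator K y \<partial>M) < \<infinity>" using K_sets by (simp add: less_top[symmetric])
      fix y z assume yz: "y \<in> S" "z \<in> S" "dist y z \<le> \<kappa>^n * \<rho>"
      show "indicator K y \<le> \<psi> z"
      proof (cases "y \<in> K")
        case True
        have "infdist z K \<le> dist z y" using True by (rule infdist_le)
        then have "z \<in> U i" using yz n by (auto simp: U_def dist_commute)
        then show ?thesis using True by (simp add: \<psi>_def)
      qed simp
    qed
    then obtain w where w: "envelope ((transfer^^n) \<psi>) \<rho> w"
      "ennreal (1 - C * \<rho> powr \<alpha>) * (\<integral>\<^sup>+y. indicator K y \<partial>M) \<le> integral\<^sup>N M w"
      using iter[of \<rho> \<psi> n "indicator K"] \<rho> by auto
    have w_big: "ennreal (m/2) \<le> integral\<^sup>N M w"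
    proof -
      have "m/2 \<le> (1 - C * \<rho> powr \<alpha>) * m"
        using \<rho>(3) m mult_right_mono[of "1/2" "1 - C * \<rho> powr \<alpha>" m] by simp
      then have "ennreal (m/2) \<le> ennreal ((1 - C * \<rho> powr \<alpha>) * m)" by (rule ennreal_leI)
      also have "\<dots> = ennreal (1 - C * \<rho> powr \<alpha>) * (\<integral>\<^sup>+y. indicator K y \<partial>M)"
        using K_sets m \<rho>(3) by (simp add: emeasure_eq_measure m_def ennreal_mult)
      finally show ?thesis using w(2) by (rule order_trans)
    qed
    have "\<exists>y\<in>S. ennreal c \<le> w y"
    proof (rule ccontr)
      assume "\<not> ?thesis"
      then have "integral\<^sup>N M w \<le> (\<integral>\<^sup>+y. ennreal c \<partial>M)"
        by (intro nn_integral_mono) (auto simp: space_M not_le less_imp_le)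
      also have "\<dots> = ennreal (m/4)"
        using c s by (simp add: space_M emeasure_eq_measure s_def[symmetric] ennreal_mult[symmetric])
           (simp add: c_def)
      finally have "ennreal (m/2) \<le> ennreal (m/4)" using w_big by (rule order_trans[rotated])
      then show False using m by simp
    qed
    then obtain y where y: "y \<in> S" "ennreal c \<le> w y" by blast
    define F where "F = S \<inter> ball y \<rho> - E"
    have F_sets: "F \<in> sets M" unfolding F_def using sets_int[of "ball y \<rho>"] E by auto
    have "ennreal (c * measure M F) = (\<integral>\<^sup>+z. ennreal c * indicator F z \<partial>M)"
      using F_sets c by (simp add: nn_integral_cmult_indicator emeasure_eq_measure ennreal_mult)
    also have "\<dots> \<le> (\<integral>\<^sup>+z. indicator (S - E) z * (transfer^^n) \<psi> z \<partial>M)"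
    proof (rule nn_integral_mono)
      fix z assume "z \<in> space M"
      show "ennreal c * indicator F z \<le> indicator (S - E) z * (transfer^^n) \<psi> z"
      proof (cases "z \<in> F")
        case True
        then have z: "z \<in> S" "dist y z \<le> \<rho>" "z \<notin> E" by (auto simp: F_def)
        have "ennreal c \<le> w y" by (rule y)
        also have "\<dots> \<le> (transfer^^n) \<psi> z" using w(1) y z by (auto simp: envelope_def)
        finally show ?thesis using True z by simp
      qed simp
    qed
    \<comment> \<open>The complement of \<open>E\<close> is invariant as well, so the operator
      preserves its share of the integral.\<close>
    also have "\<dots> = (\<integral>\<^sup>+z. indicator (S - E) z * \<psi> z \<partial>M)"
      by (rule transfer_iterate_integral_invariant[OF \<psi>_meas])
         (use E sets.compl_sets[OF E] inv h_S in \<open>auto simp: space_M\<close>)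
    also have "\<dots> \<le> (\<integral>\<^sup>+z. indicator (U i - K) z \<partial>M)"
      by (intro nn_integral_mono) (use K(2) in \<open>auto simp: \<psi>_def indicator_def\<close>)
    also have "\<dots> = ennreal (measure M (U i) - measure M K)"
      using U_sets K_sets KU by (simp add: emeasure_eq_measure finite_measure_Diff)
    finally have "c * measure M F \<le> measure M (U i) - measure M K"
      using finite_measure_mono[OF KU U_sets] by simp
    also have "\<dots> \<le> c * \<eta>" using i by simp
    finally have "measure M F \<le> \<eta>" using c by simp
    then show ?thesis using y(1) by (auto simp: F_def)
  qed
  have "\<forall>i. \<exists>y\<in>S. measure M (S \<inter> ball y \<rho> - E) \<le> 1 / real (Suc i)"
    by (intro allI approx) simp
  then obtain y where y: "\<And>i. y i \<in> S" "\<And>i. measure M (S \<inter> ball (y i) \<rho> - E) \<le> 1 / real (Suc i)"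
    by metis
  obtain p r where p: "p \<in> S" and r: "strict_mono (r::nat\<Rightarrow>nat)" and lim: "(y \<circ> r) \<longlonglongrightarrow> p"
    using compact_S y(1) unfolding compact_def by metis
  \<comment> \<open>The centres accumulate at \<open>p\<close>. Halving the radius puts one fixed
    ball inside all balls far enough along the subsequence, whose parts outside \<open>E\<close>
    have measure tending to 0.\<close>
  have null: "measure M (S \<inter> ball p (\<rho>/2) - E) \<le> 0"
  proof (rule tendsto_lowerbound)
    show "(\<lambda>i. 1 / real (Suc (r i))) \<longlonglongrightarrow> 0"
      using LIMSEQ_subseq_LIMSEQ[OF LIMSEQ_Suc[OF lim_1_over_n[where 'a=real]] r] by (simp add: o_def)
    have "\<forall>\<^sub>F i in sequentially. dist (y (r i)) p < \<rho>/2"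
      using tendstoD[OF lim, of "\<rho>/2"] \<rho>(1) by simp
    then show "\<forall>\<^sub>F i in sequentially. measure M (S \<inter> ball p (\<rho>/2) - E) \<le> 1 / real (Suc (r i))"
    proof eventually_elim
      case (elim i)
      have "S \<inter> ball p (\<rho>/2) - E \<subseteq> S \<inter> ball (y (r i)) \<rho> - E"
      proof clarsimp
        fix z assume "dist p z * 2 < \<rho>"
        then show "dist (y (r i)) z < \<rho>" using elim dist_triangle[of "y (r i)" z p] by linarith
      qed
      then have "measure M (S \<inter> ball p (\<rho>/2) - E) \<le> measure M (S \<inter> ball (y (r i)) \<rho> - E)"
        by (rule finite_measure_mono) (use sets_int[of "ball (y (r i)) \<rho>"] E in auto)
      then show ?case using y(2)[of "r i"] by simp
    qed
  qed simp
  then have "emeasure M (S \<inter> ball p (\<rho>/2) - E) = 0"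
    using measure_nonneg[of M "S \<inter> ball p (\<rho>/2) - E"] by (simp add: emeasure_eq_measure)
  then show ?thesis using p \<rho>(1) by (intro bexI[of _ p] exI[of _ "\<rho>/2"]) auto
qed

end

section \<open>Calculus on the sphere\<close>

lemma sph_iff: "x \<in> sph \<longleftrightarrow> norm x = 1"
  by (simp add: sph_def)

lemma compact_sph: "compact (sph :: (real^'n) set)"
  by (simp add: sph_def)

lemma normalize_in_sph: "x \<noteq> 0 \<Longrightarrow> x /\<^sub>R norm x \<in> sph"
  by (simp add: sph_iff)

lemma radext_sph: "x \<in> sph \<Longrightarrow> radext g x = g x"
  by (simp add: radext_def sph_iff)

text \<open>By homogeneity of degree 0 the derivative at x is the one at x / |x| with its argument
  divided by |x|. Bounds for \<open>D\<close> on the sphere thus control the derivative off the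
  sphere.\<close>

lemma sph_deriv_at:
  fixes g :: "real^'n \<Rightarrow> real^'n"
  assumes "sph_deriv g D" "x \<noteq> 0"
  shows "(radext g has_derivative (\<lambda>u. D (x /\<^sub>R norm x) (u /\<^sub>R norm x))) (at x)"
proof -
  define s where "s = x /\<^sub>R norm x"
  have s: "s \<noteq> 0" using assms(2) by (simp add: s_def)
  have "(radext g has_derivative blinfun_apply (D s)) (at s)"
    using assms(1) s by (simp add: sph_deriv_def)
  then have "((\<lambda>y. radext g (y /\<^sub>R norm x)) has_derivative (\<lambda>u. D s (u /\<^sub>R norm x))) (at x)"
    unfolding s_def
    by (rule has_derivative_compose[of "\<lambda>y. y /\<^sub>R norm x" "\<lambda>u. u /\<^sub>R norm x", rotated])
       (intro bounded_linear_imp_has_derivative bounded_linear_scaleR_right)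
  moreover have "(\<lambda>y. radext g (y /\<^sub>R norm x)) = radext g"
  proof
    fix y :: "real^'n"
    have e: "norm x * inverse (norm y) * inverse (norm x) = inverse (norm y)"
      using assms(2) by (metis mult.assoc mult.commute mult.right_neutral norm_eq_zero right_inverse)
    have "(y /\<^sub>R norm x) /\<^sub>R norm (y /\<^sub>R norm x) = (norm x * inverse (norm y) * inverse (norm x)) *\<^sub>R y"
      by simp
    then show "radext g (y /\<^sub>R norm x) = radext g y"
      by (simp only: radext_def e)
  qed
  ultimately show ?thesis by (simp add: s_def)
qed

text \<open>The mean value inequality is applied along the chord rather than an arc. The chord dips
  inside the ball, where homogeneity enlarges the derivative by a factor of at most 1/m.\<close>

lemma sph_deriv_lipschitz_segment:
  fixes g :: "real^'n \<Rightarrow> real^'n"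
  assumes D: "sph_deriv g D" and pq: "p \<in> sph" "q \<in> sph" and m: "m > 0"
    and b: "\<And>y. y \<in> closed_segment p q \<Longrightarrow> norm y \<ge> m \<and> norm (D (y /\<^sub>R norm y)) \<le> \<kappa>"
  shows "dist (g p) (g q) \<le> \<kappa> / m * dist p q"
proof -
  have "norm (radext g p - radext g q) \<le> \<kappa> / m * norm (p - q)"
  proof (rule differentiable_bound[where S="closed_segment p q"
        and f'="\<lambda>y u. D (y /\<^sub>R norm y) (u /\<^sub>R norm y)"])
    fix y assume y: "y \<in> closed_segment p q"
    have ny: "norm y \<ge> m" and nD: "norm (D (y /\<^sub>R norm y)) \<le> \<kappa>" using b[OF y] by auto
    have y0: "y \<noteq> 0" using ny m by auto
    show "(radext g has_derivative (\<lambda>u. D (y /\<^sub>R norm y) (u /\<^sub>R norm y))) (at y within closed_segment p q)"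
      by (rule has_derivative_at_withinI[OF sph_deriv_at[OF D y0]])
    show "onorm (\<lambda>u. D (y /\<^sub>R norm y) (u /\<^sub>R norm y)) \<le> \<kappa> / m"
    proof (rule onorm_bound)
      have \<kappa>0: "\<kappa> \<ge> 0" using nD norm_ge_zero order_trans by blast
      show "0 \<le> \<kappa> / m" using \<kappa>0 m by simp
      fix u
      have "norm (D (y /\<^sub>R norm y) (u /\<^sub>R norm y)) \<le> norm (D (y /\<^sub>R norm y)) * norm (u /\<^sub>R norm y)"
        by (rule norm_blinfun)
      also have "\<dots> \<le> \<kappa> * norm (u /\<^sub>R norm y)" using nD by (intro mult_right_mono) auto
      also have "norm (u /\<^sub>R norm y) = norm u / norm y" by (simp add: divide_inverse mult.commute)
      also have "\<kappa> * (norm u / norm y) \<le> \<kappa> * (norm u / m)"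
        using ny m \<kappa>0 by (intro mult_left_mono divide_left_mono) (auto intro!: mult_pos_pos)
      finally show "norm (D (y /\<^sub>R norm y) (u /\<^sub>R norm y)) \<le> \<kappa> / m * norm u" by simp
    qed
  qed auto
  then show ?thesis using pq by (simp add: radext_sph dist_norm)
qed

lemma norm_segment_ge:
  fixes x y p q :: "'a::real_normed_vector"
  assumes "y \<in> closed_segment p q" "dist p x \<le> r" "dist q x \<le> r" "norm x = 1"
  shows "dist y x \<le> r" "norm y \<ge> 1 - r"
proof -
  have "closed_segment p q \<subseteq> cball x r"
    using assms by (intro closed_segment_subset) (auto simp: dist_commute)
  then show 1: "dist y x \<le> r" using assms by (auto simp: dist_commute)
  then show "norm y \<ge> 1 - r" using norm_triangle_ineq2[of x "x - y"] assms(4)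
    by (simp add: dist_norm norm_minus_commute)
qed

lemma sph_deriv_bounded:
  assumes "sph_deriv g D"
  obtains B where "B > 0" "\<And>x. x \<in> sph \<Longrightarrow> norm (D x) \<le> B"
proof -
  have "continuous_on sph D"
    using assms unfolding sph_deriv_def by (auto intro: continuous_on_subset simp: sph_iff)
  then have "bounded (D ` sph)"
    by (intro compact_imp_bounded compact_continuous_image compact_sph)
  then show ?thesis using that by (auto simp: bounded_pos)
qed

text \<open>Chords of length at most 1/2 keep distance 1/2 from the origin, which gives B / (1/2).
  Longer chords may pass through it, but for them the diameter 2 of the sphere is already below 4 *
  dist p q.\<close>

lemma C1_sph_lipschitz:
  assumes "C1_sph g"
  obtains L where "L > 0" "\<And>p q. p \<in> sph \<Longrightarrow> q \<in> sph \<Longrightarrow> dist (g p) (g q) \<le> L * dist p q"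
proof -
  obtain D where D: "sph_deriv g D" and im: "g ` sph \<subseteq> sph" using assms by (auto simp: C1_sph_def)
  obtain B where B: "B > 0" "\<And>x. x \<in> sph \<Longrightarrow> norm (D x) \<le> B" by (fact sph_deriv_bounded[OF D])
  have "dist (g p) (g q) \<le> max (2*B) 4 * dist p q" if pq: "p \<in> sph" "q \<in> sph" for p q
  proof (cases "dist p q \<le> 1/2")
    case True
    have "dist (g p) (g q) \<le> B / (1/2) * dist p q"
    proof (rule sph_deriv_lipschitz_segment[OF D pq])
      fix y assume y: "y \<in> closed_segment p q"
      have "norm y \<ge> 1/2"
        using norm_segment_ge(2)[OF y, of p "1/2"] True pq by (auto simp: sph_iff dist_commute)
      moreover have "norm (D (y /\<^sub>R norm y)) \<le> B"
        using \<open>norm y \<ge> 1/2\<close> by (intro B normalize_in_sph) auto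
      ultimately show "norm y \<ge> 1/2 \<and> norm (D (y /\<^sub>R norm y)) \<le> B" by blast
    qed simp
    also have "\<dots> \<le> max (2*B) 4 * dist p q" by (intro mult_right_mono) auto
    finally show ?thesis .
  next
    case False
    have "norm (g p) = 1" "norm (g q) = 1" using im pq by (auto simp: sph_iff image_subset_iff)
    then have "dist (g p) (g q) \<le> 2"
      using norm_triangle_ineq4[of "g p" "g q"] by (simp add: dist_norm)
    also have "2 \<le> 4 * dist p q" using False by simp
    also have "\<dots> \<le> max (2*B) 4 * dist p q" by (intro mult_right_mono) auto
    finally show ?thesis .
  qed
  then show ?thesis by (intro that[of "max (2*B) 4"]) auto
qed

lemma C1_sph_continuous_on:
  assumes "C1_sph g"
  shows "continuous_on sph g"
proof -
  obtain L where L: "L > 0" "\<And>p q. p \<in> sph \<Longrightarrow> q \<in> sph \<Longrightarrow> dist (g p) (g q) \<le> L * dist p q"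
    by (fact C1_sph_lipschitz[OF assms])
  show ?thesis by (rule lipschitz_continuous_on) (rule L(2))
qed

section \<open>Change of variables on the sphere\<close>

text \<open>The change of variables theorem of the library is only available for well-ordered index
  types, so it is transported along a copy of the index type that carries such an order.\<close>
typedef 'a ordered_copy = "UNIV :: 'a set" ..

instance ordered_copy :: (finite) finite
proof
  have "(UNIV :: 'a ordered_copy set) = Abs_ordered_copy ` UNIV"
    by (metis Rep_ordered_copy_inverse surj_def)
  then show "finite (UNIV :: 'a ordered_copy set)" by (metis finite finite_imageI)
qed

definition copy_index :: "'a::finite ordered_copy \<Rightarrow> nat" where
  "copy_index = (SOME f. inj f)"

lemma inj_copy_index: "inj copy_index"
proof -
  have "\<exists>f :: 'a ordered_copy \<Rightarrow> nat. inj f"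
    using finite_imp_inj_to_nat_seg[of "UNIV :: 'a ordered_copy set"] by auto
  then show ?thesis unfolding copy_index_def by (rule someI_ex)
qed

instantiation ordered_copy :: (finite) wellorder
begin

definition less_eq_ordered_copy :: "'a ordered_copy \<Rightarrow> 'a ordered_copy \<Rightarrow> bool" where
  "less_eq_ordered_copy x y \<longleftrightarrow> copy_index x \<le> copy_index y"

definition less_ordered_copy :: "'a ordered_copy \<Rightarrow> 'a ordered_copy \<Rightarrow> bool" where
  "less_ordered_copy x y \<longleftrightarrow> copy_index x < copy_index y"

instance
proof (standard, goal_cases)
  case (1 x y)
  show ?case unfolding less_eq_ordered_copy_def less_ordered_copy_def by (rule less_le_not_le)
next
  case (2 x)
  show ?case unfolding less_eq_ordered_copy_def by (rule order_refl)
next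
  case (3 x y z)
  then show ?case unfolding less_eq_ordered_copy_def by (rule order_trans)
next
  case (4 x y)
  then have "copy_index x = copy_index y"
    unfolding less_eq_ordered_copy_def by (rule order_antisym)
  then show ?case by (rule injD[OF inj_copy_index])
next
  case (5 x y)
  show ?case unfolding less_eq_ordered_copy_def by (rule linear)
next
  case (6 P a)
  show ?case
  proof (induction "copy_index a" arbitrary: a rule: less_induct)
    case less
    show ?case by (rule 6, rule less) (simp only: less_ordered_copy_def)
  qed
qed

end

definition to_copy :: "real^'n \<Rightarrow> real^('n ordered_copy)" where
  "to_copy x = (\<chi> i. x $ Rep_ordered_copy i)"

definition of_copy :: "real^('n ordered_copy) \<Rightarrow> real^'n" where
  "of_copy x = (\<chi> i. x $ Abs_ordered_copy i)"

lemma of_to_copy [simp]: "of_copy (to_copy x) = x"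
  by (simp add: of_copy_def to_copy_def vec_eq_iff Abs_ordered_copy_inverse)

lemma to_of_copy [simp]: "to_copy (of_copy x) = x"
  by (simp add: of_copy_def to_copy_def vec_eq_iff Rep_ordered_copy_inverse)

lemma linear_to_copy: "linear to_copy"
  by (rule linearI) (auto simp: to_copy_def vec_eq_iff)

lemma linear_of_copy: "linear of_copy"
  by (rule linearI) (auto simp: of_copy_def vec_eq_iff)

lemma bounded_linear_copy: "bounded_linear to_copy" "bounded_linear of_copy"
  using linear_to_copy linear_of_copy by (simp_all add: linear_conv_bounded_linear)

lemma measurable_copy [measurable]:
  "to_copy \<in> borel_measurable borel" "of_copy \<in> borel_measurable borel"
  using bounded_linear_copy[THEN linear_continuous_on] by (auto intro: borel_measurable_continuous_onI)

lemma bij_Rep_ordered_copy: "bij Rep_ordered_copy"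
  by (metis Abs_ordered_copy_inverse Rep_ordered_copy_inverse UNIV_I bijI')

text \<open>Relabelling coordinates maps boxes to boxes with the same side lengths, and the volumes
  of boxes determine Lebesgue measure.\<close>

lemma lborel_of_copy: "distr lborel borel of_copy = (lborel :: (real^'n) measure)"
proof (rule lborel_eqI[symmetric])
  fix l u :: "real^'n" assume lu: "\<And>b. b \<in> Basis \<Longrightarrow> l \<bullet> b \<le> u \<bullet> b"
  have lu': "l $ i \<le> u $ i" for i using lu[of "axis i 1"] by (simp add: inner_axis)
  have "of_copy -` box l u = box (to_copy l) (to_copy u)"
    by (auto simp: mem_box_cart of_copy_def to_copy_def Abs_ordered_copy_inverse)
       (metis Rep_ordered_copy_inverse Abs_ordered_copy_inverse UNIV_I)+
  then have "emeasure (distr lborel borel of_copy) (box l u) = emeasure lborel (box (to_copy l) (to_copy u))"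
    by (simp add: emeasure_distr)
  also have "\<dots> = ennreal (\<Prod>b\<in>Basis. (to_copy u - to_copy l) \<bullet> b)"
    by (rule emeasure_lborel_box) (use lu' in \<open>auto simp: Basis_vec_def inner_axis to_copy_def\<close>)
  also have "(\<Prod>b\<in>Basis. (to_copy u - to_copy l) \<bullet> b) = (\<Prod>i\<in>UNIV. (to_copy u - to_copy l) $ i)"
    by (simp add: Basis_vec_def prod.UNION_disjoint axis_eq_axis inner_axis)
  also have "\<dots> = (\<Prod>i\<in>UNIV. (u - l) $ Rep_ordered_copy i)"
    by (simp add: to_copy_def)
  also have "\<dots> = (\<Prod>i\<in>UNIV. (u - l) $ i)"
    by (rule prod.reindex_bij_betw) (rule bij_Rep_ordered_copy)
  also have "\<dots> = (\<Prod>b\<in>Basis. (u - l) \<bullet> b)"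
    by (simp add: Basis_vec_def prod.UNION_disjoint axis_eq_axis inner_axis)
  finally show "emeasure (distr lborel borel of_copy) (box l u) = ennreal (\<Prod>b\<in>Basis. (u - l) \<bullet> b)" .
qed simp

text \<open>Conjugation by the measure-preserving relabelling reduces this to the ordered index
  type. The determinant stays in relabelled coordinates, where it serves its later purpose of being
  Hoelder and giving the right integrals equally well.\<close>

lemma emeasure_differentiable_image:
  fixes f :: "real^'n \<Rightarrow> real^'n"
  assumes S: "S \<in> sets borel" and fS: "f ` S \<in> sets borel" "bounded (f ` S)"
    and der: "\<And>x. x \<in> S \<Longrightarrow> (f has_derivative f' x) (at x within S)" and inj: "inj_on f S"
    and meas: "(\<lambda>x. ennreal \<bar>det (matrix (to_copy \<circ> f' x \<circ> of_copy))\<bar> * indicator S x) \<in> borel_measurable borel"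
  shows "emeasure lborel (f ` S) =
    (\<integral>\<^sup>+x. ennreal \<bar>det (matrix (to_copy \<circ> f' x \<circ> of_copy))\<bar> * indicator S x \<partial>lborel)"
proof -
  define T where "T = of_copy -` S"
  define F where "F = to_copy \<circ> f \<circ> of_copy"
  define F' where "F' y = to_copy \<circ> f' (of_copy y) \<circ> of_copy" for y
  have T_sets: "T \<in> sets borel" unfolding T_def
    using measurable_sets[OF measurable_copy(2) S] by simp
  have FT: "F ` T = of_copy -` (f ` S)"
  proof
    show "F ` T \<subseteq> of_copy -` (f ` S)" by (auto simp: F_def T_def)
    show "of_copy -` (f ` S) \<subseteq> F ` T"
    proof
      fix y assume "y \<in> of_copy -` (f ` S)"
      then obtain x where x: "x \<in> S" "of_copy y = f x" by auto
      then have "y = F (to_copy x)" by (metis F_def comp_apply of_to_copy to_of_copy)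
      then show "y \<in> F ` T" using x by (auto simp: T_def)
    qed
  qed
  have FT_sets: "F ` T \<in> sets borel" unfolding FT
    using measurable_sets[OF measurable_copy(2) fS(1)] by simp
  have "F ` T = to_copy ` f ` S"
  proof (intro set_eqI iffI)
    fix z assume "z \<in> to_copy ` f ` S"
    then obtain x where "x \<in> S" "z = to_copy (f x)" by auto
    then show "z \<in> F ` T" by (intro image_eqI[of _ _ "to_copy x"]) (auto simp: F_def T_def)
  qed (auto simp: F_def T_def)
  then have "bounded (F ` T)"
    using bounded_linear_image[OF fS(2)] linear_to_copy by (simp add: linear_conv_bounded_linear)
  then have FT_lm: "F ` T \<in> lmeasurable"
    using FT_sets by (intro bounded_set_imp_lmeasurable) auto
  have der': "(F has_derivative F' y) (at y within T)" if "y \<in> T" for y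
  proof -
    note b = bounded_linear_copy
    have "(f has_derivative f' (of_copy y)) (at (of_copy y) within of_copy ` T)"
      by (rule has_derivative_subset[OF der]) (use that in \<open>auto simp: T_def\<close>)
    then have "((\<lambda>y. f (of_copy y)) has_derivative (\<lambda>v. f' (of_copy y) (of_copy v))) (at y within T)"
      by (rule has_derivative_in_compose[OF bounded_linear_imp_has_derivative[OF b(2)]])
    from bounded_linear.has_derivative[OF b(1) this]
    show ?thesis by (simp add: F_def F'_def o_def)
  qed
  have "inj_on F T"

  proof (rule inj_onI)
    fix y z assume yz: "y \<in> T" "z \<in> T" and "F y = F z"
    then have "f (of_copy y) = f (of_copy z)" by (metis F_def comp_apply of_to_copy)
    then have "of_copy y = of_copy z" using yz inj by (auto simp: T_def dest: inj_onD)
    then show "y = z" by (metis to_of_copy)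
  qed
  then have "((\<lambda>x. \<bar>det (matrix (F' x))\<bar>) has_integral measure lebesgue (F ` T)) T"
    using has_measure_differentiable_image[of T F F' "measure lebesgue (F ` T)"] T_sets der' FT_lm by auto
  then have "(\<integral>\<^sup>+x. ennreal \<bar>det (matrix (F' x))\<bar> * indicator T x \<partial>lborel) = ennreal (measure lebesgue (F ` T))"
    by (intro nn_integral_has_integral_lebesgue') auto
  also have "\<dots> = emeasure lborel (F ` T)"
    using emeasure_eq_measure2[OF FT_lm] FT_sets by simp
  also have "\<dots> = emeasure (distr lborel borel of_copy) (f ` S)"
    using fS(1) by (simp add: FT emeasure_distr)
  finally have 1: "(\<integral>\<^sup>+x. ennreal \<bar>det (matrix (F' x))\<bar> * indicator T x \<partial>lborel) = emeasure lborel (f ` S)"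
    by (simp add: lborel_of_copy)
  have "(\<integral>\<^sup>+x. ennreal \<bar>det (matrix (to_copy \<circ> f' x \<circ> of_copy))\<bar> * indicator S x \<partial>lborel)
      = (\<integral>\<^sup>+x. ennreal \<bar>det (matrix (to_copy \<circ> f' x \<circ> of_copy))\<bar> * indicator S x \<partial>distr lborel borel of_copy)"
    by (simp add: lborel_of_copy)
  also have "\<dots> = (\<integral>\<^sup>+x. ennreal \<bar>det (matrix (F' x))\<bar> * indicator T x \<partial>lborel)"
    by (subst nn_integral_distr, simp, use meas in simp) (auto simp: F'_def T_def indicator_def intro!: nn_integral_cong)
  finally show ?thesis using 1 by simp
qed

text \<open>As the push-forward under radial projection, it assigns to a Borel set the volume of its
  cone, the quantity in terms of which \<open>ergodic_action\<close> is stated. It is surface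
  measure up to a constant factor.\<close>

definition sphere_measure :: "(real^'n) measure" where
  "sphere_measure = distr (restrict_space lborel (cball 0 1 - {0})) (restrict_space borel sph) (\<lambda>x. x /\<^sub>R norm x)"

lemma sets_sphere_measure: "sets sphere_measure = sets (restrict_space borel sph)"
  by (simp add: sphere_measure_def)

lemma space_sphere_measure: "space sphere_measure = sph"
  by (simp add: sphere_measure_def space_restrict_space)

lemma sets_sphere_measure_iff:
  fixes X :: "(real^'n) set"
  shows "X \<in> sets sphere_measure \<longleftrightarrow> X \<in> sets borel \<and> X \<subseteq> sph"
proof -
  have "sph \<in> sets (borel :: (real^'n) measure)" by (simp add: sph_def)
  then have "sph \<inter> space borel \<in> sets (borel :: (real^'n) measure)" by simp
  from sets_restrict_space_iff[OF this] show ?thesis by (auto simp: sets_sphere_measure)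
qed

lemma measurable_normalize:
  "(\<lambda>x. x /\<^sub>R norm x) \<in> measurable (restrict_space lborel (cball 0 1 - {0})) (restrict_space borel sph)"
proof (rule measurable_restrict_space2)
  show "(\<lambda>x. x /\<^sub>R norm x) \<in> space (restrict_space lborel (cball 0 1 - {0})) \<rightarrow> (sph :: (real^'n) set)"
    by (auto simp: space_restrict_space normalize_in_sph)
  show "(\<lambda>x::real^'n. x /\<^sub>R norm x) \<in> borel_measurable (restrict_space lborel (cball 0 1 - {0}))"
    by (rule measurable_restrict_space1) simp
qed

lemma cone_sph_eq:
  assumes "X \<subseteq> sph"
  shows "cone_sph X = {x \<in> cball 0 1 - {0}. x /\<^sub>R norm x \<in> X}"
proof (intro set_eqI iffI)
  fix x assume "x \<in> cone_sph X"
  then obtain t y where t: "x = t *\<^sub>R y" "0 < t" "t \<le> 1" "y \<in> X" by (auto simp: cone_sph_def)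
  have ny: "norm y = 1" using t assms by (auto simp: sph_iff)
  then have nx: "norm x = t" using t by simp
  have "x /\<^sub>R norm x = y" unfolding nx using t by simp
  moreover have "x \<noteq> 0" using nx t by auto
  ultimately show "x \<in> {x \<in> cball 0 1 - {0}. x /\<^sub>R norm x \<in> X}" using t nx by simp
next
  fix x assume x: "x \<in> {x \<in> cball 0 1 - {0}. x /\<^sub>R norm x \<in> X}"
  then have "x = norm x *\<^sub>R (x /\<^sub>R norm x)" "0 < norm x" "norm x \<le> 1" by auto
  then show "x \<in> cone_sph X" using x unfolding cone_sph_def by blast
qed

lemma emeasure_sphere_measure:
  assumes "X \<in> sets sphere_measure"
  shows "cone_sph X \<in> sets borel" "emeasure sphere_measure X = emeasure lborel (cone_sph X)"
proof -
  have X: "X \<in> sets (restrict_space borel sph)" "X \<subseteq> sph"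
    using assms by (auto simp: sets_sphere_measure sets_sphere_measure_iff[symmetric])
       (metis assms sets_sphere_measure_iff subsetD)
  have eq: "(\<lambda>x. x /\<^sub>R norm x) -` X \<inter> space (restrict_space lborel (cball 0 1 - {0})) = cone_sph X"
    unfolding cone_sph_eq[OF X(2)] by (auto simp: space_restrict_space)
  have "cone_sph X \<in> sets (restrict_space lborel (cball 0 1 - {0}))"
    using measurable_sets[OF measurable_normalize X(1)] unfolding eq .
  then show c: "cone_sph X \<in> sets borel" by (auto simp: sets_restrict_space_iff)
  show "emeasure sphere_measure X = emeasure lborel (cone_sph X)"
    unfolding sphere_measure_def emeasure_distr[OF measurable_normalize X(1)] eq
    by (rule emeasure_restrict_space) (auto simp: cone_sph_eq[OF X(2)])
qed

lemma finite_sphere_measure: "finite_measure (sphere_measure :: (real^'n) measure)"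
proof
  have "emeasure (sphere_measure :: (real^'n) measure) (space sphere_measure) = emeasure lborel (cone_sph sph :: (real^'n) set)"
    using emeasure_sphere_measure(2)[OF sets.top] by (simp only: space_sphere_measure)
  also have "\<dots> \<le> emeasure lborel (cball 0 1 :: (real^'n) set)"
    by (rule emeasure_mono) (auto simp: cone_sph_eq)
  also have "\<dots> < \<infinity>" by (rule emeasure_lborel_cball_finite)
  finally show "emeasure (sphere_measure :: (real^'n) measure) (space sphere_measure) \<noteq> \<infinity>" by simp
qed

lemma borel_measurable_normalize:
  fixes \<phi> :: "real^'n \<Rightarrow> ennreal"
  assumes "\<phi> \<in> borel_measurable sphere_measure"
  shows "(\<lambda>x. \<phi> (x /\<^sub>R norm x) * indicator (cball 0 1 - {0}) x) \<in> borel_measurable lborel"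
proof -
  have "(\<lambda>x. \<phi> (x /\<^sub>R norm x)) \<in> borel_measurable (restrict_space lborel (cball 0 1 - {0}))"
    using assms by (intro measurable_compose[OF measurable_normalize])
      (simp add: measurable_cong_sets[OF sets_sphere_measure refl])
  then show ?thesis by (subst (asm) borel_measurable_restrict_space_iff_ennreal) auto
qed

lemma nn_integral_sphere_measure:
  fixes \<phi> :: "real^'n \<Rightarrow> ennreal"
  assumes "\<phi> \<in> borel_measurable sphere_measure"
  shows "integral\<^sup>N sphere_measure \<phi> = (\<integral>\<^sup>+x. \<phi> (x /\<^sub>R norm x) * indicator (cball 0 1 - {0}) x \<partial>lborel)"
proof -
  have "\<phi> \<in> borel_measurable (restrict_space borel sph)"
    using assms by (simp add: measurable_cong_sets[OF sets_sphere_measure refl])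
  then show ?thesis unfolding sphere_measure_def
    by (subst nn_integral_distr[OF measurable_normalize]) (auto simp: nn_integral_restrict_space)
qed

lemma continuous_measurable_sphere:
  fixes f :: "real^'n \<Rightarrow> 'b::topological_space"
  assumes "continuous_on sph f"
  shows "f \<in> borel_measurable sphere_measure"
  using borel_measurable_continuous_on_restrict[OF assms]
  by (simp add: measurable_cong_sets[OF sets_sphere_measure refl])

lemma measurable_sphere_map:
  assumes "continuous_on sph g" "g ` sph \<subseteq> sph"
  shows "g \<in> measurable sphere_measure sphere_measure"
proof -
  have "g \<in> measurable sphere_measure (restrict_space borel sph)"
    using assms(2) by (intro measurable_restrict_space2 continuous_measurable_sphere assms(1))
      (auto simp: space_sphere_measure)
  then show ?thesis by (simp add: measurable_cong_sets[OF refl sets_sphere_measure])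
qed

text \<open>The derivative at \<open>s\<close>, on the sphere, of the degree-1 homogeneous extension of \<open>g\<close>.\<close>
definition cone_deriv :: "(real^'n \<Rightarrow> real^'n) \<Rightarrow> (real^'n \<Rightarrow> ((real^'n) \<Rightarrow>\<^sub>L (real^'n))) \<Rightarrow>
    real^'n \<Rightarrow> real^'n \<Rightarrow> real^'n" where
  "cone_deriv g D s u = (s \<bullet> u) *\<^sub>R g s + D s u"

text \<open>The degree-1 extension of a self-map of the sphere preserves norms, so it carries cones
  over sets to cones over their images, and its derivative is constant along rays. Its determinant
  is therefore the density of the map with respect to \<open>sphere_measure\<close>, obtained
  without charts or tangent spaces.\<close>

definition sphere_jacobian :: "(real^'n \<Rightarrow> real^'n) \<Rightarrow> (real^'n \<Rightarrow> ((real^'n) \<Rightarrow>\<^sub>L (real^'n))) \<Rightarrow>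
    real^'n \<Rightarrow> real" where
  "sphere_jacobian g D s = \<bar>det (matrix (to_copy \<circ> cone_deriv g D s \<circ> of_copy))\<bar>"

lemma cone_map_has_derivative:
  assumes "sph_deriv g D" "x \<noteq> 0"
  shows "((\<lambda>x. norm x *\<^sub>R radext g x) has_derivative cone_deriv g D (x /\<^sub>R norm x)) (at x)"
proof -
  define s where "s = x /\<^sub>R norm x"
  have n: "(norm has_derivative (\<lambda>u. s \<bullet> u)) (at x)"
    using has_derivative_norm[OF assms(2)] by (simp add: s_def sgn_div_norm inner_commute)
  have "((\<lambda>x. norm x *\<^sub>R radext g x) has_derivative
      (\<lambda>u. norm x *\<^sub>R D s (u /\<^sub>R norm x) + (s \<bullet> u) *\<^sub>R radext g x)) (at x)"
    by (rule has_derivative_scaleR[OF n]) (use sph_deriv_at[OF assms] in \<open>simp add: s_def\<close>)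
  moreover have "(\<lambda>u. norm x *\<^sub>R D s (u /\<^sub>R norm x) + (s \<bullet> u) *\<^sub>R radext g x) = cone_deriv g D s"
    using assms(2) by (simp add: fun_eq_iff cone_deriv_def blinfun.scaleR_right radext_def s_def)
  ultimately show ?thesis by (simp add: s_def)
qed

text \<open>A determinant is a polynomial in its entries, and each entry combines coordinates of s
  and of g s, both Lipschitz, with an entry of D s, Hoelder by assumption.\<close>

lemma sphere_jacobian_holder:
  fixes g :: "real^'n \<Rightarrow> real^'n"
  assumes g: "C1_sph g" and D: "sph_deriv g D" and \<alpha>: "0 < \<alpha>" "\<alpha> \<le> 1"
    and C: "\<And>x y. x \<in> sph \<Longrightarrow> y \<in> sph \<Longrightarrow> norm (D x - D y) \<le> C * dist x y powr \<alpha>"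
  shows "holder_on \<alpha> sph (sphere_jacobian g D)"
proof -
  have bS: "bounded (sph :: (real^'n) set)" using compact_sph by (rule compact_imp_bounded)
  obtain L where L: "L > 0" "\<And>p q. p \<in> sph \<Longrightarrow> q \<in> sph \<Longrightarrow> dist (g p) (g q) \<le> L * dist p q"
    by (fact C1_sph_lipschitz[OF g])
  obtain B where B: "B > 0" "\<And>x. x \<in> sph \<Longrightarrow> norm (D x) \<le> B" by (fact sph_deriv_bounded[OF D])
  have entry: "holder_on \<alpha> sph (\<lambda>s. cone_deriv g D s v $ a)" for v a
  proof -
    have 1: "holder_on \<alpha> sph (\<lambda>s. s \<bullet> v)"
    proof (rule holder_on_lipschitz[OF bS \<alpha>, where L="norm v"])
      fix x y :: "real^'n"
      show "\<bar>x \<bullet> v - y \<bullet> v\<bar> \<le> norm v * dist x y"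
        using Cauchy_Schwarz_ineq2[of "x - y" v] by (simp add: inner_diff_left dist_norm mult.commute)
    qed
    have 2: "holder_on \<alpha> sph (\<lambda>s. g s $ a)"
    proof (rule holder_on_lipschitz[OF bS \<alpha>, where L=L])
      fix x y :: "real^'n" assume xy: "x \<in> sph" "y \<in> sph"
      have "\<bar>g x $ a - g y $ a\<bar> \<le> dist (g x) (g y)"
        using component_le_norm_cart[of "g x - g y" a] by (simp add: dist_norm)
      also have "\<dots> \<le> L * dist x y" by (rule L(2)[OF xy])
      finally show "\<bar>g x $ a - g y $ a\<bar> \<le> L * dist x y" .
    qed
    have 3: "holder_on \<alpha> sph (\<lambda>s. D s v $ a)"
    proof (rule holder_onI[where B="B * norm v" and C="C * norm v"])
      fix x :: "real^'n" assume x: "x \<in> sph"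
      have "\<bar>D x v $ a\<bar> \<le> norm (D x v)" by (rule component_le_norm_cart)
      also have "\<dots> \<le> norm (D x) * norm v" by (rule norm_blinfun)
      also have "\<dots> \<le> B * norm v" by (intro mult_right_mono B x) simp
      finally show "\<bar>D x v $ a\<bar> \<le> B * norm v" .
    next
      fix x y :: "real^'n" assume xy: "x \<in> sph" "y \<in> sph"
      have "\<bar>D x v $ a - D y v $ a\<bar> = \<bar>(D x - D y) v $ a\<bar>" by (simp add: blinfun.diff_left)
      also have "\<dots> \<le> norm ((D x - D y) v)" by (rule component_le_norm_cart)
      also have "\<dots> \<le> norm (D x - D y) * norm v" by (rule norm_blinfun)
      also have "\<dots> \<le> (C * dist x y powr \<alpha>) * norm v" by (intro mult_right_mono C xy) simp
      finally show "\<bar>D x v $ a - D y v $ a\<bar> \<le> C * norm v * dist x y powr \<alpha>" by (simp add: mult_ac)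
    qed
    show ?thesis unfolding cone_deriv_def
      using holder_on_add[OF holder_on_mult[OF 1 2] 3] by simp
  qed
  have "holder_on \<alpha> sph (\<lambda>s. det (matrix (to_copy \<circ> cone_deriv g D s \<circ> of_copy)))"
    unfolding det_def
    by (intro holder_on_sum holder_on_mult holder_on_const holder_on_prod)
       (simp add: matrix_def to_copy_def entry)
  then show ?thesis unfolding sphere_jacobian_def by (rule holder_on_abs)
qed

text \<open>It is enough to compare two measures on Borel sets X: the norm-preserving extension
  \<open>G\<close> maps the cone over the preimage of X bijectively onto the cone over X, so the
  volume formula of the ambient space applies. The statement for integrals is the equality of
  \<open>sphere_measure\<close> with the push-forward of its weighted version.\<close>

lemma sphere_change_of_variables:
  fixes g :: "real^'n \<Rightarrow> real^'n"
  assumes bij: "bij_betw g sph sph" and g: "C1_sph g" and D: "sph_deriv g D"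
    and J: "continuous_on sph (sphere_jacobian g D)"
    and \<phi>: "\<phi> \<in> borel_measurable sphere_measure"
  shows "(\<integral>\<^sup>+y. ennreal (sphere_jacobian g D y) * \<phi> (g y) \<partial>sphere_measure) = integral\<^sup>N sphere_measure \<phi>"
proof -
  define G where "G x = norm x *\<^sub>R radext g x" for x
  have gs: "g y \<in> sph" if "y \<in> sph" for y using bij that by (auto simp: bij_betw_def)
  have g_meas: "g \<in> measurable sphere_measure sphere_measure"
    by (rule measurable_sphere_map) (use C1_sph_continuous_on[OF g] gs in auto)
  have J_meas: "(\<lambda>y. ennreal (sphere_jacobian g D y)) \<in> borel_measurable sphere_measure"
    by (rule measurable_compose[OF continuous_measurable_sphere[OF J] measurable_ennreal])
  have eq: "distr (density sphere_measure (\<lambda>y. ennreal (sphere_jacobian g D y))) sphere_measure g = sphere_measure"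
  proof (rule measure_eqI)
    fix X assume "X \<in> sets (distr (density sphere_measure (\<lambda>y. ennreal (sphere_jacobian g D y))) sphere_measure g)"
    then have X: "X \<in> sets sphere_measure" by simp
    then have Xs: "X \<subseteq> sph" by (simp add: sets_sphere_measure_iff)
    define Y where "Y = g -` X \<inter> sph"
    have Ys: "Y \<subseteq> sph" by (simp add: Y_def)
    have Y: "Y \<in> sets sphere_measure"
      using measurable_sets[OF g_meas X] by (simp add: Y_def space_sphere_measure)
    have nG: "norm (G x) = norm x" "G x /\<^sub>R norm (G x) = radext g x" if "x \<noteq> 0" for x
    proof -
      have "norm (radext g x) = 1"
        using gs[OF normalize_in_sph[OF that]] by (simp add: radext_def sph_iff)
      then show "norm (G x) = norm x" by (simp add: G_def)
      then show "G x /\<^sub>R norm (G x) = radext g x" using that by (simp add: G_def)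
    qed
    have inj: "inj_on G (cone_sph Y)"
    proof (rule inj_onI)
      fix x y assume "x \<in> cone_sph Y" "y \<in> cone_sph Y" and e: "G x = G y"
      then have xy: "x \<noteq> 0" "y \<noteq> 0" by (auto simp: cone_sph_eq[OF Ys])
      have n: "norm x = norm y" using nG(1)[OF xy(1)] nG(1)[OF xy(2)] e by simp
      have "g (x /\<^sub>R norm x) = g (y /\<^sub>R norm y)"
        using nG(2)[OF xy(1)] nG(2)[OF xy(2)] e by (simp add: radext_def)
      then have "x /\<^sub>R norm x = y /\<^sub>R norm y"
        using bij_betw_imp_inj_on[OF bij] normalize_in_sph xy by (auto dest: inj_onD)
      then show "x = y" using n xy by simp
    qed
    have im: "G ` cone_sph Y = cone_sph X"
    proof (intro set_eqI iffI)
      fix z assume "z \<in> G ` cone_sph Y"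
      then obtain x where x: "x \<in> cone_sph Y" "z = G x" by auto
      then have x': "x \<noteq> 0" "norm x \<le> 1" "x /\<^sub>R norm x \<in> Y" by (auto simp: cone_sph_eq[OF Ys])
      have "z /\<^sub>R norm z \<in> X" using nG(2)[OF x'(1)] x' x(2) by (simp add: radext_def Y_def)
      moreover have "norm z = norm x" using nG(1)[OF x'(1)] x(2) by simp
      ultimately show "z \<in> cone_sph X" using x' unfolding cone_sph_eq[OF Xs] by auto
    next
      fix z assume "z \<in> cone_sph X"
      then have z: "z \<noteq> 0" "norm z \<le> 1" "z /\<^sub>R norm z \<in> X" by (auto simp: cone_sph_eq[OF Xs])
      then obtain y where y: "y \<in> sph" "g y = z /\<^sub>R norm z"
        using bij Xs by (metis bij_betw_imp_surj_on imageE subsetD)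
      have ny: "norm y = 1" using y by (simp add: sph_iff)
      define x where "x = norm z *\<^sub>R y"
      have nx: "norm x = norm z" using ny by (simp add: x_def)
      have xy: "x /\<^sub>R norm x = y" unfolding nx using z by (simp add: x_def)
      have "G x = z" unfolding G_def radext_def xy y(2) unfolding nx using z by simp
      moreover have "x \<in> cone_sph Y" unfolding cone_sph_eq[OF Ys]
        using nx xy y z by (auto simp: Y_def)
      ultimately show "z \<in> G ` cone_sph Y" by blast
    qed
    have point: "ennreal \<bar>det (matrix (to_copy \<circ> cone_deriv g D (x /\<^sub>R norm x) \<circ> of_copy))\<bar> * indicator (cone_sph Y) x
       = (ennreal (sphere_jacobian g D (x /\<^sub>R norm x)) * indicator Y (x /\<^sub>R norm x)) * indicator (cball 0 1 - {0}) x" for x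
      unfolding cone_sph_eq[OF Ys] sphere_jacobian_def by (auto simp: indicator_def)
    have JY: "(\<lambda>y. ennreal (sphere_jacobian g D y) * indicator Y y) \<in> borel_measurable sphere_measure"
      by (intro borel_measurable_times_ennreal J_meas borel_measurable_indicator Y)
    have "emeasure sphere_measure X = emeasure lborel (G ` cone_sph Y)"
      unfolding im by (rule emeasure_sphere_measure(2)[OF X])
    also have "\<dots> = (\<integral>\<^sup>+x. ennreal \<bar>det (matrix (to_copy \<circ> cone_deriv g D (x /\<^sub>R norm x) \<circ> of_copy))\<bar>
        * indicator (cone_sph Y) x \<partial>lborel)"
    proof (rule emeasure_differentiable_image[OF _ _ _ _ inj])
      show "cone_sph Y \<in> sets borel" by (rule emeasure_sphere_measure(1)[OF Y])
      show "G ` cone_sph Y \<in> sets borel" unfolding im by (rule emeasure_sphere_measure(1)[OF X])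
      show "bounded (G ` cone_sph Y)" unfolding im
        by (rule bounded_subset[OF bounded_cball[of 0 1]]) (auto simp: cone_sph_eq[OF Xs])
      show "(G has_derivative cone_deriv g D (x /\<^sub>R norm x)) (at x within cone_sph Y)"
        if "x \<in> cone_sph Y" for x
        unfolding G_def
        by (rule has_derivative_at_withinI, rule cone_map_has_derivative[OF D])
           (use that in \<open>auto simp: cone_sph_eq[OF Ys]\<close>)
      show "(\<lambda>x. ennreal \<bar>det (matrix (to_copy \<circ> cone_deriv g D (x /\<^sub>R norm x) \<circ> of_copy))\<bar>
        * indicator (cone_sph Y) x) \<in> borel_measurable borel"
        unfolding point using borel_measurable_normalize[OF JY] by simp
    qed
    also have "\<dots> = (\<integral>\<^sup>+y. ennreal (sphere_jacobian g D y) * indicator Y y \<partial>sphere_measure)"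
      unfolding point by (rule nn_integral_sphere_measure[OF JY, symmetric])
    also have "\<dots> = emeasure (density sphere_measure (\<lambda>y. ennreal (sphere_jacobian g D y))) Y"
      by (rule emeasure_density[OF J_meas Y, symmetric])
    also have "\<dots> = emeasure (distr (density sphere_measure (\<lambda>y. ennreal (sphere_jacobian g D y))) sphere_measure g) X"
      using g_meas X by (subst emeasure_distr) (auto simp: Y_def space_sphere_measure)
    finally show "emeasure (distr (density sphere_measure (\<lambda>y. ennreal (sphere_jacobian g D y))) sphere_measure g) X
       = emeasure sphere_measure X" by simp
  qed simp
  have "integral\<^sup>N sphere_measure \<phi>
      = (\<integral>\<^sup>+y. \<phi> y \<partial>distr (density sphere_measure (\<lambda>y. ennreal (sphere_jacobian g D y))) sphere_measure g)"
    by (simp only: eq)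
  also have "\<dots> = (\<integral>\<^sup>+y. \<phi> (g y) \<partial>density sphere_measure (\<lambda>y. ennreal (sphere_jacobian g D y)))"
    by (rule nn_integral_distr) (use g_meas \<phi> in auto)
  also have "\<dots> = (\<integral>\<^sup>+y. ennreal (sphere_jacobian g D y) * \<phi> (g y) \<partial>sphere_measure)"
    by (rule nn_integral_density[OF J_meas measurable_compose[OF g_meas \<phi>]])
  finally show ?thesis by simp
qed

text \<open>Inner regularity yields a closed T inside the cone over E, but T need not be a cone. As
  T avoids the origin, its radial projection \<open>K\<close> is compact; it lies in E, and the cone
  over \<open>K\<close> contains T, so no measure is lost.\<close>

lemma compact_subset_of_positive_cone:
  fixes E :: "(real^'n) set"
  assumes E: "E \<subseteq> sph" "cone_sph E \<in> sets lebesgue" "emeasure lebesgue (cone_sph E) \<noteq> 0"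
  obtains K where "compact K" "K \<subseteq> E" "emeasure sphere_measure K > 0"
proof -
  define e where "e = emeasure lebesgue (cone_sph E)"
  obtain c :: real where c: "c > 0" "ennreal c \<le> e"
  proof (cases e)
    case (real r)
    then show ?thesis using that[of r] assms(3) by (auto simp: e_def)
  next
    case top
    then show ?thesis using that[of 1] by simp
  qed
  obtain T where T: "closed T" "T \<subseteq> cone_sph E" "emeasure lebesgue (cone_sph E - T) < ennreal c"
    using sets_lebesgue_inner_closed[OF E(2) c(1)] by metis
  have T0: "x \<noteq> 0" "norm x \<le> 1" "x /\<^sub>R norm x \<in> E" if "x \<in> T" for x
    using T(2) that by (auto simp: cone_sph_eq[OF E(1)])
  have "bounded T" by (rule bounded_subset[OF bounded_cball[of 0 1]]) (use T0 in auto)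
  then have cT: "compact T" using T(1) by (simp add: compact_eq_bounded_closed)
  define K where "K = (\<lambda>x. x /\<^sub>R norm x) ` T"
  have cK: "compact K" unfolding K_def
    by (intro compact_continuous_image continuous_intros cT) (use T0 in auto)
  have KE: "K \<subseteq> E" using T0 by (auto simp: K_def)
  have Ks: "K \<in> sets sphere_measure"
    using cK KE E(1) by (auto simp: sets_sphere_measure_iff borel_compact)
  have Tl: "T \<in> sets lebesgue" using T(1) by (simp add: borel_closed)
  have "emeasure lebesgue T \<noteq> 0"
  proof
    assume z: "emeasure lebesgue T = 0"
    have "e \<le> emeasure lebesgue T + emeasure lebesgue (cone_sph E - T)"
    proof -
      have "cone_sph E = T \<union> (cone_sph E - T)" using T(2) by auto
      then show ?thesis unfolding e_def
        using emeasure_subadditive[OF Tl, of "cone_sph E - T"] E(2) Tl by auto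
    qed
    then have "e < ennreal c" using z T(3) by simp
    then show False using c(2) by simp
  qed
  moreover have "emeasure lebesgue T \<le> emeasure lebesgue (cone_sph K)"
  proof (rule emeasure_mono)
    have Ksub: "K \<subseteq> sph" using KE E(1) by auto
    show "T \<subseteq> cone_sph K" unfolding cone_sph_eq[OF Ksub] using T0 by (auto simp: K_def)
    show "cone_sph K \<in> sets lebesgue" using emeasure_sphere_measure(1)[OF Ks] by simp
  qed
  ultimately have "emeasure sphere_measure K > 0"
    using emeasure_sphere_measure[OF Ks] by (auto simp: zero_less_iff_neq_zero)
  then show ?thesis using that[OF cK KE] by blast
qed

section \<open>Contraction in the group generated by rotations and a non-orthogonal matrix\<close>

text \<open>Only positive letters are used: C^1 closeness of the generators then passes to words
  without any estimate for perturbed inverses. Density is not affected, since the closure of the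
  positive words in the rotations contains the inverses.\<close>

primrec word_mat :: "('i \<Rightarrow> real^'n^'n) \<Rightarrow> 'i list \<Rightarrow> real^'n^'n" where
  "word_mat A [] = mat 1"
| "word_mat A (i # w) = A i ** word_mat A w"

lemma word_mat_append: "word_mat A (v @ w) = word_mat A v ** word_mat A w"
  by (induction v) (simp_all add: matrix_mul_assoc)

lemma tendsto_matrix_mult:
  fixes f g :: "'a \<Rightarrow> real^'n^'n"
  assumes "(f \<longlongrightarrow> a) F" "(g \<longlongrightarrow> b) F"
  shows "((\<lambda>x. f x ** g x) \<longlongrightarrow> a ** b) F"
  unfolding matrix_matrix_mult_def
  by (rule vec_tendstoI, rule vec_tendstoI, unfold vec_lambda_beta)
     (intro tendsto_sum tendsto_mult tendsto_vec_nth assms)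

lemma tendsto_transpose:
  fixes f :: "'a \<Rightarrow> real^'n^'n"
  assumes "(f \<longlongrightarrow> a) F"
  shows "((\<lambda>x. transpose (f x)) \<longlongrightarrow> transpose a) F"
  unfolding transpose_def
  by (rule vec_tendstoI, rule vec_tendstoI, unfold vec_lambda_beta)
     (intro tendsto_vec_nth assms)

lemma closure_words_mult:
  fixes A :: "'i \<Rightarrow> real^'n^'n"
  assumes X: "X \<in> closure (word_mat A ` lists I)" and Y: "Y \<in> closure (word_mat A ` lists I)"
  shows "X ** Y \<in> closure (word_mat A ` lists I)"
proof -
  obtain x where x: "\<And>n::nat. x n \<in> word_mat A ` lists I" "x \<longlonglongrightarrow> X"
    using X unfolding closure_sequential by auto
  obtain y where y: "\<And>n::nat. y n \<in> word_mat A ` lists I" "y \<longlonglongrightarrow> Y"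
    using Y unfolding closure_sequential by auto
  have "x n ** y n \<in> word_mat A ` lists I" for n
  proof -
    obtain v w where "v \<in> lists I" "w \<in> lists I" "x n = word_mat A v" "y n = word_mat A w"
      using x(1)[of n] y(1)[of n] by auto
    then show ?thesis by (intro image_eqI[of _ _ "v @ w"]) (auto simp: word_mat_append)
  qed
  then show ?thesis unfolding closure_sequential
    by (intro exI[of _ "\<lambda>n. x n ** y n"] conjI allI tendsto_matrix_mult x(2) y(2))
qed

lemma matrix_inv_orthogonal:
  fixes Q :: "real^'n^'n"
  assumes "orthogonal_matrix Q"
  shows "matrix_inv Q = transpose Q"
proof -
  have t: "Q ** transpose Q = mat 1" "transpose Q ** Q = mat 1"
    using assms by (auto simp: orthogonal_matrix_def)
  then have "Q ** matrix_inv Q = mat 1 \<and> matrix_inv Q ** Q = mat 1"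
    unfolding matrix_inv_def by (rule someI[of _ "transpose Q", OF conjI])
  then show ?thesis using t by (metis matrix_mul_assoc matrix_mul_lid matrix_mul_rid)
qed

lemma norm_orthogonal_matrix_le:
  fixes Q :: "real^'n^'n"
  assumes "orthogonal_matrix Q"
  shows "norm Q \<le> real CARD('n)"
proof -
  have "norm Q \<le> (\<Sum>i\<in>UNIV. norm (Q $ i))"
    unfolding norm_vec_def[of Q] by (rule L2_set_le_sum) simp
  also have "\<dots> = (\<Sum>i\<in>(UNIV::'n set). 1)"
    using assms unfolding orthogonal_matrix_orthonormal_rows row_def by (intro sum.cong) auto
  finally show ?thesis by simp
qed

text \<open>In a compact group some power of an element returns close to the identity, so the inverse
  is a limit of positive powers.\<close>
lemma matrix_inv_in_closure_words:
  fixes A :: "'i \<Rightarrow> real^'n^'n"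
  assumes i: "i \<in> I" and o: "orthogonal_matrix (A i)"
  shows "matrix_inv (A i) \<in> closure (word_mat A ` lists I)"
proof -
  define P where "P n = word_mat A (replicate n i)" for n
  have P_add: "P (m + n) = P m ** P n" for m n
    by (simp add: P_def replicate_add word_mat_append)
  have P_orth: "orthogonal_matrix (P n)" for n
    by (induction n) (simp_all add: P_def orthogonal_matrix_id orthogonal_matrix_mul o)
  have "\<forall>x\<in>range P. norm x \<le> real CARD('n)"
    using norm_orthogonal_matrix_le[OF P_orth] by auto
  then have bP: "bounded (range P)" unfolding bounded_iff by blast
  from bounded_imp_convergent_subsequence[OF bP]
  obtain L r where r: "strict_mono (r :: nat \<Rightarrow> nat)" and lim: "(P \<circ> r) \<longlonglongrightarrow> L"
    by (elim exE conjE)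
  have lim1: "(\<lambda>n. P (r n)) \<longlonglongrightarrow> L" using lim by (simp add: o_def)
  have lim2: "(\<lambda>n. P (r (Suc n))) \<longlonglongrightarrow> L" using lim1 by (rule LIMSEQ_Suc)
  have "(\<lambda>n. transpose (P (r n)) ** P (r n)) \<longlonglongrightarrow> transpose L ** L"
    by (intro tendsto_matrix_mult tendsto_transpose lim1)
  then have "(\<lambda>n. mat 1) \<longlonglongrightarrow> transpose L ** L"
    using P_orth by (simp add: orthogonal_matrix_def)
  then have LL: "transpose L ** L = mat 1" by (simp add: LIMSEQ_const_iff)
  have "(\<lambda>n. transpose (A i) ** (transpose (P (r n)) ** P (r (Suc n)))) \<longlonglongrightarrow> transpose (A i) ** (transpose L ** L)"
    by (intro tendsto_matrix_mult tendsto_transpose lim1 lim2 tendsto_const)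
  \<comment> \<open>The exponent is a natural number because \<open>r\<close> is strictly
    increasing. \<open>P (r n)\<close> and \<open>P (r (Suc n))\<close> have the same limit, so
    their quotient tends to the identity, and the quotient with one factor less tends to the inverse
    of \<open>A i\<close>.\<close>
  moreover have "transpose (A i) ** (transpose (P (r n)) ** P (r (Suc n))) = P (r (Suc n) - r n - 1)" for n
  proof -
    have "r n < r (Suc n)" using r by (simp add: strict_mono_Suc_iff)
    then obtain m where m: "r (Suc n) = r n + (1 + m)" by (metis add.assoc less_imp_add_positive Suc_eq_plus1_left gr0_implies_Suc)
    have "P 1 = A i" by (simp add: P_def)
    then have e: "P (r (Suc n)) = P (r n) ** A i ** P m" unfolding m P_add by (simp add: matrix_mul_assoc)
    have o1: "transpose (P (r n)) ** P (r n) = mat 1" and o2: "transpose (A i) ** A i = mat 1"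
      using P_orth o by (simp_all add: orthogonal_matrix_def)
    have "transpose (A i) ** (transpose (P (r n)) ** P (r (Suc n)))
        = transpose (A i) ** ((transpose (P (r n)) ** P (r n)) ** (A i ** P m))"
      unfolding e matrix_mul_assoc ..
    also have "\<dots> = P m" unfolding o1 matrix_mul_lid by (simp only: matrix_mul_assoc o2 matrix_mul_lid)
    finally show ?thesis by (simp add: m)
  qed
  ultimately have "(\<lambda>n. P (r (Suc n) - r n - 1)) \<longlonglongrightarrow> transpose (A i)"
    by (simp add: LL)
  moreover have "P n \<in> word_mat A ` lists I" for n
    unfolding P_def using i by (intro imageI) auto
  ultimately show ?thesis
    unfolding closure_sequential matrix_inv_orthogonal[OF o]
    by (intro exI[of _ "\<lambda>n. P (r (Suc n) - r n - 1)"] conjI allI)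
qed

lemma word_mat_in_closure: "w \<in> lists I \<Longrightarrow> word_mat A w \<in> closure (word_mat A ` lists I)"
  by (intro subsetD[OF closure_subset] imageI)

lemma gen_group_subset_closure_words:
  fixes A :: "'i \<Rightarrow> real^'n^'n"
  assumes "\<And>i. i \<in> I \<Longrightarrow> orthogonal_matrix (A i)"
  shows "gen_group A I \<subseteq> closure (word_mat A ` lists I)"
proof
  fix M assume "M \<in> gen_group A I"
  then show "M \<in> closure (word_mat A ` lists I)"
  proof induction
    case one
    show ?case using word_mat_in_closure[of "[]" I A] by simp
  next
    case (mul M i)
    have "A i \<in> closure (word_mat A ` lists I)" using word_mat_in_closure[of "[i]" I A] mul by simp
    then show ?case using mul by (intro closure_words_mult)
  next
    case (mulinv M i)
    then show ?case by (intro closure_words_mult matrix_inv_in_closure_words assms)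
  qed
qed

lemma SO_subset_closure_words:
  fixes A :: "nat \<Rightarrow> real^'n^'n"
  assumes "\<forall>i\<in>{1..k}. A i \<in> SO" "SO \<subseteq> closure (gen_group A {1..k})"
  shows "SO \<subseteq> closure (word_mat A ` lists {1..k})"
proof -
  have "gen_group A {1..k} \<subseteq> closure (word_mat A ` lists {1..k})"
    by (rule gen_group_subset_closure_words) (use assms(1) in \<open>auto simp: SO_def\<close>)
  then have "closure (gen_group A {1..k}) \<subseteq> closure (word_mat A ` lists {1..k})"
    by (intro closure_minimal) auto
  with assms(2) show ?thesis by (rule order_trans)
qed

section \<open>Vectors of maximal stretch\<close>

lemma onorm_attained:
  fixes B :: "real^'n^'n"
  obtains v where "norm v = 1" "norm (B *v v) = onorm ((*v) B)"
proof -
  have "compact (sphere 0 1 :: (real^'n) set)" by simp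
  moreover have "sphere 0 1 \<noteq> ({} :: (real^'n) set)" by simp
  moreover have "continuous_on (sphere 0 1) (\<lambda>x. norm (B *v x))"
    by (intro continuous_intros linear_continuous_on) simp
  ultimately obtain v where v: "v \<in> sphere 0 1" "\<And>u. u \<in> sphere 0 1 \<Longrightarrow> norm (B *v u) \<le> norm (B *v v)"
    using continuous_attains_sup by metis
  have "onorm ((*v) B) \<le> norm (B *v v)"
  proof (rule onorm_bound)
    fix u :: "real^'n"
    show "norm (B *v u) \<le> norm (B *v v) * norm u"
    proof (cases "u = 0")
      case False
      have "norm (B *v (u /\<^sub>R norm u)) \<le> norm (B *v v)" using False by (intro v(2)) simp
      then have "norm (B *v u) / norm u \<le> norm (B *v v)"
        by (simp add: matrix_vector_mult_scaleR divide_inverse mult.commute)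
      then show ?thesis using False by (simp add: field_simps)
    qed simp
  qed simp
  moreover have "norm (B *v v) \<le> onorm ((*v) B) * norm v"
    by (rule onorm[OF matrix_vector_mul_bounded_linear])
  ultimately show ?thesis using v(1) by (intro that[of v]) auto
qed

text \<open>The eigenspace of \<open>transpose B ** B\<close> for the square of the largest singular
  value, described through norms so that no spectral theorem is involved.\<close>

definition top_space :: "real^'n^'n \<Rightarrow> (real^'n) set" where
  "top_space B = {u. norm (B *v u) = onorm ((*v) B) * norm u}"

lemma norm_mult_le_onorm: "norm (B *v u) \<le> onorm ((*v) B) * norm u" for B :: "real^'n^'n"
  by (rule onorm[OF matrix_vector_mul_bounded_linear])

text \<open>Closure under sums: by the parallelogram law for u, v and for their images, the
  inequalities between the squares of |B w| and s |w| at w = u + v and w = u - v add up to an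
  equality, so each of them is one.\<close>

lemma subspace_top_space: "subspace (top_space (B :: real^'n^'n))"
proof (rule subspaceI)
  show "0 \<in> top_space B" by (simp add: top_space_def)
  show "c *\<^sub>R u \<in> top_space B" if "u \<in> top_space B" for c u
    using that by (simp add: top_space_def matrix_vector_mult_scaleR)
  define s where "s = onorm ((*v) B)"
  have s0: "s \<ge> 0" unfolding s_def by (rule onorm_pos_le) simp
  fix u v assume uv: "u \<in> top_space B" "v \<in> top_space B"
  have le: "(norm (B *v w))\<^sup>2 \<le> s\<^sup>2 * (norm w)\<^sup>2" for w
    using norm_mult_le_onorm[of B w] unfolding s_def[symmetric] power_mult_distrib[symmetric]
    by (intro power_mono) auto
  have pl: "(norm (x + y))\<^sup>2 + (norm (x - y))\<^sup>2 = 2 * (norm x)\<^sup>2 + 2 * (norm y)\<^sup>2" for x y :: "real^'n"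
    by (simp add: power2_norm_eq_inner inner_add_left inner_add_right inner_diff_left inner_diff_right)
  have "(norm (B *v (u + v)))\<^sup>2 + (norm (B *v (u - v)))\<^sup>2 = 2 * (norm (B *v u))\<^sup>2 + 2 * (norm (B *v v))\<^sup>2"
    unfolding matrix_vector_right_distrib matrix_vector_mult_diff_distrib by (rule pl)
  also have "\<dots> = s\<^sup>2 * (2 * (norm u)\<^sup>2 + 2 * (norm v)\<^sup>2)"
    using uv by (simp add: top_space_def s_def[symmetric] power_mult_distrib algebra_simps)
  also have "\<dots> = s\<^sup>2 * (norm (u + v))\<^sup>2 + s\<^sup>2 * (norm (u - v))\<^sup>2"
    unfolding pl[symmetric] by (simp add: algebra_simps)
  finally have "(norm (B *v (u + v)))\<^sup>2 = (s * norm (u + v))\<^sup>2"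
    using le[of "u+v"] le[of "u-v"] by (simp add: power_mult_distrib)
  then show "u + v \<in> top_space B"
    using s0 by (simp add: top_space_def s_def[symmetric] power2_eq_iff_nonneg)
qed

lemma mult_nonzero:
  fixes B :: "real^'n^'n"
  assumes "det B \<noteq> 0" "x \<noteq> 0"
  shows "B *v x \<noteq> 0"
proof
  assume "B *v x = 0"
  moreover have "invertible B" using assms by (simp add: invertible_det_nz)
  ultimately have "x = 0"
    by (metis invertible_def matrix_vector_mul_assoc matrix_vector_mul_lid matrix_vector_mult_0_right)
  then show False using assms by simp
qed

lemma onorm_pos_of_det:
  fixes B :: "real^'n^'n"
  assumes "det B \<noteq> 0"
  shows "onorm ((*v) B) > 0"
proof -
  obtain v :: "real^'n" where v: "norm v = 1" "norm (B *v v) = onorm ((*v) B)" by (fact onorm_attained)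
  have "v \<noteq> 0" using v(1) by auto
  then have "B *v v \<noteq> 0" by (rule mult_nonzero[OF assms])
  then show ?thesis using v(2) by (metis zero_less_norm_iff)
qed

text \<open>If all vectors are stretched by the same s, then B is s times an orthogonal matrix, and
  determinant 1 forces s = 1. This is how the assumption that \<open>A 0\<close> is not a rotation
  enters.\<close>

lemma top_space_not_UNIV:
  fixes B :: "real^'n^'n"
  assumes det: "det B = 1" and "B \<notin> SO"
  shows "top_space B \<noteq> UNIV"
proof
  assume top: "top_space B = UNIV"
  define s where "s = onorm ((*v) B)"
  have s: "s > 0" unfolding s_def by (rule onorm_pos_of_det) (simp add: det)
  have n: "norm (B *v u) = s * norm u" for u
    using top by (auto simp: top_space_def s_def)
  define f where "f u = (1/s) *\<^sub>R (B *v u)" for u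
  have lin: "linear f" unfolding f_def
    by (rule linearI) (simp_all add: matrix_vector_right_distrib matrix_vector_mult_scaleR scaleR_add_right)
  have "orthogonal_transformation f"
    unfolding orthogonal_transformation using lin n s by (simp add: f_def)
  then have of: "orthogonal_matrix (matrix f)"
    by (simp add: orthogonal_transformation_matrix)
  have mf: "s *s matrix f $ i = B $ i" for i
    using s by (simp add: matrix_def f_def vec_eq_iff matrix_vector_mul_component axis_def inner_vec_def if_distrib cong: if_cong)
  have "det B = det (\<chi> i. s *s matrix f $ i)" by (simp only: mf vec_nth_inverse)
  also have "\<dots> = (\<Prod>i\<in>(UNIV::'n set). s) * det (matrix f)"
    using det_rows_mul[of "\<lambda>_. s" "\<lambda>i. matrix f $ i"] by simp
  finally have d: "s ^ CARD('n) * det (matrix f) = 1" using det by simp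
  have "s ^ CARD('n) > 0" using s by simp
  then have "s ^ CARD('n) = 1" using det_orthogonal_matrix[OF of] d by auto
  then have "s = 1" using s by (intro power_eq_imp_eq_base[of s "CARD('n)" 1]) auto
  then have "f = (*v) B" by (simp add: f_def fun_eq_iff)
  then have "orthogonal_matrix B" using of by simp
  then show False using assms by (simp add: SO_def)
qed

lemma norm_orthogonal_matrix_mult:
  fixes R :: "real^'n^'n"
  assumes "orthogonal_matrix R"
  shows "norm (R *v x) = norm x"
  using assms orthogonal_transformation_matrix[of "(*v) R"] by (simp add: orthogonal_transformation)

text \<open>The vector \<open>u0\<close> undergoes both maximal stretches in succession, so the
  operator norms a and b multiply. A vector u is then stretched maximally by the product exactly
  when both inequalities in |A R B u| \<le> a |B u| \<le> a b |u| are equalities.\<close>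

lemma top_space_triple:
  fixes A B R :: "real^'n^'n"
  assumes det: "det A \<noteq> 0" and R: "orthogonal_matrix R"
    and u0: "u0 \<noteq> 0" "u0 \<in> top_space B" "R *v (B *v u0) \<in> top_space A"
  shows "top_space (A ** R ** B) = {u \<in> top_space B. R *v (B *v u) \<in> top_space A}"
proof -
  define a b where "a = onorm ((*v) A)" and "b = onorm ((*v) B)"
  have a: "a > 0" unfolding a_def by (rule onorm_pos_of_det[OF det])
  note Rn = norm_orthogonal_matrix_mult[OF R]
  have mul: "(A ** R ** B) *v u = A *v (R *v (B *v u))" for u
    by (simp add: matrix_vector_mul_assoc matrix_mul_assoc)
  have le: "norm ((A ** R ** B) *v u) \<le> a * norm (B *v u)" for u
    unfolding mul using norm_mult_le_onorm[of A "R *v (B *v u)"] by (simp add: Rn a_def)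
  have le2: "a * norm (B *v u) \<le> a * (b * norm u)" for u
    using norm_mult_le_onorm[of B u] a by (simp add: b_def)
  have eq0: "norm ((A ** R ** B) *v u0) = a * b * norm u0"
    unfolding mul using u0 by (simp add: top_space_def Rn a_def b_def)
  have on: "onorm ((*v) (A ** R ** B)) = a * b"
  proof (rule antisym)
    have "0 \<le> b" unfolding b_def by (rule onorm_pos_le) simp
    then show "onorm ((*v) (A ** R ** B)) \<le> a * b"
      using a order_trans[OF le le2] by (intro onorm_bound) (auto simp: mult.assoc)
    have "a * b * norm u0 \<le> onorm ((*v) (A ** R ** B)) * norm u0"
      using norm_mult_le_onorm[of "A ** R ** B" u0] eq0 by simp
    then show "a * b \<le> onorm ((*v) (A ** R ** B))" using u0(1) by simp
  qed
  show ?thesis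
  proof (intro set_eqI iffI)
    fix u assume "u \<in> top_space (A ** R ** B)"
    then have e: "norm ((A ** R ** B) *v u) = a * (b * norm u)" by (simp add: top_space_def on)
    then have e2: "a * norm (B *v u) = a * (b * norm u)" using le[of u] le2[of u] by linarith
    then have "u \<in> top_space B" using a by (simp add: top_space_def b_def)
    moreover have "norm (A *v (R *v (B *v u))) = a * norm (R *v (B *v u))"
      using e e2 by (simp only: mul Rn)
    ultimately show "u \<in> {u \<in> top_space B. R *v (B *v u) \<in> top_space A}"
      by (simp add: top_space_def a_def)
  next
    fix u assume "u \<in> {u \<in> top_space B. R *v (B *v u) \<in> top_space A}"
    then show "u \<in> top_space (A ** R ** B)" unfolding top_space_def on
      by (simp add: mul Rn a_def b_def)
  qed
qed

section \<open>Rotations with prescribed action on an orthonormal pair\<close>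

definition householder :: "'a::real_inner \<Rightarrow> 'a \<Rightarrow> 'a" where
  "householder a x = x - (2 * (a \<bullet> x) / (a \<bullet> a)) *\<^sub>R a"

lemma orthogonal_transformation_householder:
  fixes a :: "'a::euclidean_space"
  assumes "a \<noteq> 0"
  shows "orthogonal_transformation (householder a)"
  unfolding orthogonal_transformation_def
proof (intro conjI allI)
  show "linear (householder a)"
    by (rule linearI) (simp_all add: householder_def inner_add_right algebra_simps add_divide_distrib)
  fix v w
  have "a \<bullet> a \<noteq> 0" using assms by simp
  then show "householder a v \<bullet> householder a w = v \<bullet> w"
    by (simp add: householder_def inner_diff_left inner_diff_right inner_commute field_simps)
qed

text \<open>An isometry carrying a to b conjugates one reflection into the other. Equality of the
  determinants is what puts the product of two such reflections in \<open>SO\<close>.\<close>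

lemma det_householder_eq:
  fixes a b :: "real^'n"
  assumes ab: "norm a = norm b" "a \<noteq> 0"
  shows "det (matrix (householder a)) = det (matrix (householder b))"
proof -
  have b0: "b \<noteq> 0" using ab by auto
  obtain f where f: "orthogonal_transformation f" "f a = b"
    using orthogonal_transformation_exists[OF ab(1)] by metis
  have lf: "linear f" using f(1) by (rule orthogonal_transformation_linear)
  have la: "linear (householder a)" "linear (householder b)"
    using orthogonal_transformation_householder ab(2) b0 orthogonal_transformation_linear by blast+
  have ip: "f x \<bullet> f y = x \<bullet> y" for x y using f(1) by (simp add: orthogonal_transformation_def)
  have "householder b \<circ> f = f \<circ> householder a"
  proof
    fix x
    have "b \<bullet> f x = a \<bullet> x" "b \<bullet> b = a \<bullet> a" using ip f(2) by metis+
    then show "(householder b \<circ> f) x = (f \<circ> householder a) x"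
      using f(2) by (simp add: householder_def linear_diff[OF lf] linear_scale[OF lf])
  qed
  then have "matrix (householder b) ** matrix f = matrix f ** matrix (householder a)"
    using matrix_compose[OF lf la(2)] matrix_compose[OF la(1) lf] by simp
  then have "det (matrix (householder b)) * det (matrix f) = det (matrix f) * det (matrix (householder a))"
    by (metis det_mul)
  moreover have "orthogonal_matrix (matrix f)" using f(1) orthogonal_transformation_matrix by blast
  then have "det (matrix f) \<noteq> 0" using det_orthogonal_matrix by fastforce
  ultimately show ?thesis by simp
qed

text \<open>The sign is forced by the plane, where the image of w1 determines the rotation. First w1
  is rotated to v; if w2 then lands at some y other than u, a reflection taking y to u is followed
  by one negating u. Both fix v.\<close>

lemma rotation_of_orthonormal_pair:
  fixes w1 w2 v u :: "real^'n"
  assumes card: "2 \<le> CARD('n)" and w: "norm w1 = 1" "norm w2 = 1" "w1 \<bullet> w2 = 0"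
    and v: "norm v = 1" "norm u = 1" "v \<bullet> u = 0"
  shows "\<exists>R\<in>SO. R *v w1 = v \<and> (R *v w2 = u \<or> R *v w2 = - u)"
proof -
  have "norm w1 = norm v" using w v by simp
  then obtain f where f: "orthogonal_transformation f" "det (matrix f) = 1" "f w1 = v"
    using rotation_exists[OF card] by metis
  have lf: "linear f" using f(1) by (rule orthogonal_transformation_linear)
  define R1 where "R1 = matrix f"
  have R1: "R1 \<in> SO" "\<And>x. R1 *v x = f x"
    using f lf orthogonal_transformation_matrix by (auto simp: SO_def R1_def matrix_works)
  define y where "y = f w2"
  have y: "norm y = 1" "v \<bullet> y = 0"
    using f w by (auto simp: y_def orthogonal_transformation orthogonal_transformation_def)
       (metis f(1,3) orthogonal_transformation_def w(3))
  show ?thesis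
  proof (cases "y = u")
    case True
    then show ?thesis using R1 f(3) y_def by (intro bexI[of _ R1]) auto
  next
    case False
    define a where "a = y - u"
    \<comment> \<open>A multiple of \<open>u\<close> gives the same reflection; the length of
      \<open>a\<close> is chosen because \<open>det_householder_eq\<close> compares vectors of equal
      norm.\<close>
    define b where "b = norm a *\<^sub>R u"
    have a0: "a \<noteq> 0" using False by (simp add: a_def)
    have nab: "norm a = norm b" using v by (simp add: b_def)
    have b0: "b \<noteq> 0" using nab a0 by auto
    have oa: "orthogonal_transformation (householder a)" "orthogonal_transformation (householder b)"
      using orthogonal_transformation_householder a0 b0 by blast+
    have la: "linear (householder a)" "linear (householder b)"
      using oa orthogonal_transformation_linear by blast+
    have om: "orthogonal_matrix (matrix (householder a))" "orthogonal_matrix (matrix (householder b))"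
      using oa orthogonal_transformation_matrix by blast+
    define R where "R = matrix (householder b) ** matrix (householder a) ** R1"
    have "det (matrix (householder b)) * det (matrix (householder a)) = 1"
      using det_householder_eq[OF nab a0] det_orthogonal_matrix[OF om(2)] by auto
    then have "R \<in> SO" using R1(1) om by (simp add: R_def SO_def det_mul orthogonal_matrix_mul)
    moreover have Rx: "R *v x = householder b (householder a (f x))" for x
      by (simp add: R_def matrix_vector_mul_assoc[symmetric] R1(2) matrix_works la)
    have "a \<bullet> v = 0" "b \<bullet> v = 0"
      using y v by (simp_all add: a_def b_def inner_diff_left inner_diff_right inner_commute)
    then have "R *v w1 = v" by (simp add: Rx f(3) householder_def)
    moreover have "householder a y = u"
    proof -
      have yy: "y \<bullet> y = 1" "u \<bullet> u = 1" using y v by (simp_all add: norm_eq_1)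
      then have "2 * (a \<bullet> y) = a \<bullet> a"
        by (simp add: a_def inner_diff_left inner_diff_right inner_commute)
      then show ?thesis using a0 by (simp add: householder_def) (simp add: a_def)
    qed
    then have "R *v w2 = householder b u" by (simp add: Rx y_def[symmetric])
    moreover have "householder b u = - u"
      using b0 v(2) by (simp add: householder_def b_def norm_eq_1 field_simps)
        (simp add: scaleR_2)
    ultimately show ?thesis by (intro bexI[of _ R]) auto
  qed
qed

text \<open>Take B in \<open>Cl\<close> of determinant 1 with \<open>top_space B\<close> of least
  dimension. If it contained two independent vectors, a rotation R could carry the image of one to a
  maximally stretched direction of A and the image of the other orthogonally to
  \<open>top_space A\<close>; then \<open>A ** R ** B\<close> would have a strictly smaller top
  space.\<close>

lemma exists_simple_top_space:
  fixes A :: "real^'n^'n" and Cl :: "(real^'n^'n) set"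
  assumes card: "2 \<le> CARD('n)" and det: "det A = 1" and A: "A \<notin> SO" and one: "mat 1 \<in> Cl"
    and mulA: "\<And>M. M \<in> Cl \<Longrightarrow> A ** M \<in> Cl" and mulR: "\<And>R M. R \<in> SO \<Longrightarrow> M \<in> Cl \<Longrightarrow> R ** M \<in> Cl"
  obtains B v where "B \<in> Cl" "det B = 1" "norm v = 1" "v \<in> top_space B"
    "\<And>u. u \<in> top_space B \<Longrightarrow> v \<bullet> u = 0 \<Longrightarrow> u = 0"
proof -
  define Q where "Q B \<longleftrightarrow> B \<in> Cl \<and> det B = 1" for B
  have "Q (mat 1)" using one by (simp add: Q_def)
  from ex_has_least_nat[of Q, OF this, of "\<lambda>B. dim (top_space B)"]
  obtain B where B: "Q B" and least: "\<And>C. Q C \<Longrightarrow> dim (top_space B) \<le> dim (top_space C)" by auto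
  have BCl: "B \<in> Cl" and dB: "det B = 1" using B by (auto simp: Q_def)
  obtain v :: "real^'n" where v: "norm v = 1" "norm (B *v v) = onorm ((*v) B)" by (fact onorm_attained)
  have vt: "v \<in> top_space B" using v by (simp add: top_space_def)
  have s: "onorm ((*v) B) > 0" by (rule onorm_pos_of_det) (simp add: dB)
  have simple: "u = 0" if u: "u \<in> top_space B" "v \<bullet> u = 0" for u
  proof (rule ccontr)
    assume u0: "u \<noteq> 0"
    \<comment> \<open>Gram-Schmidt on the images: \<open>u2\<close> stays in the subspace
      \<open>top_space B\<close>, is nonzero because \<open>u\<close> and \<open>v\<close> are
      orthogonal, and has an image orthogonal to \<open>B *v v\<close>, so that one rotation can
      prescribe where both go.\<close>
    define c where "c = ((B *v v) \<bullet> (B *v u)) / ((B *v v) \<bullet> (B *v v))"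
    define u2 where "u2 = u - c *\<^sub>R v"
    have Bv: "B *v v \<noteq> 0" using v(2) s by auto
    have u2t: "u2 \<in> top_space B" unfolding u2_def
      by (intro subspace_diff subspace_scale subspace_top_space u vt)
    have u2n: "u2 \<noteq> 0"
    proof
      assume "u2 = 0"
      then have "u = c *\<^sub>R v" by (simp add: u2_def)
      then have "c * (v \<bullet> v) = 0" using u(2) by simp
      then have "c = 0" using v(1) by auto
      then show False using u0 \<open>u = c *\<^sub>R v\<close> by simp
    qed
    have "norm (B *v u2) = onorm ((*v) B) * norm u2" using u2t by (simp add: top_space_def)
    then have Bu2: "B *v u2 \<noteq> 0" using s u2n by auto
    have "B *v u2 = B *v u - c *\<^sub>R (B *v v)"
      by (simp add: u2_def matrix_vector_mult_diff_distrib matrix_vector_mult_scaleR)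
    then have orth: "(B *v v) \<bullet> (B *v u2) = 0"
      using Bv by (simp add: inner_diff_right c_def)
    define w1 w2 where "w1 = (B *v v) /\<^sub>R norm (B *v v)" and "w2 = (B *v u2) /\<^sub>R norm (B *v u2)"
    have w: "norm w1 = 1" "norm w2 = 1" "w1 \<bullet> w2 = 0"
      using Bv Bu2 orth by (simp_all add: w1_def w2_def)
    obtain a :: "real^'n" where a: "norm a = 1" "norm (A *v a) = onorm ((*v) A)" by (fact onorm_attained)
    have at: "a \<in> top_space A" using a by (simp add: top_space_def)
    have nU: "top_space A \<noteq> UNIV" by (rule top_space_not_UNIV[OF det A])
    have dimA: "dim (top_space A) < DIM(real^'n)"
    proof -
      have "dim (top_space A) \<noteq> DIM(real^'n)"
      proof
        assume "dim (top_space A) = DIM(real^'n)"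
        then have "span (top_space A) = UNIV" using dim_eq_full[of "top_space A"] by blast
        then show False using nU span_eq_iff subspace_top_space by metis
      qed
      then show ?thesis using dim_subset_UNIV[of "top_space A"] by linarith
    qed
    obtain x :: "real^'n" where x: "x \<noteq> 0" "\<And>y. y \<in> span (top_space A) \<Longrightarrow> orthogonal x y"
      by (fact orthogonal_to_subspace_exists[OF dimA])
    define b where "b = x /\<^sub>R norm x"
    have b: "norm b = 1" using x by (simp add: b_def)
    have b_orth: "b \<bullet> y = 0" if "y \<in> top_space A" for y
      using x(2)[OF span_base[OF that]] by (simp add: orthogonal_def b_def)
    have ab: "a \<bullet> b = 0" using b_orth[OF at] by (simp add: inner_commute)
    obtain R where R: "R \<in> SO" "R *v w1 = a" "R *v w2 = b \<or> R *v w2 = - b"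
      using rotation_of_orthonormal_pair[OF card w a(1) b ab] by auto
    define C where "C = A ** R ** B"
    have CQ: "Q C" unfolding Q_def C_def
      using mulA[OF mulR[OF R(1) BCl]] R(1) det dB by (simp add: matrix_mul_assoc det_mul SO_def)
    have Rv: "R *v (B *v v) \<in> top_space A"
    proof -
      have "B *v v = norm (B *v v) *\<^sub>R w1" using Bv by (simp add: w1_def)
      then have "R *v (B *v v) = norm (B *v v) *\<^sub>R a" using R(2) by (metis matrix_vector_mult_scaleR)
      then show ?thesis using subspace_scale[OF subspace_top_space at] by metis
    qed
    have tC: "top_space C = {u \<in> top_space B. R *v (B *v u) \<in> top_space A}"
      unfolding C_def
      by (rule top_space_triple[OF _ _ _ vt Rv]) (use det R(1) v in \<open>auto simp: SO_def\<close>)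
    have "u2 \<notin> top_space C"
    proof
      assume "u2 \<in> top_space C"
      then have m: "R *v (B *v u2) \<in> top_space A" using tC by auto
      have "B *v u2 = norm (B *v u2) *\<^sub>R w2" using Bu2 by (simp add: w2_def)
      then have e: "R *v (B *v u2) = norm (B *v u2) *\<^sub>R (R *v w2)" by (metis matrix_vector_mult_scaleR)
      have "norm (B *v u2) * (b \<bullet> (R *v w2)) = 0" using b_orth[OF m] by (simp add: e)
      then have "b \<bullet> b = 0" using R(3) Bu2 by auto
      then show False using b by (simp add: norm_eq_1)
    qed
    moreover have sub: "top_space C \<subseteq> top_space B" using tC by auto
    ultimately have "dim (top_space C) < dim (top_space B)"
      using subspace_dim_equal[OF subspace_top_space subspace_top_space sub] u2t
      by (cases "dim (top_space B) \<le> dim (top_space C)") auto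
    then show False using least[OF CQ] by simp
  qed
  show ?thesis by (rule that[OF BCl dB v(1) vt simple])
qed

section \<open>The derivative of the projective action\<close>

definition proj_deriv_fun :: "real^'n^'n \<Rightarrow> real^'n \<Rightarrow> real^'n \<Rightarrow> real^'n" where
  "proj_deriv_fun B x u = (B *v u - (((B *v x) \<bullet> (B *v u)) / (norm (B *v x))\<^sup>2) *\<^sub>R (B *v x)) /\<^sub>R norm (B *v x)"

lemma bounded_linear_proj_deriv_fun: "bounded_linear (proj_deriv_fun B x)"
  unfolding linear_conv_bounded_linear[symmetric]
  by (rule linearI) (simp_all add: proj_deriv_fun_def matrix_vector_right_distrib
      matrix_vector_mult_scaleR inner_add_right add_divide_distrib algebra_simps)

definition proj_deriv :: "real^'n^'n \<Rightarrow> real^'n \<Rightarrow> ((real^'n) \<Rightarrow>\<^sub>L (real^'n))" where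
  "proj_deriv B x = Blinfun (proj_deriv_fun B x)"

lemma proj_deriv_apply: "blinfun_apply (proj_deriv B x) = proj_deriv_fun B x"
  unfolding proj_deriv_def by (rule bounded_linear_Blinfun_apply[OF bounded_linear_proj_deriv_fun])

lemma normalize_scale:
  fixes y :: "'a::real_normed_vector"
  assumes "c > 0"
  shows "(c *\<^sub>R y) /\<^sub>R norm (c *\<^sub>R y) = y /\<^sub>R norm y"
  using assms by simp

lemma proj_action_scale:
  assumes "c > 0"
  shows "proj_action B (c *\<^sub>R x) = proj_action B x"
  unfolding proj_action_def matrix_vector_mult_scaleR by (rule normalize_scale[OF assms])

lemma radext_proj_action: "radext (proj_action B) = proj_action B"
proof
  fix x :: "real^'a"
  show "radext (proj_action B) x = proj_action B x"
    using proj_action_scale[of "inverse (norm x)" B x] by (cases "x = 0") (simp_all add: radext_def)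
qed

lemma normalize_has_derivative:
  fixes y :: "'a::real_inner"
  assumes "y \<noteq> 0"
  shows "((\<lambda>y. y /\<^sub>R norm y) has_derivative (\<lambda>u. (u - ((y \<bullet> u) / (norm y)\<^sup>2) *\<^sub>R y) /\<^sub>R norm y)) (at y)"
proof -
  have "((\<lambda>y. inverse (norm y)) has_derivative (\<lambda>u. - (inverse (norm y) * (u \<bullet> sgn y) * inverse (norm y)))) (at y)"
    by (rule Deriv.has_derivative_inverse[OF _ has_derivative_norm]) (use assms in auto)
  from has_derivative_scaleR[OF this has_derivative_ident]
  have "((\<lambda>y. y /\<^sub>R norm y) has_derivative
     (\<lambda>u. inverse (norm y) *\<^sub>R u + (- (inverse (norm y) * (u \<bullet> sgn y) * inverse (norm y))) *\<^sub>R y)) (at y)" .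
  moreover have "(\<lambda>u. inverse (norm y) *\<^sub>R u + (- (inverse (norm y) * (u \<bullet> sgn y) * inverse (norm y))) *\<^sub>R y)
     = (\<lambda>u. (u - ((y \<bullet> u) / (norm y)\<^sup>2) *\<^sub>R y) /\<^sub>R norm y)"
    using assms by (simp add: fun_eq_iff sgn_div_norm inner_commute power2_eq_square scaleR_diff_right divide_inverse mult_ac)
  ultimately show ?thesis by simp
qed

lemma proj_action_has_derivative:
  fixes B :: "real^'n^'n"
  assumes "B *v x \<noteq> 0"
  shows "(proj_action B has_derivative proj_deriv_fun B x) (at x)"
proof -
  have "((*v) B has_derivative (*v) B) (at x)"
    by (rule bounded_linear_imp_has_derivative) simp
  from has_derivative_compose[OF this normalize_has_derivative[OF assms]]
  show ?thesis by (simp add: proj_action_def[abs_def] proj_deriv_fun_def[abs_def])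
qed

lemma sph_deriv_proj_action:
  fixes B :: "real^'n^'n"
  assumes "det B \<noteq> 0"
  shows "sph_deriv (proj_action B) (proj_deriv B)"
  unfolding sph_deriv_def
proof (intro conjI allI impI)
  show "continuous_on (- {0}) (proj_deriv B)"
  proof (rule continuous_on_blinfun_componentwise)
    fix u :: "real^'n"
    have c: "continuous_on (- {0}) (\<lambda>x. B *v x)" by (rule linear_continuous_on) simp
    show "continuous_on (- {0}) (\<lambda>x. proj_deriv B x u)"
      unfolding proj_deriv_apply proj_deriv_fun_def
      by (intro continuous_intros c) (use mult_nonzero[OF assms] in auto)
  qed
  fix x :: "real^'n" assume "x \<noteq> 0"
  then show "(radext (proj_action B) has_derivative proj_deriv B x) (at x)"
    unfolding radext_proj_action proj_deriv_apply
    by (intro proj_action_has_derivative mult_nonzero[OF assms])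
qed

lemma proj_action_in_sph:
  assumes "det B \<noteq> 0" "x \<in> sph"
  shows "proj_action B x \<in> sph"
proof -
  have "x \<noteq> 0" using assms(2) by (auto simp: sph_iff)
  then show ?thesis unfolding proj_action_def by (intro normalize_in_sph mult_nonzero assms)
qed

lemma proj_action_mult:
  fixes A B :: "real^'n^'n"
  assumes "B *v x \<noteq> 0"
  shows "proj_action (A ** B) x = proj_action A (proj_action B x)"
proof -
  have "proj_action A (proj_action B x) = proj_action A (B *v x)"
    unfolding proj_action_def[of B] using assms by (intro proj_action_scale) simp
  then show ?thesis by (simp add: proj_action_def matrix_vector_mul_assoc)
qed

text \<open>The derivative at v annihilates v. On a nonzero w orthogonal to v it is B w without its
  component along B v, divided by |B v| = s, the largest stretch; as w is not in
  \<open>top_space B\<close>, |B w| < s |w|. Compactness of the unit sphere turns this pointwise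
  strictness into a bound on the operator norm.\<close>

lemma norm_proj_deriv_less_1:
  fixes B :: "real^'n^'n"
  assumes det: "det B \<noteq> 0" and v: "norm v = 1" "v \<in> top_space B"
    and simple: "\<And>u. u \<in> top_space B \<Longrightarrow> v \<bullet> u = 0 \<Longrightarrow> u = 0"
  shows "norm (proj_deriv B v) < 1"
proof -
  define s where "s = onorm ((*v) B)"
  have s: "s > 0" unfolding s_def by (rule onorm_pos_of_det[OF det])
  have Bv: "norm (B *v v) = s" using v by (simp add: top_space_def s_def)
  have less: "norm (proj_deriv B v u) < 1" if u: "norm u = 1" for u
  proof -
    define w where "w = u - (v \<bullet> u) *\<^sub>R v"
    have vv: "v \<bullet> v = 1" using v(1) by (simp add: norm_eq_1)
    have vw: "v \<bullet> w = 0" by (simp add: w_def inner_diff_right vv)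
    have nw: "norm w \<le> 1"
    proof -
      have "w \<bullet> w = u \<bullet> u - (v \<bullet> u) * (v \<bullet> u)"
        by (simp add: w_def inner_diff_left inner_diff_right vv inner_commute)
      then have "w \<bullet> w \<le> 1" using u by (simp add: norm_eq_1)
      then show ?thesis by (simp add: norm_eq_sqrt_inner)
    qed
    have Dv: "proj_deriv B v v = 0"
      using Bv s by (simp add: proj_deriv_apply proj_deriv_fun_def power2_norm_eq_inner[symmetric])
    have "u = (v \<bullet> u) *\<^sub>R v + w" by (simp add: w_def)
    then have "proj_deriv B v u = proj_deriv B v ((v \<bullet> u) *\<^sub>R v + w)" by simp
    then have Du: "proj_deriv B v u = proj_deriv B v w"
      by (simp add: blinfun.add_right blinfun.scaleR_right Dv)
    have proj: "norm (y - ((a \<bullet> y) / (norm a)\<^sup>2) *\<^sub>R a) \<le> norm y" for a y :: "real^'n"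
    proof -
      define c where "c = (a \<bullet> y) / (norm a)\<^sup>2"
      have ca: "c * (a \<bullet> a) = a \<bullet> y" by (cases "a = 0") (simp_all add: c_def power2_norm_eq_inner)
      have "(y - c *\<^sub>R a) \<bullet> (y - c *\<^sub>R a) = y \<bullet> y - 2 * (c * (a \<bullet> y)) + c * (c * (a \<bullet> a))"
        by (simp add: inner_diff_left inner_diff_right inner_commute algebra_simps)
      also have "\<dots> = y \<bullet> y - c * (a \<bullet> y)" unfolding ca by simp
      also have "\<dots> \<le> y \<bullet> y" by (simp add: c_def)
      finally have "(norm (y - c *\<^sub>R a))\<^sup>2 \<le> (norm y)\<^sup>2" by (simp only: power2_norm_eq_inner)
      then show ?thesis unfolding c_def by (rule power2_le_imp_le) simp
    qed
    have "norm (proj_deriv B v w) = norm (B *v w - (((B *v v) \<bullet> (B *v w)) / (norm (B *v v))\<^sup>2) *\<^sub>R (B *v v)) / s"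
      using s by (simp add: proj_deriv_apply proj_deriv_fun_def Bv divide_inverse mult.commute)
    also have "\<dots> \<le> norm (B *v w) / s" using proj s by (intro divide_right_mono) auto
    finally have le: "norm (proj_deriv B v w) \<le> norm (B *v w) / s" .
    show ?thesis
    proof (cases "w = 0")
      case True
      then show ?thesis by (simp add: Du blinfun.zero_right)
    next
      case False
      then have "w \<notin> top_space B" using simple vw by blast
      then have "norm (B *v w) < s * norm w"
        using norm_mult_le_onorm[of B w] by (simp add: top_space_def s_def)
      then have "norm (B *v w) / s < norm w" using s by (simp add: field_simps)
      then show ?thesis using le nw Du by simp
    qed
  qed
  have "continuous_on (sphere 0 1) (\<lambda>u. norm (proj_deriv B v u))"
    by (intro continuous_intros)
  moreover have "compact (sphere 0 1 :: (real^'n) set)" "sphere 0 1 \<noteq> ({} :: (real^'n) set)" by simp_all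
  ultimately obtain u where u: "u \<in> sphere 0 1"
    "\<And>z. z \<in> sphere 0 1 \<Longrightarrow> norm (proj_deriv B v z) \<le> norm (proj_deriv B v u)"
    using continuous_attains_sup by metis
  have "norm (proj_deriv B v) \<le> norm (proj_deriv B v u)"
  proof (rule norm_blinfun_bound)
    fix z :: "real^'n"
    show "norm (proj_deriv B v z) \<le> norm (proj_deriv B v u) * norm z"
    proof (cases "z = 0")
      case False
      have "norm (proj_deriv B v (z /\<^sub>R norm z)) \<le> norm (proj_deriv B v u)"
        using False by (intro u(2)) simp
      then have "norm (proj_deriv B v z) / norm z \<le> norm (proj_deriv B v u)"
        by (simp add: blinfun.scaleR_right divide_inverse mult.commute)
      then show ?thesis using False by (simp add: field_simps)
    qed (simp add: blinfun.zero_right)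
  qed simp
  also have "\<dots> < 1" using less u(1) by simp
  finally show ?thesis .
qed

lemma tendsto_matrix_vector_mult:
  fixes f :: "'a \<Rightarrow> real^'n^'n"
  assumes "(f \<longlongrightarrow> a) F"
  shows "((\<lambda>x. f x *v u) \<longlongrightarrow> a *v u) F"
  unfolding matrix_vector_mult_def
  by (rule vec_tendstoI, unfold vec_lambda_beta) (intro tendsto_sum tendsto_mult tendsto_vec_nth assms tendsto_const)

lemma tendsto_proj_deriv:
  fixes f :: "'a \<Rightarrow> real^'n^'n"
  assumes f: "(f \<longlongrightarrow> B) F" and B: "B *v v \<noteq> 0"
  shows "((\<lambda>x. proj_deriv (f x) v) \<longlongrightarrow> proj_deriv B v) F"
proof (rule tendsto_componentwise1)
  fix u :: "real^'n"
  show "((\<lambda>x. proj_deriv (f x) v u) \<longlongrightarrow> proj_deriv B v u) F"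
    unfolding proj_deriv_apply proj_deriv_fun_def
    by (intro tendsto_intros tendsto_matrix_vector_mult f) (use B in auto)
qed

lemma det_word_mat:
  assumes "\<And>i. i \<in> I \<Longrightarrow> det (A i) = 1" "w \<in> lists I"
  shows "det (word_mat A w) = 1"
  using assms(2) by (induction w) (simp_all add: det_mul assms(1))

text \<open>The matrix with a simple top direction is only a limit of words, but a strict bound on
  the derivative at the fixed point v is an open condition on the matrix, so some genuine word
  satisfies it.\<close>

lemma exists_contracting_word:
  fixes A :: "nat \<Rightarrow> real^'n^'n"
  assumes card: "CARD('n) \<ge> 2" and SO: "\<forall>i\<in>{1..k}. A i \<in> SO"
    and dense: "SO \<subseteq> closure (gen_group A {1..k})"
    and A0: "det (A 0) = 1" "A 0 \<notin> SO"
  obtains b v where "b \<in> lists {..k}" "v \<in> sph" "norm (proj_deriv (word_mat A b) v) < 1"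
proof -
  define Cl where "Cl = closure (word_mat A ` lists {..k})"
  have mul: "X ** Y \<in> Cl" if "X \<in> Cl" "Y \<in> Cl" for X Y
    using that unfolding Cl_def by (rule closure_words_mult)
  have one: "mat 1 \<in> Cl" using word_mat_in_closure[of "[]" "{..k}" A] by (simp add: Cl_def)
  have A0Cl: "A 0 \<in> Cl" using word_mat_in_closure[of "[0]" "{..k}" A] by (simp add: Cl_def)
  have "closure (word_mat A ` lists {1..k}) \<subseteq> Cl" unfolding Cl_def by (intro closure_mono image_mono lists_mono) auto
  then have SOCl: "SO \<subseteq> Cl" using SO_subset_closure_words[OF SO dense] by (rule order_trans[rotated])
  have "\<exists>B v. B \<in> Cl \<and> det B = 1 \<and> norm v = 1 \<and> v \<in> top_space B \<and>
      (\<forall>u\<in>top_space B. v \<bullet> u = 0 \<longrightarrow> u = 0)"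
  proof (rule exists_simple_top_space[OF card A0 one])
    show "A 0 ** M \<in> Cl" if "M \<in> Cl" for M by (rule mul[OF A0Cl that])
    show "R ** M \<in> Cl" if "R \<in> SO" "M \<in> Cl" for R M using SOCl that by (intro mul) auto
  qed blast
  then obtain B v where B: "B \<in> Cl" "det B = 1" and v: "norm v = 1" "v \<in> top_space B"
    "\<And>u. u \<in> top_space B \<Longrightarrow> v \<bullet> u = 0 \<Longrightarrow> u = 0"
    by auto
  have less: "norm (proj_deriv B v) < 1" by (rule norm_proj_deriv_less_1[OF _ v]) (simp add: B)
  obtain x where x: "\<And>n::nat. x n \<in> word_mat A ` lists {..k}" "x \<longlonglongrightarrow> B"
    using B(1) unfolding Cl_def closure_sequential by auto
  have "v \<noteq> 0" using v(1) by auto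
  then have "B *v v \<noteq> 0" by (intro mult_nonzero) (simp_all add: B)
  then have "(\<lambda>n. norm (proj_deriv (x n) v)) \<longlonglongrightarrow> norm (proj_deriv B v)"
    by (intro tendsto_norm tendsto_proj_deriv x(2))
  then have "\<forall>\<^sub>F n in sequentially. norm (proj_deriv (x n) v) < 1"
    by (rule order_tendstoD) (rule less)
  then obtain n where n: "norm (proj_deriv (x n) v) < 1" by (auto simp: eventually_sequentially)
  obtain b where "b \<in> lists {..k}" "x n = word_mat A b" using x(1)[of n] by auto
  then show ?thesis using n v(1) by (intro that[of b v]) (simp_all add: sph_iff)
qed

section \<open>Stability under small perturbations\<close>

primrec word_map :: "('i \<Rightarrow> 'a \<Rightarrow> 'a) \<Rightarrow> 'i list \<Rightarrow> 'a \<Rightarrow> 'a" where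
  "word_map g [] = id"
| "word_map g (i # w) = g i \<circ> word_map g w"

lemma word_map_append: "word_map g (v @ w) = word_map g v \<circ> word_map g w"
  by (induction v) (simp_all add: o_assoc)

lemma bij_betw_word_map:
  assumes "\<And>i. i \<in> I \<Longrightarrow> bij_betw (g i) S S" "w \<in> lists I"
  shows "bij_betw (word_map g w) S S"
  using assms(2)
proof (induction w)
  case Nil
  show ?case by (simp add: bij_betw_def)
next
  case (Cons i w)
  have "bij_betw (g i \<circ> word_map g w) S S"
    by (rule bij_betw_trans[OF Cons.IH assms(1)]) (rule Cons.hyps)
  then show ?case by (simp only: word_map.simps)
qed

lemma sph_deriv_unique:
  assumes "sph_deriv f D" "sph_deriv f D'" "x \<noteq> 0"
  shows "D x = D' x"
proof (rule blinfun_eqI)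
  fix u
  have "(radext f has_derivative blinfun_apply (D x)) (at x)" "(radext f has_derivative blinfun_apply (D' x)) (at x)"
    using assms by (simp_all add: sph_deriv_def)
  then have "blinfun_apply (D x) = blinfun_apply (D' x)" by (rule has_derivative_unique)
  then show "D x u = D' x u" by simp
qed

text \<open>Radial extension commutes with composition away from the origin, because
  \<open>radext g2\<close> takes values in the sphere, where \<open>radext g1\<close> and
  \<open>g1\<close> agree.\<close>

lemma sph_deriv_compose:
  fixes g1 g2 :: "real^'n \<Rightarrow> real^'n"
  assumes g1: "sph_deriv g1 G1" and g2: "sph_deriv g2 G2" "g2 ` sph \<subseteq> sph"
  shows "sph_deriv (g1 \<circ> g2) (\<lambda>x. G1 (radext g2 x) o\<^sub>L G2 x)"
proof -
  have r2: "radext g2 x \<in> sph" if "x \<noteq> 0" for x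
    unfolding radext_def by (rule subsetD[OF g2(2)], rule imageI, rule normalize_in_sph[OF that])
  have r2': "radext g2 x \<noteq> 0" if "x \<noteq> 0" for x
  proof
    assume "radext g2 x = 0"
    then show False using r2[OF that] by (simp add: sph_iff)
  qed
  have eq: "radext (g1 \<circ> g2) x = radext g1 (radext g2 x)" if "x \<noteq> 0" for x
  proof -
    have "radext g1 (radext g2 x) = g1 (radext g2 x)" by (rule radext_sph[OF r2[OF that]])
    also have "\<dots> = radext (g1 \<circ> g2) x" by (simp only: radext_def comp_apply)
    finally show ?thesis by (rule sym)
  qed
  have d2: "(radext g2 has_derivative blinfun_apply (G2 x)) (at x)" if "x \<noteq> 0" for x
    using g2(1) that by (simp add: sph_deriv_def)
  have c2: "continuous_on (- {0}) (radext g2)"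
  proof (intro continuous_at_imp_continuous_on ballI)
    fix x :: "real^'n" assume "x \<in> - {0}"
    then show "continuous (at x) (radext g2)" by (intro has_derivative_continuous[OF d2]) simp
  qed
  have cG: "continuous_on (- {0}) G1" "continuous_on (- {0}) G2"
    using g1 g2(1) by (simp_all add: sph_deriv_def)
  have "continuous_on (- {0}) (\<lambda>x. G1 (radext g2 x) o\<^sub>L G2 x)"
  proof -
    have "continuous_on (- {0}) (\<lambda>x. G1 (radext g2 x))"
    proof (rule continuous_on_compose2[OF cG(1) c2], rule image_subsetI)
      fix x :: "real^'n" assume "x \<in> - {0}"
      then show "radext g2 x \<in> - {0}" using r2'[of x] by simp
    qed
    then show ?thesis
      using bounded_bilinear.continuous_on[OF bounded_bilinear_blinfun_compose _ cG(2)] by simp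
  qed
  moreover have "(radext (g1 \<circ> g2) has_derivative blinfun_apply (G1 (radext g2 x) o\<^sub>L G2 x)) (at x)"
    if x: "x \<noteq> 0" for x
  proof -
    have "(radext g1 has_derivative blinfun_apply (G1 (radext g2 x))) (at (radext g2 x))"
      using g1 r2'[OF x] by (simp add: sph_deriv_def)
    from has_derivative_compose[OF d2[OF x] this]
    have "((\<lambda>y. radext g1 (radext g2 y)) has_derivative (\<lambda>u. G1 (radext g2 x) (G2 x u))) (at x)" .
    then have "(radext (g1 \<circ> g2) has_derivative (\<lambda>u. G1 (radext g2 x) (G2 x u))) (at x)"
    proof (rule has_derivative_transform_within_open)
      show "open (- {0 :: real^'n})" by (simp add: open_Compl)
      show "x \<in> - {0}" using x by simp
      show "radext g1 (radext g2 y) = radext (g1 \<circ> g2) y" if "y \<in> - {0}" for y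
        by (rule eq[symmetric]) (use that in simp)
    qed
    moreover have "(\<lambda>u. G1 (radext g2 x) (G2 x u)) = blinfun_apply (G1 (radext g2 x) o\<^sub>L G2 x)"
      by (rule ext) simp
    ultimately show ?thesis by (simp only:)
  qed
  ultimately show ?thesis unfolding sph_deriv_def by blast
qed

lemma sph_deriv_continuous_on:
  fixes f :: "real^'n \<Rightarrow> real^'n"
  assumes "sph_deriv f D"
  shows "continuous_on sph f" "continuous_on sph D"
proof -
  have s: "sph \<subseteq> - {0}" by (auto simp: sph_iff)
  have "continuous_on sph (radext f)"
  proof (intro continuous_at_imp_continuous_on ballI)
    fix x :: "real^'n" assume "x \<in> sph"
    then have "x \<noteq> 0" by (auto simp: sph_iff)
    then have "(radext f has_derivative blinfun_apply (D x)) (at x)"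
      using assms by (simp add: sph_deriv_def)
    then show "continuous (at x) (radext f)" by (rule has_derivative_continuous)
  qed
  then show "continuous_on sph f"
    by (rule continuous_on_eq) (simp add: radext_sph)
  show "continuous_on sph D"
    by (rule continuous_on_subset[OF _ s]) (use assms in \<open>simp add: sph_deriv_def\<close>)
qed

lemma C1_close_mono: "C1_close \<epsilon> g f \<Longrightarrow> \<epsilon> \<le> \<epsilon>' \<Longrightarrow> C1_close \<epsilon>' g f"
  unfolding C1_close_def by (meson order_less_le_trans)

text \<open>\<open>C1_close\<close> asserts closeness of some pair of derivatives; their uniqueness
  off the origin lets the derivative of f be prescribed.\<close>

lemma C1_closeD:
  assumes "C1_close \<epsilon> g f" "sph_deriv f F"
  obtains G where "sph_deriv g G" "\<And>x. x \<in> sph \<Longrightarrow> norm (g x - f x) < \<epsilon>"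
    "\<And>x. x \<in> sph \<Longrightarrow> norm (G x - F x) < \<epsilon>"
proof -
  obtain G F' where G: "sph_deriv g G" "sph_deriv f F'"
    and c: "\<forall>x\<in>sph. norm (g x - f x) < \<epsilon> \<and> norm (G x - F' x) < \<epsilon>"
    using assms(1) unfolding C1_close_def by blast
  have "F' x = F x" if "x \<in> sph" for x
    by (rule sph_deriv_unique[OF G(2) assms(2)]) (use that in \<open>auto simp: sph_iff\<close>)
  then show ?thesis using G(1) c by (intro that[of G]) auto
qed

text \<open>The outer maps are evaluated at the two different points g2 x and f2 x; uniform
  continuity of f1 and F1 on the compact sphere absorbs the discrepancy.\<close>

lemma C1_close_compose:
  fixes f1 f2 :: "real^'n \<Rightarrow> real^'n"
  assumes F1: "sph_deriv f1 F1" and F2: "sph_deriv f2 F2" "f2 ` sph \<subseteq> sph" and \<tau>: "\<tau> > 0"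
  shows "\<exists>\<epsilon>>0. \<forall>g1 g2. C1_close \<epsilon> g1 f1 \<longrightarrow> C1_close \<epsilon> g2 f2 \<longrightarrow> g2 ` sph \<subseteq> sph
    \<longrightarrow> C1_close \<tau> (g1 \<circ> g2) (f1 \<circ> f2)"
proof -
  obtain B1 where B1: "B1 > 0" "\<And>x. x \<in> sph \<Longrightarrow> norm (F1 x) \<le> B1" by (fact sph_deriv_bounded[OF F1])
  obtain B2 where B2: "B2 > 0" "\<And>x. x \<in> sph \<Longrightarrow> norm (F2 x) \<le> B2" by (fact sph_deriv_bounded[OF F2(1)])
  \<comment> \<open>Since \<epsilon> \<le> 1, the perturbed inner derivative has norm at most B2 +
    1, so \<mu> makes two of the three terms of the telescoped difference at most \<tau>/4. The
    bound \<tau> / (4 * B1) on \<epsilon> does the same for the third, leaving 3 * \<tau> /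
    4.\<close>
  define \<mu> where "\<mu> = \<tau> / (4 * (B2 + 1))"
  have \<mu>: "\<mu> > 0" using \<tau> B2 by (simp add: \<mu>_def)
  have "uniformly_continuous_on sph f1" "uniformly_continuous_on sph F1"
    using sph_deriv_continuous_on[OF F1] by (auto intro: compact_uniformly_continuous compact_sph)
  then obtain \<eta>1 \<eta>2 where \<eta>1: "\<eta>1 > 0" "\<And>x y. x \<in> sph \<Longrightarrow> y \<in> sph \<Longrightarrow> dist x y < \<eta>1 \<Longrightarrow> dist (f1 x) (f1 y) < \<tau>/2"
    and \<eta>2: "\<eta>2 > 0" "\<And>x y. x \<in> sph \<Longrightarrow> y \<in> sph \<Longrightarrow> dist x y < \<eta>2 \<Longrightarrow> dist (F1 x) (F1 y) < \<mu>"
    unfolding uniformly_continuous_on_def using \<tau> \<mu> by (metis half_gt_zero)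
  define \<epsilon> where "\<epsilon> = Min {1, \<eta>1, \<eta>2, \<tau>/2, \<mu>, \<tau> / (4 * B1)}"
  have \<epsilon>: "\<epsilon> > 0" using \<eta>1 \<eta>2 \<tau> \<mu> B1 by (simp add: \<epsilon>_def)
  have \<epsilon>le: "\<epsilon> \<le> 1" "\<epsilon> \<le> \<eta>1" "\<epsilon> \<le> \<eta>2" "\<epsilon> \<le> \<tau>/2" "\<epsilon> \<le> \<mu>" "\<epsilon> \<le> \<tau> / (4 * B1)"
    unfolding \<epsilon>_def by (intro Min_le; simp)+
  have "C1_close \<tau> (g1 \<circ> g2) (f1 \<circ> f2)"
    if g1: "C1_close \<epsilon> g1 f1" and g2: "C1_close \<epsilon> g2 f2" "g2 ` sph \<subseteq> sph" for g1 g2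
  proof -
    obtain G1 where G1: "sph_deriv g1 G1" "\<And>x. x \<in> sph \<Longrightarrow> norm (g1 x - f1 x) < \<epsilon>"
      "\<And>x. x \<in> sph \<Longrightarrow> norm (G1 x - F1 x) < \<epsilon>" by (fact C1_closeD[OF g1 F1])
    obtain G2 where G2: "sph_deriv g2 G2" "\<And>x. x \<in> sph \<Longrightarrow> norm (g2 x - f2 x) < \<epsilon>"
      "\<And>x. x \<in> sph \<Longrightarrow> norm (G2 x - F2 x) < \<epsilon>" by (fact C1_closeD[OF g2(1) F2(1)])
    have "norm ((g1 \<circ> g2) x - (f1 \<circ> f2) x) < \<tau> \<and>
       norm ((G1 (radext g2 x) o\<^sub>L G2 x) - (F1 (radext f2 x) o\<^sub>L F2 x)) < \<tau>" if x: "x \<in> sph" for x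
    proof
      define y z where "y = g2 x" and "z = f2 x"
      have yz: "y \<in> sph" "z \<in> sph" using g2(2) F2(2) x by (auto simp: y_def z_def)
      have dyz: "dist y z < \<epsilon>" using G2(2)[OF x] by (simp add: y_def z_def dist_norm)
      have "norm (g1 y - f1 z) \<le> norm (g1 y - f1 y) + dist (f1 y) (f1 z)"
        unfolding dist_norm by (rule norm_diff_triangle_le) auto
      also have "\<dots> < \<epsilon> + \<tau>/2"
        using G1(2)[OF yz(1)] \<eta>1(2)[OF yz] dyz \<epsilon>le by (intro add_strict_mono) auto
      also have "\<dots> \<le> \<tau>" using \<epsilon>le by simp
      finally show "norm ((g1 \<circ> g2) x - (f1 \<circ> f2) x) < \<tau>" by (simp add: y_def z_def)
      have nG2: "norm (G2 x) \<le> B2 + 1"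
        using norm_triangle_sub[of "G2 x" "F2 x"] G2(3)[OF x] B2(2)[OF x] \<epsilon>le by linarith
      have split: "(G1 y o\<^sub>L G2 x) - (F1 z o\<^sub>L F2 x)
         = ((G1 y - F1 y) o\<^sub>L G2 x) + ((F1 y - F1 z) o\<^sub>L G2 x) + (F1 z o\<^sub>L (G2 x - F2 x))"
        by (rule blinfun_eqI) (simp add: blinfun.diff_left blinfun.diff_right blinfun.add_left)
      have "norm ((G1 y o\<^sub>L G2 x) - (F1 z o\<^sub>L F2 x)) \<le>
         norm ((G1 y - F1 y) o\<^sub>L G2 x) + norm ((F1 y - F1 z) o\<^sub>L G2 x) + norm (F1 z o\<^sub>L (G2 x - F2 x))"
        unfolding split by (intro norm_triangle_le add_mono norm_triangle_ineq order_refl)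
      also have "\<dots> \<le> norm (G1 y - F1 y) * norm (G2 x) + norm (F1 y - F1 z) * norm (G2 x) + norm (F1 z) * norm (G2 x - F2 x)"
        by (intro add_mono norm_blinfun_compose)
      also have "\<dots> \<le> \<mu> * (B2 + 1) + \<mu> * (B2 + 1) + B1 * (\<tau> / (4 * B1))"
      proof (intro add_mono mult_mono nG2)
        show "norm (G1 y - F1 y) \<le> \<mu>" using G1(3)[OF yz(1)] \<epsilon>le by simp
        show "norm (F1 y - F1 z) \<le> \<mu>" using \<eta>2(2)[OF yz] dyz \<epsilon>le by (simp add: dist_norm)
        show "norm (F1 z) \<le> B1" by (rule B1(2)[OF yz(2)])
        show "norm (G2 x - F2 x) \<le> \<tau> / (4 * B1)" using G2(3)[OF x] \<epsilon>le by simp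
      qed (use \<mu> B1 in auto)
      also have "\<dots> = 3 * \<tau> / 4"
      proof -
        have "B2 + 1 \<noteq> 0" using B2(1) by simp
        then have "\<mu> * (B2 + 1) = \<tau> / 4" unfolding \<mu>_def by (metis nonzero_mult_divide_mult_cancel_right times_divide_eq_left)
        moreover have "B1 * (\<tau> / (4 * B1)) = \<tau> / 4" using B1(1) by simp
        ultimately show ?thesis by simp
      qed
      also have "\<dots> < \<tau>" using \<tau> by simp
      finally show "norm ((G1 (radext g2 x) o\<^sub>L G2 x) - (F1 (radext f2 x) o\<^sub>L F2 x)) < \<tau>"
        using radext_sph[OF x] by (simp add: y_def z_def)
    qed
    then show ?thesis unfolding C1_close_def
      using sph_deriv_compose[OF G1(1) G2(1) g2(2)] sph_deriv_compose[OF F1 F2] by blast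
  qed
  then show ?thesis using \<epsilon> by blast
qed

lemma proj_action_compose:
  assumes "det B \<noteq> 0"
  shows "proj_action A \<circ> proj_action B = proj_action (A ** B)"
proof
  fix x
  show "(proj_action A \<circ> proj_action B) x = proj_action (A ** B) x"
  proof (cases "x = 0")
    case False
    then show ?thesis using proj_action_mult[OF mult_nonzero[OF assms False]] by simp
  qed (simp add: proj_action_def)
qed

text \<open>The closeness that \<open>C1_close_compose\<close> asks of the inner factor becomes the
  accuracy demanded from the shorter word; hence the induction with \<tau> arbitrary.\<close>

lemma C1_close_words:
  fixes A :: "'i \<Rightarrow> real^'n^'n"
  assumes A: "\<And>i. i \<in> I \<Longrightarrow> det (A i) = 1" and w: "w \<in> lists I" and "\<tau> > 0"
  shows "\<exists>\<epsilon>>0. \<forall>g. (\<forall>i\<in>I. g i ` sph \<subseteq> sph \<and> C1_close \<epsilon> (g i) (proj_action (A i)))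
     \<longrightarrow> C1_close \<tau> (word_map g w) (proj_action (word_mat A w))"
  using w \<open>\<tau> > 0\<close>
proof (induction w arbitrary: \<tau>)
  case Nil
  \<comment> \<open>\<open>id\<close> and the action of \<open>mat 1\<close> agree on the sphere but
    not off it; their radial extensions, through which derivatives are measured, coincide.\<close>
  have "radext id = radext (proj_action (mat 1 :: real^'n^'n))"
    unfolding radext_proj_action by (simp add: radext_def proj_action_def fun_eq_iff)
  moreover have m: "sph_deriv (proj_action (mat 1 :: real^'n^'n)) (proj_deriv (mat 1))"
    by (rule sph_deriv_proj_action) simp
  ultimately have "sph_deriv id (proj_deriv (mat 1 :: real^'n^'n))" by (simp add: sph_deriv_def)
  moreover have "proj_action (mat 1 :: real^'n^'n) x = id x" if "x \<in> sph" for x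
    using that by (simp add: proj_action_def sph_iff)
  ultimately have "C1_close \<tau> id (proj_action (mat 1 :: real^'n^'n))"
    unfolding C1_close_def using m Nil
    by (intro exI[of _ "proj_deriv (mat 1)"] conjI ballI) simp_all
  then have "C1_close \<tau> (word_map g []) (proj_action (word_mat A []))" for g
    by (simp only: word_map.simps word_mat.simps)
  then show ?case using zero_less_one by blast
next
  case (Cons i w)
  then have i: "i \<in> I" and w: "w \<in> lists I" by auto
  have dw: "det (word_mat A w) = 1" by (rule det_word_mat[OF A w])
  have "\<exists>\<epsilon>>0. \<forall>g1 g2. C1_close \<epsilon> g1 (proj_action (A i)) \<longrightarrow> C1_close \<epsilon> g2 (proj_action (word_mat A w))
    \<longrightarrow> g2 ` sph \<subseteq> sph \<longrightarrow> C1_close \<tau> (g1 \<circ> g2) (proj_action (A i) \<circ> proj_action (word_mat A w))"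
    by (rule C1_close_compose[OF sph_deriv_proj_action sph_deriv_proj_action])
       (use A[OF i] dw Cons.prems proj_action_in_sph[of "word_mat A w"] in auto)
  then obtain \<epsilon>1 where \<epsilon>1: "\<epsilon>1 > 0"
    "\<And>g1 g2. C1_close \<epsilon>1 g1 (proj_action (A i)) \<Longrightarrow> C1_close \<epsilon>1 g2 (proj_action (word_mat A w))
      \<Longrightarrow> g2 ` sph \<subseteq> sph \<Longrightarrow> C1_close \<tau> (g1 \<circ> g2) (proj_action (A i) \<circ> proj_action (word_mat A w))"
    by auto
  obtain \<epsilon>2 where \<epsilon>2: "\<epsilon>2 > 0" "\<And>g. (\<forall>i\<in>I. g i ` sph \<subseteq> sph \<and> C1_close \<epsilon>2 (g i) (proj_action (A i)))
     \<Longrightarrow> C1_close \<epsilon>1 (word_map g w) (proj_action (word_mat A w))"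
    using Cons.IH[OF \<epsilon>1(1)] by auto
  have "C1_close \<tau> (word_map g (i # w)) (proj_action (word_mat A (i # w)))"
    if g: "\<forall>i\<in>I. g i ` sph \<subseteq> sph \<and> C1_close (min \<epsilon>1 \<epsilon>2) (g i) (proj_action (A i))" for g
  proof -
    have "word_map g v ` sph \<subseteq> sph" if "v \<in> lists I" for v
      using that by (induction v) (use g in \<open>auto simp: image_subset_iff\<close>)
    moreover have "C1_close \<epsilon>1 (word_map g w) (proj_action (word_mat A w))"
      by (rule \<epsilon>2(2)) (use g in \<open>auto intro: C1_close_mono\<close>)
    moreover have "C1_close \<epsilon>1 (g i) (proj_action (A i))"
      using g i by (auto intro: C1_close_mono)
    ultimately have "C1_close \<tau> (g i \<circ> word_map g w) (proj_action (A i) \<circ> proj_action (word_mat A w))"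
      using w by (intro \<epsilon>1(2)) auto
    then show ?thesis using proj_action_compose[of "word_mat A w" "A i"] dw by simp
  qed
  moreover have "min \<epsilon>1 \<epsilon>2 > 0" using \<epsilon>1(1) \<epsilon>2(1) by simp
  ultimately show ?case by blast
qed

section \<open>Rotated copies of one contraction\<close>

lemma proj_action_orthogonal:
  assumes "orthogonal_matrix R"
  shows "proj_action (R ** B) x = R *v proj_action B x"
  by (simp add: proj_action_def matrix_vector_mul_assoc[symmetric] matrix_vector_mult_scaleR
      norm_orthogonal_matrix_mult[OF assms])

text \<open>A rotation applied last is an isometry: it moves the image without spoiling the
  contraction.\<close>

lemma norm_proj_deriv_orthogonal:
  fixes R B :: "real^'n^'n"
  assumes "orthogonal_matrix R"
  shows "norm (proj_deriv (R ** B) x) \<le> norm (proj_deriv B x)"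
proof (rule norm_blinfun_bound)
  fix u
  have ot: "orthogonal_transformation ((*v) R)"
    using assms orthogonal_transformation_matrix[of "(*v) R"] by simp
  have n: "norm (R *v y) = norm y" and ip: "(R *v y) \<bullet> (R *v z) = y \<bullet> z" for y z
    using ot by (simp_all add: orthogonal_transformation, simp add: orthogonal_transformation_def)
  have "proj_deriv (R ** B) x u = R *v proj_deriv B x u"
    unfolding proj_deriv_apply proj_deriv_fun_def matrix_vector_mul_assoc[symmetric] n ip
    by (simp add: matrix_vector_mult_scaleR matrix_vector_mult_diff_distrib)
  then have "norm (proj_deriv (R ** B) x u) = norm (proj_deriv B x u)" by (simp add: n)
  also have "\<dots> \<le> norm (proj_deriv B x) * norm u" by (rule norm_blinfun)
  finally show "norm (proj_deriv (R ** B) x u) \<le> norm (proj_deriv B x) * norm u" .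
qed simp

lemma inj_on_proj_action:
  fixes B :: "real^'n^'n"
  assumes det: "det B \<noteq> 0"
  shows "inj_on (proj_action B) sph"
proof (rule inj_onI)
  fix x y :: "real^'n" assume xy: "x \<in> sph" "y \<in> sph" and e: "proj_action B x = proj_action B y"
  have x0: "x \<noteq> 0" and y0: "y \<noteq> 0" using xy by (auto simp: sph_iff)
  have Bx: "B *v x \<noteq> 0" "B *v y \<noteq> 0" using mult_nonzero[OF det] x0 y0 by auto
  define c where "c = norm (B *v x) / norm (B *v y)"
  have c: "c > 0" using Bx by (simp add: c_def)
  have "B *v x = norm (B *v x) *\<^sub>R proj_action B x" using Bx by (simp add: proj_action_def)
  also have "\<dots> = c *\<^sub>R (B *v y)" unfolding e using Bx by (simp add: proj_action_def c_def divide_inverse)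
  finally have "B *v (x - c *\<^sub>R y) = 0"
    by (simp add: matrix_vector_mult_diff_distrib matrix_vector_mult_scaleR)
  then have "x = c *\<^sub>R y" using mult_nonzero[OF det, of "x - c *\<^sub>R y"] by auto
  moreover have "c = 1" using \<open>x = c *\<^sub>R y\<close> xy c by (simp add: sph_iff)
  ultimately show "x = y" by simp
qed

text \<open>Continuity of the inverse at f v in quantitative form: away from v the distance to f v
  has a positive minimum. It serves to locate preimages under perturbed maps.\<close>

lemma inj_on_compact_separates:
  fixes f :: "'a::metric_space \<Rightarrow> 'b::metric_space"
  assumes "compact S" "continuous_on S f" "inj_on f S" "v \<in> S" "r > 0"
  shows "\<exists>\<sigma>>0. \<forall>u\<in>S. dist (f u) (f v) < \<sigma> \<longrightarrow> dist u v < r"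
proof -
  define K where "K = S \<inter> {u. dist u v \<ge> r}"
  have "closed {u. dist u v \<ge> r}" by (intro closed_Collect_le continuous_intros)
  then have K: "compact K" unfolding K_def by (rule compact_Int_closed[OF assms(1)])
  show ?thesis
  proof (cases "K = {}")
    case True
    then have "\<forall>u\<in>S. dist u v < r" by (auto simp: K_def)
    then show ?thesis by (intro exI[of _ 1]) auto
  next
    case False
    have "continuous_on K (\<lambda>u. dist (f u) (f v))"
      by (intro continuous_intros continuous_on_subset[OF assms(2)]) (auto simp: K_def)
    then obtain u where u: "u \<in> K" "\<And>z. z \<in> K \<Longrightarrow> dist (f u) (f v) \<le> dist (f z) (f v)"
      using continuous_attains_inf[OF K False] by metis
    have "u \<noteq> v" using u(1) assms(5) by (auto simp: K_def)
    then have pos: "dist (f u) (f v) > 0"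
      using u(1) assms(3,4) by (auto simp: K_def dest: inj_onD)
    have "dist z v < r" if "z \<in> S" "dist (f z) (f v) < dist (f u) (f v)" for z
    proof (rule ccontr)
      assume "\<not> dist z v < r"
      then have "z \<in> K" using that by (auto simp: K_def)
      then show False using u(2)[of z] that(2) by simp
    qed
    then show ?thesis using pos by blast
  qed
qed

lemma orthogonal_word_mat:
  assumes "\<And>i. i \<in> I \<Longrightarrow> orthogonal_matrix (A i)" "w \<in> lists I"
  shows "orthogonal_matrix (word_mat A w)"
  using assms(2) by (induction w) (simp_all add: orthogonal_matrix_id orthogonal_matrix_mul assms(1))

text \<open>\<open>SO\<close> is transitive on the sphere, positive words are dense in it, and
  compactness leaves finitely many of them.\<close>

lemma finite_rotation_net:
  fixes A :: "nat \<Rightarrow> real^'n^'n"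
  assumes card: "CARD('n) \<ge> 2" and SO: "\<forall>i\<in>{1..k}. A i \<in> SO"
    and dense: "SO \<subseteq> closure (gen_group A {1..k})" and p: "p \<in> sph" and r: "r > 0"
  obtains W where "finite W" "W \<subseteq> lists {1..k}" "\<And>z. z \<in> sph \<Longrightarrow> \<exists>w\<in>W. dist (word_mat A w *v p) z < r"
proof -
  note SOCl = SO_subset_closure_words[OF SO dense]
  have net: "\<exists>w\<in>lists {1..k}. z \<in> ball (word_mat A w *v p) r" if z: "z \<in> sph" for z
  proof -
    have pz: "norm p = norm z" using p z by (simp add: sph_iff)
    obtain f where f: "orthogonal_transformation f" "det (matrix f) = 1" "f p = z"
      by (fact rotation_exists[OF card pz])
    have lf: "linear f" using f(1) by (rule orthogonal_transformation_linear)
    have "matrix f \<in> SO" using f orthogonal_transformation_matrix[of f] by (simp add: SO_def)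
    then have "matrix f \<in> closure (word_mat A ` lists {1..k})" using SOCl by blast
    then obtain x where x: "\<And>n::nat. x n \<in> word_mat A ` lists {1..k}" "x \<longlonglongrightarrow> matrix f"
      unfolding closure_sequential by auto
    have "(\<lambda>n. x n *v p) \<longlonglongrightarrow> matrix f *v p" by (rule tendsto_matrix_vector_mult[OF x(2)])
    then have "(\<lambda>n. x n *v p) \<longlonglongrightarrow> z" using f(3) lf by (simp add: matrix_works)
    from tendstoD[OF this r] obtain n where "dist (x n *v p) z < r"
      by (auto simp: eventually_sequentially)
    moreover obtain w where "w \<in> lists {1..k}" "x n = word_mat A w" using x(1)[of n] by auto
    ultimately show ?thesis by auto
  qed
  have cover: "sph \<subseteq> (\<Union>w\<in>lists {1..k}. ball (word_mat A w *v p) r)"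
  proof
    fix z :: "real^'n" assume "z \<in> sph"
    then obtain w where w: "w \<in> lists {1..k}" "z \<in> ball (word_mat A w *v p) r" using net by blast
    show "z \<in> (\<Union>w\<in>lists {1..k}. ball (word_mat A w *v p) r)" by (rule UN_I[OF w(1)]) (rule w(2))
  qed
  obtain W where W: "W \<subseteq> lists {1..k}" "finite W" "sph \<subseteq> (\<Union>w\<in>W. ball (word_mat A w *v p) r)"
    by (rule compactE_image[OF compact_sph open_ball cover])
  show ?thesis
  proof (rule that[OF W(2,1)])
    fix z :: "real^'n" assume "z \<in> sph"
    then have "z \<in> (\<Union>w\<in>W. ball (word_mat A w *v p) r)" by (rule subsetD[OF W(3)])
    then show "\<exists>w\<in>W. dist (word_mat A w *v p) z < r" by simp
  qed
qed

text \<open>Every word in \<open>W\<close> begins by applying the same contracting word, so one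
  centre, one radius and one rate serve them all; the rotations applied afterwards carry the image
  of v to a net of the sphere. All bounds are first fixed with slack for the unperturbed action, and
  \<epsilon> comes last.\<close>

lemma robust_contracting_cover:
  fixes A :: "nat \<Rightarrow> real^'n^'n"
  assumes card: "CARD('n) \<ge> 2" and SO: "\<forall>i\<in>{1..k}. A i \<in> SO"
    and dense: "SO \<subseteq> closure (gen_group A {1..k})"
    and A0: "det (A 0) = 1" "A 0 \<notin> SO"
  obtains W v \<delta> \<kappa> \<epsilon> where "finite W" "W \<subseteq> lists {..k}" "v \<in> sph" "\<delta> > 0" "0 < \<kappa>" "\<kappa> < 1" "\<epsilon> > 0"
    "\<And>g w y z. \<lbrakk>\<forall>i\<le>k. diffeo_sph (g i) \<and> C1_close \<epsilon> (g i) (proj_action (A i)); w \<in> W; y \<in> sph; z \<in> sph;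
       dist y v \<le> 2*\<delta>; dist z v \<le> 2*\<delta>\<rbrakk> \<Longrightarrow> dist (word_map g w y) (word_map g w z) \<le> \<kappa> * dist y z"
    "\<And>g z. \<lbrakk>\<forall>i\<le>k. diffeo_sph (g i) \<and> C1_close \<epsilon> (g i) (proj_action (A i)); z \<in> sph\<rbrakk>
       \<Longrightarrow> \<exists>w\<in>W. \<exists>u\<in>sph. dist u v < \<delta>/2 \<and> word_map g w u = z"
proof -
  have detA: "det (A i) = 1" if "i \<in> {..k}" for i
    using SO A0 that by (cases i) (auto simp: SO_def)
  obtain b v where b: "b \<in> lists {..k}" and v: "v \<in> sph" and c0: "norm (proj_deriv (word_mat A b) v) < 1"
    by (fact exists_contracting_word[OF card SO dense A0])
  define B where "B = word_mat A b"
  have dB: "det B = 1" unfolding B_def by (rule det_word_mat[OF detA b])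
  have dB0: "det B \<noteq> 0" using dB by simp
  have nv: "norm v = 1" using v by (simp add: sph_iff)
  \<comment> \<open>A chain of bounds below 1: \<kappa>1 for the derivative near \<open>v\<close>,
    \<kappa>2 = \<kappa>1 + \<tau> after a perturbation, and \<open>m\<close> between \<kappa>2 and
    1 as lower bound for the norm on chords, which yields the rate \<kappa>2 / m.\<close>
  define \<kappa>1 where "\<kappa>1 = (1 + norm (proj_deriv B v)) / 2"
  have \<kappa>1: "norm (proj_deriv B v) < \<kappa>1" "0 < \<kappa>1" "\<kappa>1 < 1"
    using c0 norm_ge_zero[of "proj_deriv B v"] unfolding \<kappa>1_def B_def[symmetric]
    by (simp_all only: field_simps)
  define \<tau> where "\<tau> = (1 - \<kappa>1) / 2"
  define \<kappa>2 where "\<kappa>2 = \<kappa>1 + \<tau>"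
  define m where "m = (1 + \<kappa>2) / 2"
  define \<kappa> where "\<kappa> = \<kappa>2 / m"
  have \<tau>: "\<tau> > 0" using \<kappa>1 by (simp add: \<tau>_def)
  have \<kappa>2: "0 < \<kappa>2" "\<kappa>2 < 1" using \<kappa>1(2,3) by (simp_all add: \<kappa>2_def \<tau>_def field_simps)
  have m: "m > 0" "\<kappa>2 < m" "m < 1" using \<kappa>2 by (auto simp: m_def)
  have \<kappa>: "0 < \<kappa>" "\<kappa> < 1" using \<kappa>2 m by (auto simp: \<kappa>_def)
  have "continuous_on sph (\<lambda>y. norm (proj_deriv B y))"
    by (intro continuous_on_norm sph_deriv_continuous_on(2)[OF sph_deriv_proj_action[OF dB0]])
  then have "((\<lambda>y. norm (proj_deriv B y)) \<longlongrightarrow> norm (proj_deriv B v)) (at v within sph)"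
    using v by (simp add: continuous_on_def)
  from order_tendstoD(2)[OF this \<kappa>1(1)]
  obtain r where r: "r > 0" "\<And>y. y \<in> sph \<Longrightarrow> y \<noteq> v \<Longrightarrow> dist y v < r \<Longrightarrow> norm (proj_deriv B y) < \<kappa>1"
    unfolding eventually_at by auto
  have near: "norm (proj_deriv B y) < \<kappa>1" if "y \<in> sph" "dist y v < r" for y
    using r(2)[OF that(1) _ that(2)] \<kappa>1(1) by (cases "y = v") auto
  \<comment> \<open>Points of chords within 2 * \<delta> of \<open>v\<close> have norm at least 1 -
    2 * \<delta> \<ge> m, and radial projection moves them by at most another 2 * \<delta>, so they
    end up within 4 * \<delta> < r of \<open>v\<close>.\<close>
  define \<delta> where "\<delta> = min (r / 8) ((1 - m) / 2)"
  have \<delta>: "\<delta> > 0" "4 * \<delta> < r" "1 - 2 * \<delta> \<ge> m" using r m by (auto simp: \<delta>_def min_def field_simps)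
  obtain \<sigma> where \<sigma>: "\<sigma> > 0" "\<And>u. u \<in> sph \<Longrightarrow> dist (proj_action B u) (proj_action B v) < \<sigma> \<Longrightarrow> dist u v < \<delta>/2"
    using inj_on_compact_separates[OF compact_sph sph_deriv_continuous_on(1)[OF sph_deriv_proj_action[OF dB0]]
        inj_on_proj_action[OF dB0] v, of "\<delta>/2"] \<delta>(1) by auto
  have pv: "proj_action B v \<in> sph" by (rule proj_action_in_sph[OF dB0 v])
  have \<sigma>2: "\<sigma>/2 > 0" using \<sigma>(1) by simp
  obtain V where V: "finite V" "V \<subseteq> lists {1..k}"
    "\<And>z. z \<in> sph \<Longrightarrow> \<exists>w\<in>V. dist (word_mat A w *v proj_action B v) z < \<sigma>/2"
    by (fact finite_rotation_net[OF card SO dense pv \<sigma>2])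
  define W where "W = (\<lambda>w. w @ b) ` V"
  have fW: "finite W" using V(1) by (simp add: W_def)
  have "{1..k} \<subseteq> {..k}" by auto
  then have Vk: "V \<subseteq> lists {..k}" using V(2) lists_mono by blast
  have Wk: "W \<subseteq> lists {..k}"
  proof
    fix w assume "w \<in> W"
    then obtain w' where w': "w' \<in> V" "w = w' @ b" by (auto simp: W_def)
    have "w' \<in> lists {..k}" using Vk w'(1) by (rule subsetD)
    then show "w \<in> lists {..k}" using b w'(2) by (simp only: append_in_lists_conv)
  qed
  have orth: "orthogonal_matrix (word_mat A w)" if "w \<in> V" for w
  proof (rule orthogonal_word_mat)
    show "w \<in> lists {1..k}" using V(2) that by (rule subsetD)
    show "orthogonal_matrix (A i)" if "i \<in> {1..k}" for i using SO that by (auto simp: SO_def)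
  qed
  \<comment> \<open>\<tau> protects the derivative. The bound \<sigma>/2 on the displacement of
    points and the \<sigma>/2 of the net add up to \<sigma>.\<close>
  define \<tau>' where "\<tau>' = min \<tau> (\<sigma>/2)"
  have \<tau>': "\<tau>' > 0" using \<tau> \<sigma> by (simp add: \<tau>'_def)
  have "\<forall>w\<in>W. \<exists>\<epsilon>>0. \<forall>g. (\<forall>i\<in>{..k}. g i ` sph \<subseteq> sph \<and> C1_close \<epsilon> (g i) (proj_action (A i)))
     \<longrightarrow> C1_close \<tau>' (word_map g w) (proj_action (word_mat A w))"
  proof
    fix w assume "w \<in> W"
    then have "w \<in> lists {..k}" using Wk by blast
    then show "\<exists>\<epsilon>>0. \<forall>g. (\<forall>i\<in>{..k}. g i ` sph \<subseteq> sph \<and> C1_close \<epsilon> (g i) (proj_action (A i)))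
     \<longrightarrow> C1_close \<tau>' (word_map g w) (proj_action (word_mat A w))"
      by (intro C1_close_words detA \<tau>')
  qed
  then obtain e where e: "\<And>w. w \<in> W \<Longrightarrow> e w > 0"
    "\<And>w g. w \<in> W \<Longrightarrow> (\<forall>i\<in>{..k}. g i ` sph \<subseteq> sph \<and> C1_close (e w) (g i) (proj_action (A i)))
     \<Longrightarrow> C1_close \<tau>' (word_map g w) (proj_action (word_mat A w))"
    by metis
  define \<epsilon> where "\<epsilon> = Min (insert 1 (e ` W))"
  have \<epsilon>: "\<epsilon> > 0" using fW e(1) by (simp add: \<epsilon>_def)
  have \<epsilon>le: "\<epsilon> \<le> e w" if "w \<in> W" for w using fW that by (simp add: \<epsilon>_def)
  have close: "C1_close \<tau>' (word_map g w) (proj_action (word_mat A w))"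
    if g: "\<forall>i\<le>k. diffeo_sph (g i) \<and> C1_close \<epsilon> (g i) (proj_action (A i))" and w: "w \<in> W" for g w
  proof (rule e(2)[OF w], rule ballI, rule conjI)
    fix i assume "i \<in> {..k}"
    then have i: "diffeo_sph (g i)" "C1_close \<epsilon> (g i) (proj_action (A i))" using g by auto
    show "g i ` sph \<subseteq> sph" using i(1) by (simp add: diffeo_sph_def C1_sph_def)
    show "C1_close (e w) (g i) (proj_action (A i))" by (rule C1_close_mono[OF i(2) \<epsilon>le[OF w]])
  qed
  have contr: "dist (word_map g w y) (word_map g w z) \<le> \<kappa> * dist y z"
    if g: "\<forall>i\<le>k. diffeo_sph (g i) \<and> C1_close \<epsilon> (g i) (proj_action (A i))" and w: "w \<in> W"
      and y: "y \<in> sph" and z: "z \<in> sph" and d: "dist y v \<le> 2*\<delta>" "dist z v \<le> 2*\<delta>" for g w y z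
  proof -
    obtain w' where w': "w' \<in> V" "w = w' @ b" using w by (auto simp: W_def)
    have wk: "w \<in> lists {..k}" using Wk w by (rule subsetD)
    have dw: "det (word_mat A w) \<noteq> 0" using det_word_mat[OF detA wk] by simp
    obtain G where G: "sph_deriv (word_map g w) G"
      "\<And>x. x \<in> sph \<Longrightarrow> norm (word_map g w x - proj_action (word_mat A w) x) < \<tau>'"
      "\<And>x. x \<in> sph \<Longrightarrow> norm (G x - proj_deriv (word_mat A w) x) < \<tau>'"
      by (fact C1_closeD[OF close[OF g w] sph_deriv_proj_action[OF dw]])
    have Gle: "norm (G q) \<le> \<kappa>2" if q: "q \<in> sph" "dist q v < r" for q
    proof -
      have "norm (proj_deriv (word_mat A w) q) \<le> norm (proj_deriv B q)"
        unfolding w' word_mat_append B_def by (rule norm_proj_deriv_orthogonal[OF orth[OF w'(1)]])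
      then have "norm (proj_deriv (word_mat A w) q) < \<kappa>1" using near[OF q] by simp
      moreover have "norm (G q - proj_deriv (word_mat A w) q) < \<tau>" using G(3)[OF q(1)] by (simp add: \<tau>'_def)
      ultimately show ?thesis
        using norm_triangle_sub[of "G q" "proj_deriv (word_mat A w) q"] by (simp add: \<kappa>2_def)
    qed
    have "dist (word_map g w y) (word_map g w z) \<le> \<kappa>2 / m * dist y z"
    proof (rule sph_deriv_lipschitz_segment[OF G(1) y z m(1)])
      fix q assume q: "q \<in> closed_segment y z"
      have dq: "dist q v \<le> 2*\<delta>" "norm q \<ge> 1 - 2*\<delta>" using norm_segment_ge[OF q d nv] by auto
      have nq: "norm q \<ge> m" using dq(2) \<delta>(3) by simp
      have q0: "q \<noteq> 0" using nq m(1) by auto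
      have "norm q \<le> norm v + 2*\<delta>" using norm_triangle_sub[of q v] dq(1) by (simp add: dist_norm)
      then have "\<bar>1 - norm q\<bar> \<le> 2*\<delta>" using dq(2) nv by simp
      moreover have "dist (q /\<^sub>R norm q) q = \<bar>1 - norm q\<bar>"
      proof -
        define e where "e = q /\<^sub>R norm q"
        have e: "norm q *\<^sub>R e = q" "norm e = 1" using q0 by (simp_all add: e_def)
        have "dist e (norm q *\<^sub>R e) = norm ((1 - norm q) *\<^sub>R e)" by (simp add: dist_norm scaleR_diff_left)
        then show ?thesis unfolding e_def[symmetric] e(1) by (simp add: e(2))
      qed
      ultimately have "dist (q /\<^sub>R norm q) v \<le> 4 * \<delta>"
        using dist_triangle[of "q /\<^sub>R norm q" v q] dq(1) by linarith
      then have "norm (G (q /\<^sub>R norm q)) \<le> \<kappa>2"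
        using \<delta>(2) by (intro Gle normalize_in_sph[OF q0]) simp
      then show "m \<le> norm q \<and> norm (G (q /\<^sub>R norm q)) \<le> \<kappa>2" using nq by simp
    qed
    then show ?thesis by (simp add: \<kappa>_def)
  qed
  have cov: "\<exists>w\<in>W. \<exists>u\<in>sph. dist u v < \<delta>/2 \<and> word_map g w u = z"
    if g: "\<forall>i\<le>k. diffeo_sph (g i) \<and> C1_close \<epsilon> (g i) (proj_action (A i))" and z: "z \<in> sph" for g z
  proof -
    obtain w' where w': "w' \<in> V" "dist (word_mat A w' *v proj_action B v) z < \<sigma>/2" using V(3)[OF z] by auto
    define w where "w = w' @ b"
    have w: "w \<in> W" using w'(1) by (simp add: W_def w_def)
    have wk: "w \<in> lists {..k}" using Wk w by (rule subsetD)
    \<comment> \<open>Bijectivity supplies a preimage of \<open>z\<close> at once, in place of a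
      quantitative inverse function argument; closeness and the choice of \<sigma> then show that it
      lies near \<open>v\<close>.\<close>
    have "bij_betw (word_map g w) sph sph"
      by (rule bij_betw_word_map[OF _ wk]) (use g in \<open>auto simp: diffeo_sph_def\<close>)
    then have "z \<in> word_map g w ` sph" using z by (simp add: bij_betw_def)
    then obtain u where u: "u \<in> sph" "word_map g w u = z" by auto
    have dw: "det (word_mat A w) \<noteq> 0" using det_word_mat[OF detA wk] by simp
    obtain G where G: "sph_deriv (word_map g w) G"
      "\<And>x. x \<in> sph \<Longrightarrow> norm (word_map g w x - proj_action (word_mat A w) x) < \<tau>'"
      "\<And>x. x \<in> sph \<Longrightarrow> norm (G x - proj_deriv (word_mat A w) x) < \<tau>'"
      by (fact C1_closeD[OF close[OF g w] sph_deriv_proj_action[OF dw]])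
    define R where "R = word_mat A w'"
    have oR: "orthogonal_matrix R" unfolding R_def by (rule orth[OF w'(1)])
    have act: "proj_action (word_mat A w) x = R *v proj_action B x" for x
      unfolding w_def word_mat_append R_def B_def by (rule proj_action_orthogonal[OF oR[unfolded R_def]])
    have "dist z (R *v proj_action B u) < \<sigma>/2"
      using G(2)[OF u(1)] u(2) by (simp add: act dist_norm \<tau>'_def)
    moreover have "dist (R *v proj_action B v) z < \<sigma>/2" using w'(2) by (simp add: R_def)
    ultimately have "dist (R *v proj_action B u) (R *v proj_action B v) < \<sigma>"
      using dist_triangle[of "R *v proj_action B u" "R *v proj_action B v" z]
        dist_commute[of z "R *v proj_action B u"] dist_commute[of "R *v proj_action B v" z] by linarith
    moreover have "dist (R *v a) (R *v c) = dist a c" for a c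
      using norm_orthogonal_matrix_mult[OF oR, of "a - c"]
      by (simp add: dist_norm matrix_vector_mult_diff_distrib)
    ultimately have "dist u v < \<delta>/2" using \<sigma>(2)[OF u(1)] by simp
    then show ?thesis using w u by blast
  qed
  show ?thesis by (rule that[OF fW Wk v \<delta>(1) \<kappa> \<epsilon> contr cov])
qed

section \<open>Minimality and ergodicity\<close>

lemma orbit_of_word_map:
  assumes "y \<in> orbit_of g I x" "w \<in> lists I"
  shows "word_map g w y \<in> orbit_of g I x"
  using assms(2) by (induction w) (use assms(1) in \<open>auto intro: orbit_of.fwd\<close>)

lemma orbit_of_word_map_backward:
  assumes "\<And>i. i \<in> I \<Longrightarrow> bij_betw (g i) sph sph" "w \<in> lists I" "u \<in> sph" "word_map g w u \<in> orbit_of g I x"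
  shows "u \<in> orbit_of g I x"
  using assms(2,4)
proof (induction w)
  case Nil
  then show ?case by simp
next
  case (Cons i w)
  then have i: "i \<in> I" and w: "w \<in> lists I" by auto
  have "bij_betw (word_map g w) sph sph" by (rule bij_betw_word_map[OF assms(1) w])
  then have s: "word_map g w u \<in> sph" using assms(3) by (auto simp: bij_betw_def)
  have "g i (word_map g w u) \<in> orbit_of g I x" using Cons.prems by simp
  then have "inv_into sph (g i) (g i (word_map g w u)) \<in> orbit_of g I x"
    using i by (rule orbit_of.bwd)
  then have "word_map g w u \<in> orbit_of g I x"
    using inv_into_f_f[OF bij_betw_imp_inj_on[OF assms(1)[OF i]] s] by simp
  then show ?case by (rule Cons.IH)
qed

text \<open>The word grows from the side applied first: z has a preimage y near v under some w in W,
  induction provides a word leading close to y, and applying w last multiplies the error by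
  \<kappa>. The error never exceeds \<delta>, so the intermediate points remain within 2 * \<delta>
  of v, where w contracts.\<close>

lemma contracting_words_near:
  fixes g :: "'i \<Rightarrow> 'a::metric_space \<Rightarrow> 'a"
  assumes W: "W \<subseteq> lists I" and \<delta>: "\<delta> > 0" and \<kappa>: "0 < \<kappa>" "\<kappa> < 1"
    and bij: "\<And>w. w \<in> lists I \<Longrightarrow> bij_betw (word_map g w) S S"
    and contr: "\<And>w y z. w \<in> W \<Longrightarrow> y \<in> S \<Longrightarrow> z \<in> S \<Longrightarrow> dist y v \<le> 2*\<delta> \<Longrightarrow> dist z v \<le> 2*\<delta>
        \<Longrightarrow> dist (word_map g w y) (word_map g w z) \<le> \<kappa> * dist y z"
    and cov: "\<And>z. z \<in> S \<Longrightarrow> \<exists>w\<in>W. \<exists>u\<in>S. dist u v < \<delta>/2 \<and> word_map g w u = z"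
    and z: "z \<in> S"
  shows "\<exists>w\<in>lists I. \<forall>u\<in>S. dist u v < \<delta>/2 \<longrightarrow> dist (word_map g w u) z \<le> \<kappa>^n * \<delta>"
  using z
proof (induction n arbitrary: z)
  case 0
  obtain w y where w: "w \<in> W" "y \<in> S" "dist y v < \<delta>/2" "word_map g w y = z" using cov[OF 0] by auto
  have "dist (word_map g w u) z \<le> \<delta>" if u: "u \<in> S" "dist u v < \<delta>/2" for u
  proof -
    have "dist (word_map g w u) (word_map g w y) \<le> \<kappa> * dist u y"
      using w u \<delta> by (intro contr) auto
    also have "\<dots> \<le> 1 * dist u y" using \<kappa> by (intro mult_right_mono) auto
    also have "\<dots> \<le> \<delta>" using dist_triangle2[of u y v] w(3) u(2) by simp
    finally show ?thesis using w(4) by simp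
  qed
  then show ?case using w(1) W by auto
next
  case (Suc n)
  obtain w y where w: "w \<in> W" "y \<in> S" "dist y v < \<delta>/2" "word_map g w y = z" using cov[OF Suc.prems] by auto
  obtain w' where w': "w' \<in> lists I" "\<And>u. u \<in> S \<Longrightarrow> dist u v < \<delta>/2 \<Longrightarrow> dist (word_map g w' u) y \<le> \<kappa>^n * \<delta>"
    using Suc.IH[OF w(2)] by auto
  have "dist (word_map g (w @ w') u) z \<le> \<kappa>^Suc n * \<delta>" if u: "u \<in> S" "dist u v < \<delta>/2" for u
  proof -
    define q where "q = word_map g w' u"
    have q: "q \<in> S" using bij[OF w'(1)] u(1) by (auto simp: q_def bij_betw_def)
    have dq: "dist q y \<le> \<kappa>^n * \<delta>" unfolding q_def by (rule w'(2)[OF u])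
    have "\<kappa>^n * \<delta> \<le> 1 * \<delta>" using \<kappa> \<delta> by (intro mult_right_mono power_le_one) auto
    then have "dist q v \<le> 2*\<delta>" using dist_triangle[of q v y] dq w(3) \<delta> by linarith
    then have "dist (word_map g w q) (word_map g w y) \<le> \<kappa> * dist q y"
      using w \<delta> by (intro contr q) auto
    also have "\<dots> \<le> \<kappa> * (\<kappa>^n * \<delta>)" using dq \<kappa> by (intro mult_left_mono) auto
    finally show ?thesis using w(4) by (simp add: word_map_append q_def mult.assoc)
  qed
  moreover have "w @ w' \<in> lists I" using w(1) w'(1) W by auto
  ultimately show ?case by blast
qed

lemma minimal_action_of_contracting_cover:
  fixes g :: "'i \<Rightarrow> real^'n \<Rightarrow> real^'n"
  assumes W: "W \<subseteq> lists I" and \<delta>: "\<delta> > 0" and \<kappa>: "0 < \<kappa>" "\<kappa> < 1"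
    and bij: "\<And>i. i \<in> I \<Longrightarrow> bij_betw (g i) sph sph"
    and contr: "\<And>w y z. w \<in> W \<Longrightarrow> y \<in> sph \<Longrightarrow> z \<in> sph \<Longrightarrow> dist y v \<le> 2*\<delta> \<Longrightarrow> dist z v \<le> 2*\<delta>
        \<Longrightarrow> dist (word_map g w y) (word_map g w z) \<le> \<kappa> * dist y z"
    and cov: "\<And>z. z \<in> sph \<Longrightarrow> \<exists>w\<in>W. \<exists>u\<in>sph. dist u v < \<delta>/2 \<and> word_map g w u = z"
  shows "minimal_action g I"
  unfolding minimal_action_def
proof (intro ballI subsetI)
  fix x z :: "real^'n" assume x: "x \<in> sph" and z: "z \<in> sph"
  obtain w0 u where w0: "w0 \<in> W" "u \<in> sph" "dist u v < \<delta>/2" "word_map g w0 u = x" using cov[OF x] by auto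
  have w0I: "w0 \<in> lists I" using w0(1) W by blast
  have u: "u \<in> orbit_of g I x"
    by (rule orbit_of_word_map_backward[OF bij w0I w0(2)]) (simp_all add: w0(4) orbit_of.base)
  show "z \<in> closure (orbit_of g I x)"
    unfolding closure_approachable
  proof (intro allI impI)
    fix e :: real assume e: "e > 0"
    have "(\<lambda>n. \<kappa>^n * \<delta>) \<longlonglongrightarrow> 0 * \<delta>"
      by (intro tendsto_intros LIMSEQ_power_zero) (use \<kappa> in auto)
    then have "\<forall>\<^sub>F n in sequentially. \<kappa>^n * \<delta> < e"
      by (rule order_tendstoD) (use e in auto)
    then obtain n where n: "\<kappa>^n * \<delta> < e" by (auto simp: eventually_sequentially)
    have "\<exists>w\<in>lists I. \<forall>u\<in>sph. dist u v < \<delta>/2 \<longrightarrow> dist (word_map g w u) z \<le> \<kappa>^n * \<delta>"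
    proof (rule contracting_words_near[OF W \<delta> \<kappa> _ _ _ z])
      show "bij_betw (word_map g w) sph sph" if "w \<in> lists I" for w by (rule bij_betw_word_map[OF bij that])
    qed (fact contr, fact cov)
    then obtain w where w: "w \<in> lists I" "dist (word_map g w u) z \<le> \<kappa>^n * \<delta>" using w0 by auto
    then show "\<exists>y\<in>orbit_of g I x. dist y z < e"
      using n orbit_of_word_map[OF u w(1)] by (intro bexI[of _ "word_map g w u"]) auto
  qed
qed

text \<open>What the ergodicity argument needs of a map, in a form closed under composition. The
  Jacobian enters only through its change of variables formula, so for composites the chain rule
  reduces to the product J2 y * J1 (h2 y), without differentiating again.\<close>

definition tame :: "real \<Rightarrow> (real^'n \<Rightarrow> real^'n) \<Rightarrow> bool" where
  "tame \<alpha> h \<longleftrightarrow> h ` sph \<subseteq> sph \<and> (\<exists>L. \<forall>y\<in>sph. \<forall>z\<in>sph. dist (h y) (h z) \<le> L * dist y z) \<and>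
     (\<exists>J. (\<forall>y\<in>sph. J y \<ge> 0) \<and> holder_on \<alpha> sph J \<and>
       (\<forall>\<phi>\<in>borel_measurable sphere_measure.
          (\<integral>\<^sup>+y. ennreal (J y) * \<phi> (h y) \<partial>sphere_measure) = integral\<^sup>N sphere_measure \<phi>))"

lemma tame_measurable:
  assumes "tame \<alpha> h"
  shows "h \<in> measurable sphere_measure sphere_measure"
proof (rule measurable_sphere_map)
  obtain L where L: "\<forall>y\<in>sph. \<forall>z\<in>sph. dist (h y) (h z) \<le> L * dist y z" using assms by (auto simp: tame_def)
  show "continuous_on sph h" by (rule lipschitz_continuous_on) (use L in blast)
  show "h ` sph \<subseteq> sph" using assms by (simp add: tame_def)
qed

lemma tame_id: "tame \<alpha> id"
proof -
  have "\<exists>L. \<forall>y\<in>sph. \<forall>z\<in>sph. dist (id y) (id z) \<le> L * dist y z" by (intro exI[of _ 1]) simp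
  moreover have "(\<integral>\<^sup>+y. ennreal 1 * \<phi> (id y) \<partial>sphere_measure) = integral\<^sup>N sphere_measure \<phi>" for \<phi> :: "real^'a \<Rightarrow> ennreal"
    by simp
  ultimately show ?thesis unfolding tame_def
    by (intro conjI exI[of _ "\<lambda>_. 1"] ballI holder_on_const) auto
qed

lemma tame_compose:
  fixes h1 h2 :: "real^'n \<Rightarrow> real^'n"
  assumes \<alpha>: "\<alpha> > 0" and t1: "tame \<alpha> h1" and t2: "tame \<alpha> h2"
  shows "tame \<alpha> (h1 \<circ> h2)"
proof -
  have s1: "h1 y \<in> sph" and s2: "h2 y \<in> sph" if "y \<in> sph" for y using t1 t2 that by (auto simp: tame_def)
  obtain L1 where L1: "\<forall>y\<in>sph. \<forall>z\<in>sph. dist (h1 y) (h1 z) \<le> L1 * dist y z" using t1 by (auto simp: tame_def)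
  obtain L2 where L2: "\<forall>y\<in>sph. \<forall>z\<in>sph. dist (h2 y) (h2 z) \<le> L2 * dist y z" using t2 by (auto simp: tame_def)
  obtain J1 where J1: "\<forall>y\<in>sph. J1 y \<ge> 0" "holder_on \<alpha> sph J1"
    "\<And>\<phi>. \<phi> \<in> borel_measurable sphere_measure \<Longrightarrow>
       (\<integral>\<^sup>+y. ennreal (J1 y) * \<phi> (h1 y) \<partial>sphere_measure) = integral\<^sup>N sphere_measure \<phi>"
    using t1 unfolding tame_def by auto
  obtain J2 where J2: "\<forall>y\<in>sph. J2 y \<ge> 0" "holder_on \<alpha> sph J2"
    "\<And>\<phi>. \<phi> \<in> borel_measurable sphere_measure \<Longrightarrow>
       (\<integral>\<^sup>+y. ennreal (J2 y) * \<phi> (h2 y) \<partial>sphere_measure) = integral\<^sup>N sphere_measure \<phi>"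
    using t2 unfolding tame_def by auto
  define J where "J y = J2 y * J1 (h2 y)" for y
  have "\<forall>y\<in>sph. \<forall>z\<in>sph. dist ((h1 \<circ> h2) y) ((h1 \<circ> h2) z) \<le> (max 0 L1 * L2) * dist y z"
  proof (intro ballI)
    fix y z :: "real^'n" assume yz: "y \<in> sph" "z \<in> sph"
    have "dist (h1 (h2 y)) (h1 (h2 z)) \<le> L1 * dist (h2 y) (h2 z)" using L1 s2 yz by blast
    also have "\<dots> \<le> max 0 L1 * dist (h2 y) (h2 z)" by (intro mult_right_mono) auto
    also have "\<dots> \<le> max 0 L1 * (L2 * dist y z)" using L2 yz by (intro mult_left_mono) auto
    finally show "dist ((h1 \<circ> h2) y) ((h1 \<circ> h2) z) \<le> (max 0 L1 * L2) * dist y z" by (simp add: mult.assoc)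
  qed
  moreover have "(h1 \<circ> h2) ` sph \<subseteq> sph" using s1 s2 by auto
  moreover have "\<forall>y\<in>sph. J y \<ge> 0" using J1(1) J2(1) s2 by (auto simp: J_def)
  moreover have "holder_on \<alpha> sph J" unfolding J_def
    by (rule holder_on_mult[OF J2(2) holder_on_compose[OF J1(2) \<alpha>, where L=L2]]) (use s2 L2 in blast)+
  moreover have "(\<integral>\<^sup>+y. ennreal (J y) * \<phi> ((h1 \<circ> h2) y) \<partial>sphere_measure) = integral\<^sup>N sphere_measure \<phi>"
    if \<phi>: "\<phi> \<in> borel_measurable sphere_measure" for \<phi>
  proof -
    have "(\<lambda>y. ennreal (J1 y)) \<in> borel_measurable sphere_measure"
      by (rule measurable_compose[OF continuous_measurable_sphere[OF holder_on_continuous_on[OF J1(2) \<alpha>]] measurable_ennreal])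
    then have m: "(\<lambda>y. ennreal (J1 y) * \<phi> (h1 y)) \<in> borel_measurable sphere_measure"
      by (rule borel_measurable_times_ennreal) (rule measurable_compose[OF tame_measurable[OF t1] \<phi>])
    have "(\<integral>\<^sup>+y. ennreal (J y) * \<phi> ((h1 \<circ> h2) y) \<partial>sphere_measure)
        = (\<integral>\<^sup>+y. ennreal (J2 y) * (ennreal (J1 (h2 y)) * \<phi> (h1 (h2 y))) \<partial>sphere_measure)"
      using J1(1) J2(1) s2
      by (intro nn_integral_cong) (simp add: J_def space_sphere_measure ennreal_mult mult.assoc)
    also have "\<dots> = (\<integral>\<^sup>+y. ennreal (J1 y) * \<phi> (h1 y) \<partial>sphere_measure)" by (rule J2(3)[OF m])
    also have "\<dots> = integral\<^sup>N sphere_measure \<phi>" by (rule J1(3)[OF \<phi>])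
    finally show ?thesis .
  qed
  ultimately show ?thesis unfolding tame_def by blast
qed

lemma tame_diffeo:
  fixes g :: "real^'n \<Rightarrow> real^'n"
  assumes \<alpha>: "0 < \<alpha>" "\<alpha> \<le> 1" and bij: "bij_betw g sph sph" and C1: "C1_sph g" and H: "holder_C1 \<alpha> g"
  shows "tame \<alpha> g"
proof -
  obtain D C where D: "sph_deriv g D" "\<forall>x\<in>sph. \<forall>y\<in>sph. norm (D x - D y) \<le> C * dist x y powr \<alpha>"
    using H by (auto simp: holder_C1_def)
  have J: "holder_on \<alpha> sph (sphere_jacobian g D)"
    by (rule sphere_jacobian_holder[OF C1 D(1) \<alpha>]) (use D(2) in blast)
  have cJ: "continuous_on sph (sphere_jacobian g D)" by (rule holder_on_continuous_on[OF J \<alpha>(1)])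
  obtain L where L: "L > 0" "\<And>p q. p \<in> sph \<Longrightarrow> q \<in> sph \<Longrightarrow> dist (g p) (g q) \<le> L * dist p q"
    by (fact C1_sph_lipschitz[OF C1])
  have 1: "g ` sph \<subseteq> sph" using C1 by (simp add: C1_sph_def)
  have 2: "\<exists>L. \<forall>y\<in>sph. \<forall>z\<in>sph. dist (g y) (g z) \<le> L * dist y z"
    by (intro exI[of _ L] ballI L(2))
  have 3: "\<forall>y\<in>sph. sphere_jacobian g D y \<ge> 0" by (simp add: sphere_jacobian_def)
  have 4: "\<forall>\<phi>\<in>borel_measurable sphere_measure.
          (\<integral>\<^sup>+y. ennreal (sphere_jacobian g D y) * \<phi> (g y) \<partial>sphere_measure) = integral\<^sup>N sphere_measure \<phi>"
    by (intro ballI sphere_change_of_variables[OF bij C1 D(1) cJ])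
  show ?thesis unfolding tame_def
    by (intro conjI 1 2 exI[of _ "sphere_jacobian g D"] 3 J 4)
qed

lemma tame_word_map:
  assumes "\<alpha> > 0" "\<And>l. l \<in> I \<Longrightarrow> tame \<alpha> (h l)" "w \<in> lists I"
  shows "tame \<alpha> (word_map h w)"
  using assms(3)
proof (induction w)
  case Nil
  show ?case unfolding word_map.simps by (rule tame_id)
next
  case (Cons l w)
  then show ?case unfolding word_map.simps using assms(2) by (intro tame_compose[OF assms(1)]) auto
qed

text \<open>Change of variables along k, a right inverse of h, turns the integral of \<phi> (h y)
  into that of J y * \<phi> y, where the Jacobian J of k is bounded.\<close>

lemma tame_pullback_bounded:
  fixes h k :: "real^'n \<Rightarrow> real^'n"
  assumes h: "tame \<alpha> h" and k: "tame \<alpha> k" and hk: "\<And>y. y \<in> sph \<Longrightarrow> h (k y) = y"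
  shows "\<exists>C\<ge>0. \<forall>\<phi>\<in>borel_measurable sphere_measure.
          (\<integral>\<^sup>+y. \<phi> (h y) \<partial>sphere_measure) \<le> ennreal C * integral\<^sup>N sphere_measure \<phi>"
proof -
  obtain J where J: "\<forall>y\<in>sph. J y \<ge> 0" "holder_on \<alpha> sph J"
    "\<And>\<phi>. \<phi> \<in> borel_measurable sphere_measure \<Longrightarrow>
       (\<integral>\<^sup>+y. ennreal (J y) * \<phi> (k y) \<partial>sphere_measure) = integral\<^sup>N sphere_measure \<phi>"
    using k unfolding tame_def by auto
  obtain B C where B: "B \<ge> 0" "C \<ge> 0" "\<And>x. x \<in> sph \<Longrightarrow> \<bar>J x\<bar> \<le> B"
    "\<And>x y. x \<in> sph \<Longrightarrow> y \<in> sph \<Longrightarrow> \<bar>J x - J y\<bar> \<le> C * dist x y powr \<alpha>"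
    by (fact holder_onE[OF J(2)])
  have "(\<integral>\<^sup>+y. \<phi> (h y) \<partial>sphere_measure) \<le> ennreal B * integral\<^sup>N sphere_measure \<phi>"
    if \<phi>: "\<phi> \<in> borel_measurable sphere_measure" for \<phi>
  proof -
    have m: "(\<lambda>y. \<phi> (h y)) \<in> borel_measurable sphere_measure"
      by (rule measurable_compose[OF tame_measurable[OF h] \<phi>])
    have "(\<integral>\<^sup>+y. \<phi> (h y) \<partial>sphere_measure) = (\<integral>\<^sup>+y. ennreal (J y) * \<phi> (h (k y)) \<partial>sphere_measure)"
      by (rule J(3)[OF m, symmetric])
    also have "\<dots> \<le> (\<integral>\<^sup>+y. ennreal B * \<phi> y \<partial>sphere_measure)"
    proof (rule nn_integral_mono)
      fix y :: "real^'n" assume "y \<in> space sphere_measure"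
      then have y: "y \<in> sph" by (simp add: space_sphere_measure)
      then have "J y \<le> B" using B(3)[OF y] by simp
      then show "ennreal (J y) * \<phi> (h (k y)) \<le> ennreal B * \<phi> y"
        unfolding hk[OF y] by (intro mult_right_mono ennreal_leI) auto
    qed
    also have "\<dots> = ennreal B * integral\<^sup>N sphere_measure \<phi>" by (rule nn_integral_cmult[OF \<phi>])
    finally show ?thesis .
  qed
  then show ?thesis using B(1) by blast
qed

section \<open>Words in the generators and their inverses\<close>

definition letter :: "('i \<Rightarrow> real^'n \<Rightarrow> real^'n) \<Rightarrow> 'i \<times> bool \<Rightarrow> real^'n \<Rightarrow> real^'n" where
  "letter g l = (if snd l then g (fst l) else inv_into sph (g (fst l)))"

definition inverse_word :: "('i \<times> bool) list \<Rightarrow> ('i \<times> bool) list" where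
  "inverse_word w = rev (map (\<lambda>l. (fst l, \<not> snd l)) w)"

lemma inverse_word_inverse_word: "inverse_word (inverse_word w) = w"
  by (simp add: inverse_word_def rev_map o_def)

lemma inverse_word_lists: "w \<in> lists (I \<times> UNIV) \<Longrightarrow> inverse_word w \<in> lists (I \<times> UNIV)"
  unfolding inverse_word_def in_lists_conv_set by (force simp: mem_Times_iff)

lemma letter_simps [simp]: "letter g (i, True) = g i" "letter g (i, False) = inv_into sph (g i)"
  by (simp_all add: letter_def)

lemma word_map_letter_positive: "word_map (letter g) (map (\<lambda>i. (i, True)) w) = word_map g w"
  by (induction w) simp_all

lemma letter_facts:
  assumes "bij_betw (g i) sph sph"
  shows "bij_betw (letter g (i, b)) sph sph" "y \<in> sph \<Longrightarrow> letter g (i, \<not> b) (letter g (i, b) y) = y"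
proof -
  have inj: "inj_on (g i) sph" and im: "g i ` sph = sph" using assms by (auto simp: bij_betw_def)
  show "bij_betw (letter g (i, b)) sph sph"
    using assms bij_betw_inv_into[OF assms] by (simp add: letter_def)
  show "y \<in> sph \<Longrightarrow> letter g (i, \<not> b) (letter g (i, b) y) = y"
    using inv_into_f_f[OF inj, of y] f_inv_into_f[of y "g i" sph] im by (simp add: letter_def)
qed

lemma word_map_inverse_word:
  assumes bij: "\<And>i. i \<in> I \<Longrightarrow> bij_betw (g i) sph sph" and w: "w \<in> lists (I \<times> UNIV)" and y: "y \<in> sph"
  shows "word_map (letter g) (inverse_word w) (word_map (letter g) w y) = y"
  using w
proof (induction w)
  case Nil
  show ?case by (simp add: inverse_word_def)
next
  case (Cons l w)
  obtain i b where l: "l = (i, b)" by (cases l)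
  have i: "i \<in> I" and w: "w \<in> lists (I \<times> UNIV)" using Cons.hyps l by auto
  have "bij_betw (word_map (letter g) w) sph sph"
    by (rule bij_betw_word_map[OF _ w]) (auto intro: letter_facts(1) bij)
  then have s: "word_map (letter g) w y \<in> sph" using y by (auto simp: bij_betw_def)
  have "inverse_word (l # w) = inverse_word w @ [(i, \<not> b)]" by (simp add: inverse_word_def l)
  then have "word_map (letter g) (inverse_word (l # w)) (word_map (letter g) (l # w) y)
     = word_map (letter g) (inverse_word w) (letter g (i, \<not> b) (letter g (i, b) (word_map (letter g) w y)))"
    by (simp add: word_map_append l)
  also have "\<dots> = y" unfolding letter_facts(2)[where b=b and g=g and i=i, OF bij[OF i] s] by (rule Cons.IH)
  finally show ?case .
qed

lemma orbit_of_subset_words: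
  assumes "y \<in> orbit_of g I x"
  shows "\<exists>w\<in>lists (I \<times> UNIV). y = word_map (letter g) w x"
  using assms
proof induction
  case base
  show ?case by (intro bexI[of _ "[]"]) simp_all
next
  case (fwd y i)
  then obtain w where "w \<in> lists (I \<times> UNIV)" "y = word_map (letter g) w x" by auto
  then show ?case using fwd by (intro bexI[of _ "(i, True) # w"]) simp_all
next
  case (bwd y i)
  then obtain w where "w \<in> lists (I \<times> UNIV)" "y = word_map (letter g) w x" by auto
  then show ?case using bwd by (intro bexI[of _ "(i, False) # w"]) simp_all
qed

text \<open>The cone over an invariant set \<open>E\<close> is merely Lebesgue measurable, while the
  measure on the sphere lives on Borel sets. Therefore \<open>E\<close> is replaced by the union
  \<open>F\<close> of the images of a compact subset under the countably many words in generators
  and inverses: \<open>F\<close> is Borel, invariant and contained in \<open>E\<close>, so it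
  suffices that its complement is null.\<close>

lemma ergodic_action_of_contracting_cover:
  fixes g :: "'i::countable \<Rightarrow> real^'n \<Rightarrow> real^'n"
  assumes \<alpha>: "0 < \<alpha>" "\<alpha> \<le> 1" and diffeo: "\<And>i. i \<in> I \<Longrightarrow> C1alpha_diffeo \<alpha> (g i)"
    and W: "finite W" "W \<subseteq> lists I" and \<delta>: "\<delta> > 0" and \<kappa>: "0 < \<kappa>" "\<kappa> < 1"
    and contr: "\<And>w y z. w \<in> W \<Longrightarrow> y \<in> sph \<Longrightarrow> z \<in> sph \<Longrightarrow> dist y v \<le> 2*\<delta> \<Longrightarrow> dist z v \<le> 2*\<delta>
        \<Longrightarrow> dist (word_map g w y) (word_map g w z) \<le> \<kappa> * dist y z"
    and cov: "\<And>z. z \<in> sph \<Longrightarrow> \<exists>w\<in>W. \<exists>u\<in>sph. dist u v < \<delta>/2 \<and> word_map g w u = z"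
  shows "ergodic_action g I"
  unfolding ergodic_action_def
proof (intro allI impI)
  fix E :: "(real^'n) set"
  assume "E \<subseteq> sph \<and> cone_sph E \<in> sets lebesgue \<and> (\<forall>i\<in>I. g i ` E = E)"
  then have E: "E \<subseteq> sph" "cone_sph E \<in> sets lebesgue" and invE: "\<And>i. i \<in> I \<Longrightarrow> g i ` E = E" by auto
  define L where "L = lists (I \<times> (UNIV :: bool set))"
  define G where "G = word_map (letter g)"
  have bij: "bij_betw (g i) sph sph" if "i \<in> I" for i
    using diffeo[OF that] by (simp add: C1alpha_diffeo_def diffeo_sph_def)
  have tame_letter: "tame \<alpha> (letter g l)" if "l \<in> I \<times> UNIV" for l
  proof -
    obtain i b where l: "l = (i, b)" by (cases l)
    have i: "i \<in> I" using that l by simp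
    have d: "C1_sph (g i)" "C1_sph (inv_into sph (g i))" "holder_C1 \<alpha> (g i)" "holder_C1 \<alpha> (inv_into sph (g i))"
      using diffeo[OF i] by (simp_all add: C1alpha_diffeo_def diffeo_sph_def)
    show ?thesis
      using tame_diffeo[OF \<alpha> bij[OF i] d(1,3)] tame_diffeo[OF \<alpha> bij_betw_inv_into[OF bij[OF i]] d(2,4)]
      by (cases b) (simp_all add: l)
  qed
  have tame_G: "tame \<alpha> (G w)" if "w \<in> L" for w
    using that unfolding G_def L_def by (intro tame_word_map[OF \<alpha>(1) tame_letter])
  have iL: "inverse_word w \<in> L" if "w \<in> L" for w using that unfolding L_def by (rule inverse_word_lists)
  have G_inv: "G (inverse_word w) (G w y) = y" if "w \<in> L" "y \<in> sph" for w y
    using that unfolding G_def L_def by (intro word_map_inverse_word[OF bij])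
  have G_inv': "G w (G (inverse_word w) y) = y" if "w \<in> L" "y \<in> sph" for w y
    using G_inv[OF iL[OF that(1)] that(2)] by (simp add: inverse_word_inverse_word)
  have G_sph: "G w y \<in> sph" if "w \<in> L" "y \<in> sph" for w y
    using tame_G[OF that(1)] that(2) by (auto simp: tame_def)
  show "emeasure lebesgue (cone_sph E) = 0 \<or> emeasure lebesgue (cone_sph (sph - E)) = 0"
  proof (cases "emeasure lebesgue (cone_sph E) = 0")
    case False
    obtain K where K: "compact K" "K \<subseteq> E" "emeasure sphere_measure K > 0"
      by (fact compact_subset_of_positive_cone[OF E False])
    have Ks: "K \<subseteq> sph" using K(2) E(1) by blast
    define F where "F = (\<Union>w\<in>L. G w ` K)"
    have FE: "F \<subseteq> E"
    proof -
      have "G w y \<in> E" if w: "w \<in> L" and y: "y \<in> E" for w y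
        using w unfolding L_def G_def
      proof (induction w)
        case (Cons l w)
        obtain i b where l: "l = (i, b)" by (cases l)
        have i: "i \<in> I" using Cons.hyps l by simp
        define q where "q = word_map (letter g) w y"
        have q: "q \<in> E" unfolding q_def by (rule Cons.IH)
        have "letter g l q \<in> E"
        proof (cases b)
          case True
          then show ?thesis using invE[OF i] q l by auto
        next
          case False
          obtain e where e: "e \<in> E" "q = g i e" using invE[OF i] q by blast
          have "inv_into sph (g i) q = e"
            unfolding e(2) by (rule inv_into_f_f[OF bij_betw_imp_inj_on[OF bij[OF i]]]) (use e(1) E(1) in blast)
          then show ?thesis using e(1) False l by simp
        qed
        then show ?case by (simp add: q_def)
      qed (simp add: y)
      then show ?thesis using K(2) by (auto simp: F_def)
    qed
    have F_sets: "F \<in> sets sphere_measure"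
    proof -
      have "countable L" unfolding L_def by (rule countable_lists) simp
      moreover have "G w ` K \<in> sets borel" if w: "w \<in> L" for w
      proof -
        have "continuous_on K (G w)"
        proof -
          obtain C where C: "\<forall>y\<in>sph. \<forall>z\<in>sph. dist (G w y) (G w z) \<le> C * dist y z"
            using tame_G[OF w] by (auto simp: tame_def)
          show ?thesis by (rule lipschitz_continuous_on) (use C Ks in blast)
        qed
        then have "compact (G w ` K)" by (rule compact_continuous_image[OF _ K(1)])
        then show ?thesis by (rule borel_compact)
      qed
      ultimately have "F \<in> sets borel" unfolding F_def by (intro sets.countable_UN') auto
      then show ?thesis using FE E(1) by (simp add: sets_sphere_measure_iff)
    qed
    have KF: "K \<subseteq> F"
    proof
      fix y assume "y \<in> K"
      then have "y \<in> G [] ` K" by (simp add: G_def)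
      moreover have "[] \<in> L" by (simp add: L_def)
      ultimately show "y \<in> F" unfolding F_def by (rule UN_I[rotated])
    qed
    have F_fwd: "G w y \<in> F" if w: "w \<in> L" and y: "y \<in> F" for w y
    proof -
      obtain u q where u: "u \<in> L" "q \<in> K" "y = G u q" using y by (auto simp: F_def)
      have "G w y = G (w @ u) q" using u(3) by (simp add: G_def word_map_append)
      moreover have "w @ u \<in> L" using w u(1) by (simp add: L_def)
      ultimately show ?thesis using u(2) by (auto simp: F_def)
    qed
    have F_iff: "G w y \<in> F \<longleftrightarrow> y \<in> F" if "w \<in> L" "y \<in> sph" for w y
      using F_fwd[OF iL[OF that(1)], of "G w y"] F_fwd[OF that(1), of y] G_inv[OF that] by auto
    define pos where "pos w = map (\<lambda>i. (i, True)) w" for w :: "'i list"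
    have posL: "pos w \<in> L" if "w \<in> W" for w
      using subsetD[OF W(2) that] by (auto simp: pos_def L_def)
    have G_pos: "G (pos w) = word_map g w" for w
      unfolding G_def pos_def by (rule word_map_letter_positive)
    have "\<forall>w\<in>W. \<exists>J. (\<forall>y\<in>sph. J y \<ge> 0) \<and> holder_on \<alpha> sph J \<and>
       (\<forall>\<phi>\<in>borel_measurable sphere_measure.
          (\<integral>\<^sup>+y. ennreal (J y) * \<phi> (G (pos w) y) \<partial>sphere_measure) = integral\<^sup>N sphere_measure \<phi>)"
      using tame_G[OF posL] by (simp add: tame_def)
    then obtain J where J: "\<And>w y. w \<in> W \<Longrightarrow> y \<in> sph \<Longrightarrow> J w y \<ge> 0" "\<And>w. w \<in> W \<Longrightarrow> holder_on \<alpha> sph (J w)"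
      "\<And>w \<phi>. w \<in> W \<Longrightarrow> \<phi> \<in> borel_measurable sphere_measure \<Longrightarrow>
          (\<integral>\<^sup>+y. ennreal (J w y) * \<phi> (G (pos w) y) \<partial>sphere_measure) = integral\<^sup>N sphere_measure \<phi>"
      by metis
    interpret contracting_cover sph sphere_measure W "\<lambda>w. G (pos w)" "\<lambda>w. G (inverse_word (pos w))" J v \<alpha> \<delta> \<kappa>
    proof (rule contracting_cover.intro)
      show "compact (sph :: (real^'n) set)" by (rule compact_sph)
      show "finite_measure (sphere_measure :: (real^'n) measure)" by (rule finite_sphere_measure)
      show "sets sphere_measure = sets (restrict_space borel (sph :: (real^'n) set))" by (rule sets_sphere_measure)
      show "finite W" by (rule W)
      show "0 < \<alpha>" "\<alpha> \<le> 1" "0 < \<delta>" "0 < \<kappa>" "\<kappa> < 1" by (fact \<alpha> \<delta> \<kappa>)+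
      fix w assume w: "w \<in> W"
      show "G (pos w) y \<in> sph" "G (inverse_word (pos w)) y \<in> sph" if "y \<in> sph" for y
        using G_sph posL[OF w] iL that by auto
      show "G (inverse_word (pos w)) (G (pos w) y) = y" if "y \<in> sph" for y by (rule G_inv[OF posL[OF w] that])
      show "\<exists>L. \<forall>y\<in>sph. \<forall>z\<in>sph. dist (G (pos w) y) (G (pos w) z) \<le> L * dist y z"
        using tame_G[OF posL[OF w]] by (simp add: tame_def)
      show "\<exists>L. \<forall>y\<in>sph. \<forall>z\<in>sph. dist (G (inverse_word (pos w)) y) (G (inverse_word (pos w)) z) \<le> L * dist y z"
        using tame_G[OF iL[OF posL[OF w]]] by (simp add: tame_def)
      show "J w y \<ge> 0" if "y \<in> sph" for y by (rule J(1)[OF w that])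
      show "holder_on \<alpha> sph (J w)" by (rule J(2)[OF w])
      show "(\<integral>\<^sup>+y. ennreal (J w y) * \<phi> (G (pos w) y) \<partial>sphere_measure) = integral\<^sup>N sphere_measure \<phi>"
        if "\<phi> \<in> borel_measurable sphere_measure" for \<phi> by (rule J(3)[OF w that])
      show "\<exists>C\<ge>0. \<forall>\<phi>\<in>borel_measurable sphere_measure.
          (\<integral>\<^sup>+y. \<phi> (G (pos w) y) \<partial>sphere_measure) \<le> ennreal C * integral\<^sup>N sphere_measure \<phi>"
        by (rule tame_pullback_bounded[OF tame_G[OF posL[OF w]] tame_G[OF iL[OF posL[OF w]]] G_inv'[OF posL[OF w]]])
      show "dist (G (pos w) y) (G (pos w) z) \<le> \<kappa> * dist y z"
        if "y \<in> sph" "z \<in> sph" "dist y v \<le> 2*\<delta>" "dist z v \<le> 2*\<delta>" for y z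
        unfolding G_pos by (rule contr[OF w that])
    next
      fix z :: "real^'n" assume "z \<in> sph"
      then obtain w u where w: "w \<in> W" "u \<in> sph" "dist u v < \<delta>/2" "word_map g w u = z" using cov by blast
      have "G (inverse_word (pos w)) z = u"
        using G_inv[OF posL[OF w(1)] w(2)] w(4) by (simp add: G_pos)
      then show "\<exists>w\<in>W. dist (G (inverse_word (pos w)) z) v < \<delta>/2" using w by auto
    qed
    obtain p r where p: "p \<in> sph" "r > 0" "emeasure sphere_measure (sph \<inter> ball p r - F) = 0"
      using invariant_contains_ball[OF F_sets K(1) KF K(3) F_iff[OF posL]] by blast
    have min: "minimal_action g I"
      by (rule minimal_action_of_contracting_cover[OF W(2) \<delta> \<kappa> bij contr cov])
    define N where "N = sph \<inter> ball p r - F"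
    have N_sets: "N \<in> sets sphere_measure"
      unfolding N_def by (rule sets.Diff[OF _ F_sets]) (simp add: sets_sphere_measure_iff sph_def)
    \<comment> \<open>Inverse words are tame too, so \<open>G w\<close> pushes the measure to at
      most a multiple of itself, and preimages of null sets are null.\<close>
    have null: "(\<lambda>y. G w y) -` N \<inter> sph \<in> null_sets sphere_measure" if w: "w \<in> L" for w
    proof (rule null_setsI)
      have m: "G w \<in> measurable sphere_measure sphere_measure" by (rule tame_measurable[OF tame_G[OF w]])
      show s: "(\<lambda>y. G w y) -` N \<inter> sph \<in> sets sphere_measure"
        using measurable_sets[OF m N_sets] by (simp add: space_sphere_measure)
      obtain C where C: "\<forall>\<phi>\<in>borel_measurable sphere_measure.
          (\<integral>\<^sup>+y. \<phi> (G w y) \<partial>sphere_measure) \<le> ennreal C * integral\<^sup>N sphere_measure \<phi>"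
        using tame_pullback_bounded[OF tame_G[OF w] tame_G[OF iL[OF w]] G_inv'[OF w]] by auto
      have "emeasure sphere_measure ((\<lambda>y. G w y) -` N \<inter> sph) = (\<integral>\<^sup>+y. indicator N (G w y) \<partial>sphere_measure)"
        unfolding nn_integral_indicator[OF s, symmetric]
        by (intro nn_integral_cong) (simp add: indicator_def space_sphere_measure)
      also have "\<dots> \<le> ennreal C * (\<integral>\<^sup>+y. indicator N y \<partial>sphere_measure)"
        using N_sets by (intro C[rule_format]) simp
      also have "\<dots> = 0" using N_sets p(3) by (simp add: N_def[symmetric])
      finally show "emeasure sphere_measure ((\<lambda>y. G w y) -` N \<inter> sph) = 0" by simp
    qed
    have "countable L" unfolding L_def by (rule countable_lists) simp
    then have UN: "(\<Union>w\<in>L. G w -` N \<inter> sph) \<in> null_sets sphere_measure"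
      by (rule null_sets_UN') (rule null)
    \<comment> \<open>An orbit starting outside \<open>F\<close> stays outside it and, by
      minimality, enters the ball around \<open>p\<close>, so it meets \<open>N\<close>. Hence the
      complement of \<open>F\<close> is covered by countably many null preimages of
      \<open>N\<close>.\<close>
    have sub: "sph - F \<subseteq> (\<Union>w\<in>L. G w -` N \<inter> sph)"
    proof
      fix s :: "real^'n" assume s: "s \<in> sph - F"
      have "p \<in> closure (orbit_of g I s)" using min s p(1) by (auto simp: minimal_action_def)
      then obtain y where y: "y \<in> orbit_of g I s" "dist y p < r" using p(2) by (auto simp: closure_approachable)
      obtain w where w: "w \<in> L" "y = G w s" using orbit_of_subset_words[OF y(1)] by (auto simp: L_def G_def)
      have "G w s \<in> N" unfolding N_def
        using F_iff[OF w(1)] G_sph[OF w(1)] s y(2) w(2) by (auto simp: dist_commute)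
      then show "s \<in> (\<Union>w\<in>L. G w -` N \<inter> sph)" using w(1) s by auto
    qed
    have cF: "sph - F \<in> sets sphere_measure" using sets.compl_sets[OF F_sets] by (simp add: space_sphere_measure)
    have "emeasure sphere_measure (sph - F) = 0"
      using null_sets_subset[OF UN cF sub] by (rule null_setsD1)
    then have z: "emeasure lebesgue (cone_sph (sph - F)) = 0" "cone_sph (sph - F) \<in> sets lebesgue"
      using emeasure_sphere_measure[OF cF] by simp_all
    have "cone_sph (sph - E) \<subseteq> cone_sph (sph - F)" using FE by (auto simp: cone_sph_def)
    then have "emeasure lebesgue (cone_sph (sph - E)) \<le> emeasure lebesgue (cone_sph (sph - F))"
      using z(2) by (rule emeasure_mono)
    then show ?thesis using z(1) by simp
  qed simp
qed

theorem mainTheorem15: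
  fixes A :: "nat \<Rightarrow> real^'n^'n" and k :: nat
  assumes "CARD('n) \<ge> 2"
    and "\<forall>i\<in>{1..k}. A i \<in> SO"
    and "SO \<subseteq> closure (gen_group A {1..k})"
    and "det (A 0) = 1" and "A 0 \<notin> SO"
  shows "(\<forall>\<alpha>::real. 0 < \<alpha> \<and> \<alpha> \<le> 1 \<longrightarrow>
            (\<exists>\<epsilon>>0. \<forall>g :: nat \<Rightarrow> real^'n \<Rightarrow> real^'n.
               (\<forall>i\<le>k. C1alpha_diffeo \<alpha> (g i) \<and> C1_close \<epsilon> (g i) (proj_action (A i)))
               \<longrightarrow> ergodic_action g {..k}))
       \<and> (\<exists>\<epsilon>>0. \<forall>g :: nat \<Rightarrow> real^'n \<Rightarrow> real^'n.
               (\<forall>i\<le>k. diffeo_sph (g i) \<and> C1_close \<epsilon> (g i) (proj_action (A i)))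
               \<longrightarrow> minimal_action g {..k})"
proof -
  \<comment> \<open>One \<epsilon> serves both claims and every \<alpha>: the cover depends on C^1
    closeness only. The Hoelder constants of the perturbed maps influence the radius \<rho> in the
    ergodicity argument, not \<epsilon>.\<close>
  obtain W v \<delta> \<kappa> \<epsilon> where W: "finite W" "W \<subseteq> lists {..k}" and v: "v \<in> sph" and \<delta>: "\<delta> > 0"
    and \<kappa>: "0 < \<kappa>" "\<kappa> < 1" and \<epsilon>: "\<epsilon> > 0"
    and contr: "\<And>g w y z. \<lbrakk>\<forall>i\<le>k. diffeo_sph (g i) \<and> C1_close \<epsilon> (g i) (proj_action (A i)); w \<in> W; y \<in> sph; z \<in> sph;
       dist y v \<le> 2*\<delta>; dist z v \<le> 2*\<delta>\<rbrakk> \<Longrightarrow> dist (word_map g w y) (word_map g w z) \<le> \<kappa> * dist y z"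
    and cov: "\<And>g z. \<lbrakk>\<forall>i\<le>k. diffeo_sph (g i) \<and> C1_close \<epsilon> (g i) (proj_action (A i)); z \<in> sph\<rbrakk>
       \<Longrightarrow> \<exists>w\<in>W. \<exists>u\<in>sph. dist u v < \<delta>/2 \<and> word_map g w u = z"
    by (fact robust_contracting_cover[OF assms])
  have minimal: "minimal_action g {..k}"
    if g: "\<forall>i\<le>k. diffeo_sph (g i) \<and> C1_close \<epsilon> (g i) (proj_action (A i))" for g
  proof (rule minimal_action_of_contracting_cover[OF W(2) \<delta> \<kappa> _ contr[OF g] cov[OF g]])
    show "bij_betw (g i) sph sph" if "i \<in> {..k}" for i using g that by (simp add: diffeo_sph_def)
  qed
  have ergodic: "ergodic_action g {..k}"
    if \<alpha>: "0 < \<alpha>" "\<alpha> \<le> 1" and g: "\<forall>i\<le>k. C1alpha_diffeo \<alpha> (g i) \<and> C1_close \<epsilon> (g i) (proj_action (A i))" for \<alpha> g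
  proof -
    have g': "\<forall>i\<le>k. diffeo_sph (g i) \<and> C1_close \<epsilon> (g i) (proj_action (A i))"
      using g by (simp add: C1alpha_diffeo_def)
    show ?thesis
    proof (rule ergodic_action_of_contracting_cover[OF \<alpha> _ W \<delta> \<kappa> contr[OF g'] cov[OF g']])
      show "C1alpha_diffeo \<alpha> (g i)" if "i \<in> {..k}" for i using g that by simp
    qed
  qed
  show ?thesis using minimal ergodic \<epsilon> by blast
qed

end
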